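(* Let $X_1, \dots, X_{n-1}$ be random vectors in $\mathbb{R}^n$ whose coordinates are independent copies of a centered subgaussian random variable $\xi$ of unit variance. There exist constants $\gamma\in(0,1)$, $\beta > 0$ and $c, c' > 0$, depending only on the distribution of $\xi$, such that, with $\alpha = \beta\sqrt n$ and $\mathrm{LCD}_\alpha$ defined with parameter $\gamma$, $$\mathbb{P}\big(\text{there exists a unit vector } Z \text{ orthogonal to } X_1,\dots,X_{n-1} \text{ with } \mathrm{LCD}_\alpha(Z) < e^{cn}\big) \le e^{-c'n}.$$
   Context: A real random variable $\xi$ is subgaussian if there exist constants $C, v > 0$ such that $\mathbb{P}(|\xi| > t) \le C e^{-v t^2}$ for all $t > 0$; centered means $\mathbb{E}\xi=0$. For $\alpha > 0$ and $a \in \mathbb{R}^n$, the essential least common denominator (with parameter $\gamma$) is $\mathrm{LCD}_\alpha(a) = \inf\{\theta > 0 : \mathrm{dist}(\theta a, \mathbb{Z}^n) < \min(\gamma\|\theta a\|_2, \alpha)\}$.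
   Formalization: The bound is proved for all n ≥ n0, with n0 depending only on the distribution of ξ; for n = 1 the claim is false (Z = ±1 has LCD < 1, so the probability is 1), and the cases 2 ≤ n < n0 follow by shrinking γ, c and c'. *)

theory Defs
  imports "HOL-Probability.Probability"
begin

text \<open>Vectors in R^n are represented as functions nat => real, only the
coordinates 0..n-1 being relevant.\<close>

definition vnorm :: "nat \<Rightarrow> (nat \<Rightarrow> real) \<Rightarrow> real" where
  "vnorm n a = sqrt (\<Sum>j<n. (a j)\<^sup>2)"

definition dist_lattice :: "nat \<Rightarrow> (nat \<Rightarrow> real) \<Rightarrow> real" where
  "dist_lattice n a = Inf {vnorm n (\<lambda>j. a j - of_int (p j)) | p :: nat \<Rightarrow> int. True}"

text \<open>Essential least common denominator with parameter gamma; the infimum of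
the empty set is +infinity (hence the values in ereal).\<close>
definition LCD :: "nat \<Rightarrow> real \<Rightarrow> real \<Rightarrow> (nat \<Rightarrow> real) \<Rightarrow> ereal" where
  "LCD n \<gamma> \<alpha> a = (INF \<theta> \<in> {\<theta>::real. \<theta> > 0 \<and>
      dist_lattice n (\<lambda>j. \<theta> * a j) < min (\<gamma> * vnorm n (\<lambda>j. \<theta> * a j)) \<alpha>}. ereal \<theta>)"

definition subgaussian :: "real measure \<Rightarrow> bool" where
  "subgaussian \<mu> \<longleftrightarrow> (\<exists>C v. C > 0 \<and> v > 0 \<and>
      (\<forall>t>0. measure \<mu> {x \<in> space \<mu>. \<bar>x\<bar> > t} \<le> C * exp (- v * t\<^sup>2)))"

end

theory Submission
  imports Defs
begin

text \<open>
  Let \<open>B\<close> be the matrix with rows \<open>X\<^sub>i\<close>. Outside an event of exponentially small probability its operator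
  norm is at most \<open>K sqrt n\<close>. If \<open>\<theta>\<close> is admissible in the definition of the LCD of a unit vector \<open>Z\<close> with
  \<open>B Z = 0\<close>, then \<open>Z\<close> is close to \<open>p / |p|\<close> for the integer vector \<open>p\<close> nearest to \<open>\<theta> Z\<close>, so that integer
  points form the nets.

  If \<open>\<theta> \<le> c0 sqrt n\<close>, there are only \<open>exp (2 \<delta> n)\<close> such \<open>p\<close>, while for a fixed unit vector \<open>x\<close> the
  probability that \<open>|B x|\<close> is a small multiple of \<open>sqrt n\<close> is at most about \<open>exp (- 4 \<delta> n)\<close>.

  If the first admissible \<open>\<theta>\<close> lies in \<open>[D, 2 D)\<close> with \<open>D \<ge> c0 sqrt n\<close>, there are at most
  \<open>(C D / sqrt n)\<^sup>n\<close> vectors \<open>p\<close>, each approximating \<open>Z\<close> up to \<open>\<beta> sqrt n / D\<close>. For a representative \<open>x\<close>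
  in the same level set, the Fourier transform gives \<open>E exp (- \<langle>X, x\<rangle>\<^sup>2 / t\<^sup>2) \<le> C t / \<gamma>\<close> at the scale
  \<open>t = 4 K \<beta> sqrt n / D\<close>, and the \<open>n - 1\<close> independent rows make the union bound
  \<open>(C \<beta> / \<gamma>)\<^bsup>n - 1\<^esup> D\<close>, which is exponentially small for small \<open>\<beta>\<close> as long as \<open>D \<le> exp (c n)\<close>.
\<close>

section \<open>Elementary inequalities\<close>

text \<open>The order in which the constants are fixed shapes the proof. For small denominators only
  the error \<open>\<gamma> \<theta>\<close> is used, never \<alpha>, so \<gamma> and
  \<open>c0\<close> are fixed before \<beta>; each row of the level-set bound then pays a multiple
  of \<open>\<beta> / \<gamma>\<close>, and \<beta> is chosen last, against all other constants.
  Normalised integer vectors are the net points only for small denominators. At a higher level the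
  small ball bound needs a point without admissible multiple below \<open>D\<close>, and
  \<open>p / |p|\<close> need not be one; so each \<open>p\<close> is traded for a nearby vector of
  the level set, which doubles the approximation error. Two things limit the height of the levels:
  the count has \<open>n\<close> factors against \<open>n - 1\<close> rows, so one factor stays
  uncancelled, and the small ball bound carries an additive error
  \<open>exp (- \<kappa> \<alpha>^2)\<close>, exponentially small in \<open>n\<close>, that has to
  stay below \<open>1 / D\<close>. Laplace transforms of \<open>\<langle>X, x\<rangle>^2\<close>
  take the place of small ball probabilities because they multiply over independent rows, so that no
  separate tensorization is required.\<close>

lemma exp_minus_le_quadratic:
  fixes y :: real
  assumes "0 \<le> y"
  shows "exp (- y) \<le> 1 - y + y\<^sup>2 / 2"
proof -
  have "\<exists>t. \<bar>t\<bar> \<le> \<bar>- y\<bar> \<and> exp (- y) = (\<Sum>m<3. (- y) ^ m / fact m) + exp t / fact 3 * (- y) ^ 3"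
    using Maclaurin_exp_le by blast
  then obtain t where "exp (- y) = (\<Sum>m<3. (- y) ^ m / fact m) + exp t / fact 3 * (- y) ^ 3"
    by blast
  moreover have "exp t / fact 3 * (- y) ^ 3 \<le> 0"
    using assms by simp
  ultimately show ?thesis
    by (simp add: numeral_3_eq_3 power2_eq_square)
qed

text \<open>The linear term vanishes on integrating a centered variable, which leaves an exponential
  of a square. For \<open>x > 1\<close> this is \<open>x <= x^2\<close>; near zero it follows from
  Taylor bounds, and for \<open>x < - 1\<close> from
  \<open>exp x <= 1 <= 1 + x + x^2\<close>.\<close>

lemma exp_le_add_exp_square: "exp x \<le> x + exp (x\<^sup>2)" for x :: real
proof -
  have sq: "1 + x\<^sup>2 \<le> exp (x\<^sup>2)" by simp
  consider "x > 1" | "0 \<le> x" "x \<le> 1" | "- 1 \<le> x" "x < 0" | "x < - 1" by linarith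
  then show ?thesis
  proof cases
    case 1
    then have "exp x \<le> exp (x\<^sup>2)" by (simp add: power2_eq_square)
    then show ?thesis using 1 by linarith
  next
    case 2
    then show ?thesis using exp_bound[of x] sq by linarith
  next
    case 3
    then have "exp x \<le> 1 + x + x\<^sup>2 / 2" using exp_minus_le_quadratic[of "- x"] by simp
    then show ?thesis using sq zero_le_power2[of x] by linarith
  next
    case 4
    then have "exp x \<le> 1" "0 \<le> x * (x + 1)" by (auto simp: mult_nonpos_nonpos)
    moreover have "x * (x + 1) = x\<^sup>2 + x" by (simp add: power2_eq_square algebra_simps)
    ultimately show ?thesis using sq by linarith
  qed
qed

text \<open>Fourth power of \<open>y / 4 <= exp (y / 4)\<close>, so the constant is
  \<open>4 ^ 4\<close>. Both signs appear so that the moment generating function at 1 and -1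
  controls a fourth moment.\<close>

lemma power4_le_exp_sum: "x ^ 4 \<le> 256 * (exp x + exp (- x))" for x :: real
proof -
  have *: "y ^ 4 \<le> 256 * exp y" if "0 \<le> y" for y :: real
  proof -
    have "(y / 4) ^ 4 \<le> exp (y / 4) ^ 4"
      using that exp_ge_add_one_self[of "y / 4"] by (intro power_mono) linarith+
    also have "exp (y / 4) ^ 4 = exp y" by (simp flip: exp_of_nat_mult)
    finally show ?thesis by (simp add: power_divide)
  qed
  show ?thesis
  proof (cases "0 \<le> x")
    case True
    then show ?thesis using *[of x] exp_gt_zero[of "- x"] by (simp del: exp_gt_zero)
  next
    case False
    then show ?thesis using *[of "- x"] exp_gt_zero[of x] by (simp del: exp_gt_zero)
  qed
qed

text \<open>With \<open>y^2 <= 10\<close> the quartic Taylor term takes at most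
  \<open>10 y^2 / 24\<close> away from \<open>y^2 / 2\<close>, which leaves
  \<open>y^2 / 12\<close>.\<close>

lemma one_minus_cos_ge:
  fixes y :: real
  assumes "\<bar>y\<bar> \<le> pi"
  shows "y\<^sup>2 / 12 \<le> 1 - cos y"
proof -
  obtain t where "cos y = (\<Sum>m<4. cos_coeff m * y ^ m) + (cos (t + 1/2 * real 4 * pi) / fact 4) * y ^ 4"
    using Maclaurin_cos_expansion[of y 4] by blast
  moreover have "(\<Sum>m<4. cos_coeff m * y ^ m) = 1 - y\<^sup>2 / 2"
  proof -
    have "{..<4::nat} = {0, 1, 2, 3}" by auto
    then show ?thesis by (simp add: cos_coeff_def fact_numeral)
  qed
  moreover have "(cos (t + 1/2 * real 4 * pi) / fact 4) * y ^ 4 \<le> (1 / fact 4) * y ^ 4"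
    by (intro mult_right_mono divide_right_mono) auto
  ultimately have c: "cos y \<le> 1 - y\<^sup>2 / 2 + y ^ 4 / 24"
    by (simp add: fact_numeral)
  have "y\<^sup>2 \<le> pi\<^sup>2" using assms by (metis abs_le_square_iff abs_of_nonneg pi_ge_zero)
  also have "pi\<^sup>2 \<le> (3.15)\<^sup>2" using pi_approx pi_ge_zero by (intro power_mono) auto
  finally have "y\<^sup>2 \<le> 10" by (simp add: power2_eq_square)
  then have "y\<^sup>2 * y\<^sup>2 \<le> 10 * y\<^sup>2" by (intro mult_right_mono) auto
  then have "y ^ 4 \<le> 10 * y\<^sup>2" by (simp flip: power_add)
  then show ?thesis using c by linarith
qed

text \<open>The lower bound has the cubic order of \<open>s - sin s\<close> at zero and its linear
  order at infinity. Divided by \<open>s^3\<close> it is a multiple of \<open>1 / (1 + s^2)\<close>,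
  which dominates \<open>exp (- s^2)\<close>.\<close>

lemma diff_sin_ge:
  fixes s :: real
  assumes "0 < s"
  shows "s ^ 3 / (12 * (1 + s\<^sup>2)) \<le> s - sin s"
proof (cases "s \<le> 2")
  case True
  have "\<bar>sin s - (\<Sum>m<5. sin_coeff m * s ^ m)\<bar> \<le> inverse (fact 5) * \<bar>s\<bar> ^ 5"
    by (rule Maclaurin_sin_bound)
  moreover have "(\<Sum>m<5. sin_coeff m * s ^ m) = s - s ^ 3 / 6"
  proof -
    have "{..<5::nat} = {0, 1, 2, 3, 4}" by auto
    then show ?thesis by (simp add: sin_coeff_def fact_numeral)
  qed
  ultimately have "\<bar>sin s - (s - s ^ 3 / 6)\<bar> \<le> s ^ 5 / 120"
    using assms by (simp add: fact_numeral)
  then have "sin s \<le> s - s ^ 3 / 6 + s ^ 5 / 120" by linarith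
  moreover have "s ^ 3 * s\<^sup>2 \<le> s ^ 3 * 4"
    using True assms power_mono[of s 2 2] by (intro mult_left_mono) auto
  then have "s ^ 5 \<le> 4 * s ^ 3" by (simp flip: power_add)
  ultimately have 1: "s ^ 3 / 12 \<le> s - sin s" using assms zero_less_power[of s 3] by linarith
  have "s ^ 3 / (12 * (1 + s\<^sup>2)) \<le> s ^ 3 / 12"
    using assms by (intro divide_left_mono) (auto simp: add_pos_nonneg)
  with 1 show ?thesis by linarith
next
  case False
  have "s ^ 3 \<le> s * (1 + s\<^sup>2)" using assms by (simp add: power2_eq_square power3_eq_cube algebra_simps)
  then have "s ^ 3 / (12 * (1 + s\<^sup>2)) \<le> s / 12"
    by (simp add: divide_simps add_pos_nonneg algebra_simps)
  also have "\<dots> \<le> s - sin s" using False sin_le_one[of s] by linarith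
  finally show ?thesis .
qed

text \<open>The kernel \<open>(1 - u)\<^sup>2\<close> on the unit interval has the cosine transform
  \<open>2 (s - sin s) / s\<^sup>3\<close>, which (unlike the Fejer kernel) has no zeros.\<close>

lemma exp_minus_square_le_cosine_transform:
  fixes s :: real
  shows "exp (- s\<^sup>2) \<le> 6 * (\<integral>u. ((1 - u)\<^sup>2 * cos (u * s)) * indicator {0..1} u \<partial>lborel)"
proof (cases "s = 0")
  case True
  have "(\<integral>u. (1 - u)\<^sup>2 * indicator {0..1} u \<partial>lborel) = - ((1 - 1) ^ 3 / 3) - (- ((1 - 0) ^ 3 / 3) :: real)"
    by (rule integral_FTC_Icc_real)
      (auto intro!: derivative_eq_intros simp: power2_eq_square field_simps)
  with True show ?thesis by simp
next
  case False
  have even: "(\<integral>u. ((1 - u)\<^sup>2 * cos (u * s)) * indicator {0..1} u \<partial>lborel)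
      = (\<integral>u. ((1 - u)\<^sup>2 * cos (u * \<bar>s\<bar>)) * indicator {0..1} u \<partial>lborel)"
    by (cases "0 \<le> s") auto
  define r where "r = \<bar>s\<bar>"
  have r: "0 < r" "r\<^sup>2 = s\<^sup>2" using False by (auto simp: r_def)
  define F where "F u = (1 - u)\<^sup>2 * sin (u * r) / r - 2 * (1 - u) * cos (u * r) / r\<^sup>2 - 2 * sin (u * r) / r ^ 3" for u
  have "(\<integral>u. ((1 - u)\<^sup>2 * cos (u * r)) * indicator {0..1} u \<partial>lborel) = F 1 - F 0"
  proof (rule integral_FTC_Icc_real)
    fix u :: real
    show "DERIV F u :> (1 - u)\<^sup>2 * cos (u * r)"
      unfolding F_def using r(1)
      by (auto intro!: derivative_eq_intros simp: power2_eq_square power3_eq_cube field_simps)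
  qed auto
  also have "F 1 - F 0 = 2 * (r - sin r) / r ^ 3"
    using r(1) by (simp add: F_def power2_eq_square power3_eq_cube field_simps)
  finally have I: "(\<integral>u. ((1 - u)\<^sup>2 * cos (u * r)) * indicator {0..1} u \<partial>lborel) = 2 * (r - sin r) / r ^ 3" .
  have "exp (- s\<^sup>2) = 1 / exp (r\<^sup>2)" by (simp add: r exp_minus divide_inverse)
  also have "\<dots> \<le> 1 / (1 + r\<^sup>2)"
    by (intro divide_left_mono mult_pos_pos) (auto simp: add_pos_nonneg)
  also have "\<dots> = 12 * (r ^ 3 / (12 * (1 + r\<^sup>2))) / r ^ 3"
  proof -
    have "1 / q = 12 * (r ^ 3 / (12 * q)) / r ^ 3" for q
      using r(1) by simp
    then show ?thesis .
  qed
  \<comment> \<open>The factor 6 in the claim turns the transform \<open>2 (r - sin r) / r^3\<close>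
    into \<open>12 (r - sin r) / r^3\<close>, to match the 12 of \<open>diff_sin_ge\<close>.\<close>
  also have "\<dots> \<le> 12 * (r - sin r) / r ^ 3"
    using diff_sin_ge[OF r(1)] r by (intro divide_right_mono mult_left_mono) auto
  finally show ?thesis using I even unfolding r_def by simp
qed

section \<open>Linear forms in independent subgaussian variables\<close>

context real_distribution
begin

section \<open>Exponential moments of a centered subgaussian law\<close>

lemma subgaussian_integrable_exp_square:
  assumes "subgaussian M"
  obtains p where "0 < p" "integrable M (\<lambda>x. exp (p * x\<^sup>2))"
proof -
  obtain C v where C: "C > 0" and v: "v > 0"
    and tail: "\<And>t. t > 0 \<Longrightarrow> prob {x. \<bar>x\<bar> > t} \<le> C * exp (- v * t\<^sup>2)"
    using assms unfolding subgaussian_def by auto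
  \<comment> \<open>On the shell \<open>k + 1 < |x| <= k + 2\<close> the weight
    \<open>exp (p (k + 2)^2)\<close> meets the tail \<open>exp (- v (k + 1)^2)\<close>. As
    \<open>(k + 2)^2 <= 4 (k + 1)^2\<close>, the choice \<open>v / 8\<close> spends at most half of
    the decay.\<close>
  define p where "p = v / 8"
  define w where "w k = exp (p * (real k + 2)\<^sup>2)" for k :: nat
  define r where "r = exp (- v / 2)"
  have r: "0 < r" "r < 1" using v by (auto simp: r_def)
  have bound: "w k * (C * exp (- v * (real k + 1)\<^sup>2)) \<le> C * r ^ k" for k
  proof -
    have "p * (real k + 2)\<^sup>2 - v * (real k + 1)\<^sup>2 = - (v / 2) * real k - (v / 8) * (real k * (8 + 7 * real k) + 4)"
      by (simp add: p_def power2_eq_square field_simps)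
    also have "\<dots> \<le> - (v / 2) * real k" using v by simp
    finally have "exp (p * (real k + 2)\<^sup>2 - v * (real k + 1)\<^sup>2) \<le> exp (- (v / 2) * real k)" by simp
    also have "\<dots> = r ^ k" by (simp add: r_def mult.commute flip: exp_of_nat_mult)
    finally have "w k * exp (- v * (real k + 1)\<^sup>2) \<le> r ^ k"
      by (simp add: w_def flip: exp_add)
    then show ?thesis using C by (simp add: mult.left_commute mult_left_mono)
  qed
  have pw: "ennreal (exp (p * x\<^sup>2)) \<le>
      ennreal (exp p) + (\<Sum>k. ennreal (w k) * indicator {x. \<bar>x\<bar> > real k + 1} x)" for x :: real
  proof (cases "\<bar>x\<bar> \<le> 1")
    case True
    then have "x\<^sup>2 \<le> 1" by (simp add: abs_square_le_1)
    then have "exp (p * x\<^sup>2) \<le> exp p" using v by (simp add: p_def)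
    then show ?thesis by (simp add: ennreal_leI add_increasing2)
  next
    case False
    define k where "k = nat (\<lceil>\<bar>x\<bar>\<rceil> - 2)"
    have "2 \<le> \<lceil>\<bar>x\<bar>\<rceil>" using False by linarith
    then have "real k = of_int \<lceil>\<bar>x\<bar>\<rceil> - 2" by (simp add: k_def)
    then have k: "\<bar>x\<bar> > real k + 1" "\<bar>x\<bar> \<le> real k + 2" by linarith+
    have "x\<^sup>2 \<le> (real k + 2)\<^sup>2" using k(2) by (intro abs_le_square_iff[THEN iffD1]) auto
    then have "exp (p * x\<^sup>2) \<le> w k" using v by (simp add: p_def w_def)
    then have "ennreal (exp (p * x\<^sup>2)) \<le> (\<Sum>j\<in>{k}. ennreal (w j) * indicator {x. \<bar>x\<bar> > real j + 1} x)"
      using k(1) by (simp add: ennreal_leI)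
    also have "\<dots> \<le> (\<Sum>j. ennreal (w j) * indicator {x. \<bar>x\<bar> > real j + 1} x)"
      by (intro sum_le_suminf) auto
    finally show ?thesis by (simp add: add_increasing)
  qed
  have "(\<integral>\<^sup>+x. ennreal (exp (p * x\<^sup>2)) \<partial>M) \<le>
      (\<integral>\<^sup>+x. ennreal (exp p) + (\<Sum>k. ennreal (w k) * indicator {x. \<bar>x\<bar> > real k + 1} x) \<partial>M)"
    by (intro nn_integral_mono pw)
  also have "\<dots> = ennreal (exp p) + (\<Sum>k. ennreal (w k) * emeasure M {x. \<bar>x\<bar> > real k + 1})"
    using emeasure_space_1
    by (subst nn_integral_add, simp, measurable, subst nn_integral_suminf, measurable)
      (simp add: nn_integral_cmult)
  also have "\<dots> \<le> ennreal (exp p) + (\<Sum>k. ennreal (C * r ^ k))"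
  proof (intro add_left_mono suminf_le allI)
    fix k :: nat
    have "ennreal (w k) * emeasure M {x. \<bar>x\<bar> > real k + 1} = ennreal (w k * prob {x. \<bar>x\<bar> > real k + 1})"
      by (simp add: emeasure_eq_measure ennreal_mult w_def)
    also have "\<dots> \<le> ennreal (w k * (C * exp (- v * (real k + 1)\<^sup>2)))"
      using tail[of "real k + 1"] by (intro ennreal_leI mult_left_mono) (auto simp: w_def)
    also have "\<dots> \<le> ennreal (C * r ^ k)" by (intro ennreal_leI bound)
    finally show "ennreal (w k) * emeasure M {x. \<bar>x\<bar> > real k + 1} \<le> ennreal (C * r ^ k)" .
  qed auto
  also have "\<dots> < \<infinity>"
  proof -
    have "(\<Sum>k. ennreal (C * r ^ k)) = ennreal (\<Sum>k. C * r ^ k)"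
      using r C by (intro suminf_ennreal2) (auto intro!: summable_mult summable_geometric)
    then show ?thesis by simp
  qed
  finally have "integrable M (\<lambda>x. exp (p * x\<^sup>2))"
    by (intro integrableI_bounded) auto
  moreover have "0 < p" using v by (simp add: p_def)
  ultimately show thesis using that by blast
qed

text \<open>There are two ranges of \<open>s\<close>. For \<open>s^2 <= p\<close>, centering removes
  the linear term and convexity of \<open>exp\<close> interpolates between 0 and
  \<open>p x^2\<close>, giving \<open>1 + O(s^2)\<close>. For larger \<open>s\<close> the square is
  completed, and the fixed factor \<open>B\<close> is absorbed because
  \<open>s^2 / p > 1\<close>.\<close>

lemma subgaussian_mgf_bound:
  assumes "subgaussian M" "integrable M (\<lambda>x. x)" "(\<integral>x. x \<partial>M) = 0"
  obtains C where "0 \<le> C" "\<And>s. (\<integral>\<^sup>+x. ennreal (exp (s * x)) \<partial>M) \<le> ennreal (exp (C * s\<^sup>2))"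
proof -
  obtain p where p: "0 < p" and int: "integrable M (\<lambda>x. exp (p * x\<^sup>2))"
    using subgaussian_integrable_exp_square[OF assms(1)] .
  define B where "B = (\<integral>x. exp (p * x\<^sup>2) \<partial>M)"
  have "(\<integral>x. 1 \<partial>M) \<le> B" unfolding B_def using int p by (intro integral_mono) auto
  then have B: "1 \<le> B" using prob_space by simp
  define C where "C = (1 + B) / p"
  have "(\<integral>\<^sup>+x. ennreal (exp (s * x)) \<partial>M) \<le> ennreal (exp (C * s\<^sup>2))" for s
  proof (cases "s\<^sup>2 \<le> p")
    case True
    define l where "l = s\<^sup>2 / p"
    have l: "0 \<le> l" "l \<le> 1" "s\<^sup>2 = l * p" using True p by (auto simp: l_def)
    have pw: "exp (s * x) \<le> s * x + (1 + l * (exp (p * x\<^sup>2) - 1))" for x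
    proof -
      have "exp ((1 - l) *\<^sub>R 0 + l *\<^sub>R (p * x\<^sup>2)) \<le> (1 - l) * exp 0 + l * exp (p * x\<^sup>2)"
        using l by (intro convex_onD[OF exp_convex]) auto
      moreover have sq: "(s * x)\<^sup>2 = l * (p * x\<^sup>2)" using l(3) by (simp add: power_mult_distrib)
      moreover have "exp (s * x) \<le> s * x + exp (l * (p * x\<^sup>2))"
        using exp_le_add_exp_square[of "s * x"] unfolding sq .
      ultimately show ?thesis by (simp add: algebra_simps)
    qed
    have int': "integrable M (\<lambda>x. s * x + (1 + l * (exp (p * x\<^sup>2) - 1)))"
      using int assms(2) by auto
    have "(\<integral>\<^sup>+x. ennreal (exp (s * x)) \<partial>M) \<le> (\<integral>\<^sup>+x. ennreal (s * x + (1 + l * (exp (p * x\<^sup>2) - 1))) \<partial>M)"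
      by (intro nn_integral_mono ennreal_leI pw)
    also have "\<dots> = ennreal (\<integral>x. s * x + (1 + l * (exp (p * x\<^sup>2) - 1)) \<partial>M)"
      using int' by (rule nn_integral_eq_integral) (use pw in \<open>auto intro!: AE_I2 order_trans[OF exp_ge_zero pw]\<close>)
    also have "(\<integral>x. s * x + (1 + l * (exp (p * x\<^sup>2) - 1)) \<partial>M) = 1 + l * (B - 1)"
      using int assms(2,3) prob_space by (simp add: B_def)
    also have "1 + l * (B - 1) \<le> exp (l * (B - 1))" by simp
    also have "\<dots> \<le> exp (C * s\<^sup>2)"
    proof -
      have "C * s\<^sup>2 = l * (1 + B)" using l(3) p by (simp add: C_def)
      then show ?thesis using l(1) by (simp add: mult_left_mono)
    qed
    finally show ?thesis by (simp add: ennreal_leI)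
  next
    case False
    have pw: "exp (s * x) \<le> exp (s\<^sup>2 / (4 * p)) * exp (p * x\<^sup>2)" for x
    proof -
      have "s\<^sup>2 / (4 * p) + p * x\<^sup>2 - s * x = (s - 2 * p * x)\<^sup>2 / (4 * p)"
        using p by (simp add: field_simps power2_eq_square)
      also have "\<dots> \<ge> 0" using p by simp
      finally show ?thesis by (simp flip: exp_add)
    qed
    have "(\<integral>\<^sup>+x. ennreal (exp (s * x)) \<partial>M) \<le> (\<integral>\<^sup>+x. ennreal (exp (s\<^sup>2 / (4 * p)) * exp (p * x\<^sup>2)) \<partial>M)"
      by (intro nn_integral_mono ennreal_leI pw)
    also have "\<dots> = ennreal (\<integral>x. exp (s\<^sup>2 / (4 * p)) * exp (p * x\<^sup>2) \<partial>M)"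
      using int by (intro nn_integral_eq_integral) auto
    also have "(\<integral>x. exp (s\<^sup>2 / (4 * p)) * exp (p * x\<^sup>2) \<partial>M) = exp (s\<^sup>2 / (4 * p)) * B"
      by (simp add: B_def)
    also have "\<dots> \<le> exp (s\<^sup>2 / (4 * p)) * exp (s\<^sup>2 / p * B)"
    proof (intro mult_left_mono)
      have "1 * B \<le> s\<^sup>2 / p * B" using False p B by (intro mult_right_mono) auto
      then show "B \<le> exp (s\<^sup>2 / p * B)" using exp_ge_add_one_self[of "s\<^sup>2 / p * B"] by linarith
    qed simp
    also have "\<dots> \<le> exp (C * s\<^sup>2)"
    proof -
      have "s\<^sup>2 / (4 * p) \<le> s\<^sup>2 / p" using p by (intro divide_left_mono) auto
      then show ?thesis using p by (simp add: C_def field_simps flip: exp_add)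
    qed
    finally show ?thesis by (simp add: ennreal_leI)
  qed
  moreover have "0 \<le> C" using p B by (simp add: C_def)
  ultimately show thesis using that by blast
qed

sublocale powers: product_prob_space "\<lambda>_::'i. M" UNIV
  by unfold_locales

lemma linear_form_measurable [measurable]:
  "(\<lambda>\<omega>. \<Sum>k\<in>K. a k * \<omega> k) \<in> borel_measurable (PiM K (\<lambda>_. M))"
proof (rule borel_measurable_sum)
  fix k assume "k \<in> K"
  then show "(\<lambda>\<omega>. a k * \<omega> k) \<in> borel_measurable (PiM K (\<lambda>_. M))" by measurable
qed

lemma linear_form_mgf:
  assumes mgf: "\<And>s. (\<integral>\<^sup>+x. ennreal (exp (s * x)) \<partial>M) \<le> ennreal (exp (C * s\<^sup>2))"
    and "finite K"
  shows "(\<integral>\<^sup>+\<omega>. ennreal (exp (\<Sum>k\<in>K. a k * \<omega> k)) \<partial>PiM K (\<lambda>_. M)) \<le> ennreal (exp (C * (\<Sum>k\<in>K. (a k)\<^sup>2)))"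
proof -
  have "(\<integral>\<^sup>+\<omega>. ennreal (exp (\<Sum>k\<in>K. a k * \<omega> k)) \<partial>PiM K (\<lambda>_. M))
      = (\<integral>\<^sup>+\<omega>. (\<Prod>k\<in>K. ennreal (exp (a k * \<omega> k))) \<partial>PiM K (\<lambda>_. M))"
    using assms(2) by (simp add: exp_sum prod_ennreal)
  also have "\<dots> = (\<Prod>k\<in>K. \<integral>\<^sup>+x. ennreal (exp (a k * x)) \<partial>M)"
    using assms(2) by (intro powers.product_nn_integral_prod) auto
  also have "\<dots> \<le> (\<Prod>k\<in>K. ennreal (exp (C * (a k)\<^sup>2)))"
    by (intro prod_mono_ennreal mgf)
  also have "\<dots> = ennreal (exp (C * (\<Sum>k\<in>K. (a k)\<^sup>2)))"
    using assms(2) by (simp add: prod_ennreal exp_sum sum_distrib_left)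
  finally show ?thesis .
qed

lemma linear_form_second_moment:
  fixes K :: "'i set"
  assumes "integrable M (\<lambda>x. x)" "(\<integral>x. x \<partial>M) = 0"
    and "integrable M (\<lambda>x. x\<^sup>2)" "(\<integral>x. x\<^sup>2 \<partial>M) = 1" and K: "finite K"
  shows "integrable (PiM K (\<lambda>_. M)) (\<lambda>\<omega>. (\<Sum>k\<in>K. a k * \<omega> k)\<^sup>2)"
    and "(\<integral>\<omega>. (\<Sum>k\<in>K. a k * \<omega> k)\<^sup>2 \<partial>PiM K (\<lambda>_. M)) = (\<Sum>k\<in>K. (a k)\<^sup>2)"
proof -
  \<comment> \<open>Writes \<open>\<omega> k * \<omega> l\<close> as a product over all of
    \<open>K\<close> of functions of one coordinate each, so that one product formula covers the
    diagonal, where both factors sit at the same \<open>i\<close>, and the off-diagonal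
    terms.\<close>
  define f where "f k l i x = (if i = k then x else 1) * (if i = l then x else (1::real))" for k l i :: 'i and x
  have f_int: "integrable M (f k l i)" for k l i
    using assms(1,3) by (cases "i = k"; cases "i = l") (auto simp: f_def[abs_def] power2_eq_square)
  have f_prod: "(\<Prod>i\<in>K. f k l i (\<omega> i)) = \<omega> k * \<omega> l" if "k \<in> K" "l \<in> K" for k l \<omega>
    using K that by (simp add: f_def prod.distrib prod.delta)
  have int: "integrable (PiM K (\<lambda>_. M)) (\<lambda>\<omega>. \<omega> k * \<omega> l)" if "k \<in> K" "l \<in> K" for k l
    using powers.product_integrable_prod[OF K, of "f k l"] f_int unfolding f_prod[OF that] by blast
  have val: "(\<integral>\<omega>. \<omega> k * \<omega> l \<partial>PiM K (\<lambda>_. M)) = (if k = l then 1 else 0)" if "k \<in> K" "l \<in> K" for k l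
  proof -
    have "(\<integral>\<omega>. \<omega> k * \<omega> l \<partial>PiM K (\<lambda>_. M)) = (\<Prod>i\<in>K. integral\<^sup>L M (f k l i))"
      using powers.product_integral_prod[OF K, of "f k l"] f_int unfolding f_prod[OF that] by blast
    also have "\<dots> = (if k = l then 1 else 0)"
    proof (cases "k = l")
      case True
      have "integral\<^sup>L M (f k l i) = 1" for i
        using True assms(4) by (cases "i = k") (use prob_space in \<open>auto simp: f_def[abs_def] power2_eq_square\<close>)
      then show ?thesis using True by simp
    next
      case False
      then have "integral\<^sup>L M (f k l k) = 0" using assms(2) by (simp add: f_def[abs_def])
      then show ?thesis using False K that by (simp add: prod_zero_iff) blast
    qed
    finally show ?thesis .
  qed
  have expand: "(\<Sum>k\<in>K. a k * \<omega> k)\<^sup>2 = (\<Sum>k\<in>K. \<Sum>l\<in>K. a k * a l * (\<omega> k * \<omega> l))" for \<omega> :: "'i \<Rightarrow> real"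
    by (simp add: power2_eq_square sum_product algebra_simps)
  show "integrable (PiM K (\<lambda>_. M)) (\<lambda>\<omega>. (\<Sum>k\<in>K. a k * \<omega> k)\<^sup>2)"
    unfolding expand using int by (intro Bochner_Integration.integrable_sum integrable_mult_right) auto
  have "(\<integral>\<omega>. (\<Sum>k\<in>K. a k * \<omega> k)\<^sup>2 \<partial>PiM K (\<lambda>_. M))
      = (\<Sum>k\<in>K. \<Sum>l\<in>K. a k * a l * (\<integral>\<omega>. \<omega> k * \<omega> l \<partial>PiM K (\<lambda>_. M)))"
    unfolding expand using int by (simp add: Bochner_Integration.integral_sum)
  also have "\<dots> = (\<Sum>k\<in>K. \<Sum>l\<in>K. if k = l then a k * a l else 0)"
    by (intro sum.cong refl) (auto simp: val)
  also have "\<dots> = (\<Sum>k\<in>K. (a k)\<^sup>2)"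
    using K by (simp add: power2_eq_square)
  finally show "(\<integral>\<omega>. (\<Sum>k\<in>K. a k * \<omega> k)\<^sup>2 \<partial>PiM K (\<lambda>_. M)) = (\<Sum>k\<in>K. (a k)\<^sup>2)" .
qed

text \<open>The fourth moment of a normalised linear form is bounded by its moment generating
  function, so \<open>exp (- y) \<le> 1 - y + y\<^sup>2 / 2\<close> bounds the Laplace transform of its square away from 1.\<close>

lemma linear_form_laplace_lt_1:
  fixes K :: "'i set"
  assumes mgf: "0 \<le> C" "\<And>s. (\<integral>\<^sup>+x. ennreal (exp (s * x)) \<partial>M) \<le> ennreal (exp (C * s\<^sup>2))"
    and "integrable M (\<lambda>x. x)" "(\<integral>x. x \<partial>M) = 0"
    and "integrable M (\<lambda>x. x\<^sup>2)" "(\<integral>x. x\<^sup>2 \<partial>M) = 1"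
    and K: "finite K" "(\<Sum>k\<in>K. (a k)\<^sup>2) = 1"
    and Q: "Q = 512 * exp C"
  shows "(\<integral>\<^sup>+\<omega>. ennreal (exp (- (1 / Q) * (\<Sum>k\<in>K. a k * \<omega> k)\<^sup>2)) \<partial>PiM K (\<lambda>_. M)) \<le> ennreal (1 - 1 / (2 * Q))"
proof -
  interpret P: prob_space "PiM K (\<lambda>_. M)" by (intro prob_space_PiM prob_space_axioms)
  define S where "S \<omega> = (\<Sum>k\<in>K. a k * \<omega> k)" for \<omega> :: "'i \<Rightarrow> real"
  have [measurable]: "S \<in> borel_measurable (PiM K (\<lambda>_. M))" unfolding S_def by measurable
  have S2: "integrable (PiM K (\<lambda>_. M)) (\<lambda>\<omega>. (S \<omega>)\<^sup>2)" "(\<integral>\<omega>. (S \<omega>)\<^sup>2 \<partial>PiM K (\<lambda>_. M)) = 1"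
    unfolding S_def using linear_form_second_moment[OF assms(3-6) K(1)] K(2) by auto
  have e1: "(\<integral>\<^sup>+\<omega>. ennreal (exp (S \<omega>)) \<partial>PiM K (\<lambda>_. M)) \<le> ennreal (exp C)"
    using linear_form_mgf[OF mgf(2) K(1), of a] K(2) by (simp add: S_def)
  have e2: "(\<integral>\<^sup>+\<omega>. ennreal (exp (- S \<omega>)) \<partial>PiM K (\<lambda>_. M)) \<le> ennreal (exp C)"
    using linear_form_mgf[OF mgf(2) K(1), of "\<lambda>k. - a k"] K(2) by (simp add: S_def sum_negf)
  have Qpos: "0 < Q" by (simp add: Q)
  have "(\<integral>\<^sup>+\<omega>. ennreal ((S \<omega>) ^ 4) \<partial>PiM K (\<lambda>_. M)) \<le>
      (\<integral>\<^sup>+\<omega>. 256 * (ennreal (exp (S \<omega>)) + ennreal (exp (- S \<omega>))) \<partial>PiM K (\<lambda>_. M))"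
  proof (rule nn_integral_mono)
    fix \<omega>
    have "ennreal (S \<omega> ^ 4) \<le> ennreal (256 * (exp (S \<omega>) + exp (- S \<omega>)))"
      by (intro ennreal_leI power4_le_exp_sum)
    then show "ennreal (S \<omega> ^ 4) \<le> 256 * (ennreal (exp (S \<omega>)) + ennreal (exp (- S \<omega>)))"
      by (simp add: ennreal_mult)
  qed
  also have "\<dots> = 256 * ((\<integral>\<^sup>+\<omega>. ennreal (exp (S \<omega>)) \<partial>PiM K (\<lambda>_. M)) + (\<integral>\<^sup>+\<omega>. ennreal (exp (- S \<omega>)) \<partial>PiM K (\<lambda>_. M)))"
    by (simp add: nn_integral_cmult nn_integral_add)
  also have "\<dots> \<le> 256 * (ennreal (exp C) + ennreal (exp C))"
    by (intro mult_left_mono add_mono e1 e2) simp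
  also have "\<dots> = ennreal Q" by (simp add: Q flip: ennreal_plus ennreal_mult ennreal_numeral)
  finally have S4': "(\<integral>\<^sup>+\<omega>. ennreal ((S \<omega>) ^ 4) \<partial>PiM K (\<lambda>_. M)) \<le> ennreal Q" .
  then have S4: "integrable (PiM K (\<lambda>_. M)) (\<lambda>\<omega>. (S \<omega>) ^ 4)"
    by (intro integrableI_bounded) (auto simp: le_less_trans[OF _ ennreal_less_top] power_abs)
  have S4b: "(\<integral>\<omega>. (S \<omega>) ^ 4 \<partial>PiM K (\<lambda>_. M)) \<le> Q"
    using S4' nn_integral_eq_integral[OF S4] Qpos by (simp add: ennreal_le_iff)
  \<comment> \<open>\<open>Q\<close> bounds the fourth moment. At the Laplace parameter
    \<open>1 / Q\<close> the quadratic term costs at most \<open>Q / (2 Q^2)\<close>, half of the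
    gain \<open>1 / Q\<close> from the unit second moment.\<close>
  define g where "g \<omega> = 1 - (1 / Q) * (S \<omega>)\<^sup>2 + (1 / (2 * Q\<^sup>2)) * (S \<omega>) ^ 4" for \<omega>
  have pw: "exp (- (1 / Q) * (S \<omega>)\<^sup>2) \<le> g \<omega>" for \<omega>
    using exp_minus_le_quadratic[of "(1 / Q) * (S \<omega>)\<^sup>2"] Qpos
    by (simp add: g_def power_mult_distrib power_divide flip: power_mult)
  have g_int: "integrable (PiM K (\<lambda>_. M)) g" unfolding g_def using S2 S4 by auto
  have "(\<integral>\<^sup>+\<omega>. ennreal (exp (- (1 / Q) * (S \<omega>)\<^sup>2)) \<partial>PiM K (\<lambda>_. M)) \<le> (\<integral>\<^sup>+\<omega>. ennreal (g \<omega>) \<partial>PiM K (\<lambda>_. M))"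
    by (intro nn_integral_mono ennreal_leI pw)
  also have "\<dots> = ennreal (\<integral>\<omega>. g \<omega> \<partial>PiM K (\<lambda>_. M))"
    using g_int by (rule nn_integral_eq_integral) (auto intro!: AE_I2 order_trans[OF exp_ge_zero pw])
  also have "(\<integral>\<omega>. g \<omega> \<partial>PiM K (\<lambda>_. M)) = 1 - 1 / Q + (1 / (2 * Q\<^sup>2)) * (\<integral>\<omega>. (S \<omega>) ^ 4 \<partial>PiM K (\<lambda>_. M))"
    unfolding g_def using S2 S4 by (simp add: P.prob_space)
  also have "\<dots> \<le> 1 - 1 / Q + (1 / (2 * Q\<^sup>2)) * Q"
    using S4b by (intro add_left_mono mult_left_mono) auto
  also have "\<dots> = 1 - 1 / (2 * Q)" using Qpos by (simp add: field_simps power2_eq_square)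
  finally show ?thesis by (simp add: S_def ennreal_leI)
qed

text \<open>Independence of the rows of a random matrix: one block at a time is split off by Fubini.
  The last hypothesis says that \<open>F i\<close> reads only the coordinates in \<open>K i\<close>,
  so that it can be evaluated at points of a larger product.\<close>

lemma nn_integral_prod_disjoint_blocks:
  fixes F :: "'a \<Rightarrow> ('i \<Rightarrow> real) \<Rightarrow> ennreal"
  assumes "finite A" "\<And>i. i \<in> A \<Longrightarrow> finite (K i)" "disjoint_family_on K A"
    and "\<And>i. i \<in> A \<Longrightarrow> F i \<in> borel_measurable (PiM (K i) (\<lambda>_. M))"
    and "\<And>i \<omega>. i \<in> A \<Longrightarrow> F i (restrict \<omega> (K i)) = F i \<omega>"
  shows "(\<integral>\<^sup>+\<omega>. (\<Prod>i\<in>A. F i \<omega>) \<partial>PiM (\<Union>i\<in>A. K i) (\<lambda>_. M)) = (\<Prod>i\<in>A. \<integral>\<^sup>+\<omega>. F i \<omega> \<partial>PiM (K i) (\<lambda>_. M))"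
  using assms
proof (induction A rule: finite_induct)
  case empty
  interpret E: prob_space "PiM {} (\<lambda>_::'i. M)" by (intro prob_space_PiM prob_space_axioms)
  show ?case using E.emeasure_space_1 by simp
next
  case (insert a A)
  let ?U = "\<Union>i\<in>A. K i"
  have meas: "F i \<in> borel_measurable (PiM J (\<lambda>_. M))" if "i \<in> insert a A" "K i \<subseteq> J" for i J
  proof -
    have "(\<lambda>\<omega>. F i (restrict \<omega> (K i))) \<in> borel_measurable (PiM J (\<lambda>_. M))"
      using that by (intro measurable_compose[OF measurable_restrict_subset insert.prems(3)]) auto
    then show ?thesis using insert.prems(4)[OF that(1)] by simp
  qed
  have cong: "F i \<omega> = F i \<omega>'" if "i \<in> insert a A" "\<And>k. k \<in> K i \<Longrightarrow> \<omega> k = \<omega>' k" for i \<omega> \<omega>'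
  proof -
    have "restrict \<omega> (K i) = restrict \<omega>' (K i)" using that(2) by (intro restrict_ext) auto
    then show ?thesis using insert.prems(4)[OF that(1), of \<omega>] insert.prems(4)[OF that(1), of \<omega>'] by simp
  qed
  have disj: "K a \<inter> ?U = {}"
  proof -
    have "K a \<inter> K i = {}" if "i \<in> A" for i
      using insert.prems(2) insert.hyps(2) that by (intro disjoint_family_onD[of K "insert a A"]) auto
    then show ?thesis by blast
  qed
  have "(\<integral>\<^sup>+\<omega>. (\<Prod>i\<in>insert a A. F i \<omega>) \<partial>PiM (\<Union>i\<in>insert a A. K i) (\<lambda>_. M))
      = (\<integral>\<^sup>+\<omega>. (\<Prod>i\<in>insert a A. F i \<omega>) \<partial>PiM (K a \<union> ?U) (\<lambda>_. M))" by simp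
  also have "\<dots> = (\<integral>\<^sup>+x. (\<integral>\<^sup>+y. (\<Prod>i\<in>insert a A. F i (merge (K a) ?U (x, y))) \<partial>PiM ?U (\<lambda>_. M)) \<partial>PiM (K a) (\<lambda>_. M))"
  proof (rule powers.product_nn_integral_fold[OF disj])
    show "finite (K a)" "finite ?U" using insert.hyps(1) insert.prems(1) by auto
    show "(\<lambda>\<omega>. \<Prod>i\<in>insert a A. F i \<omega>) \<in> borel_measurable (PiM (K a \<union> ?U) (\<lambda>_. M))"
      by (intro borel_measurable_prod_ennreal meas) auto
  qed
  also have "\<dots> = (\<integral>\<^sup>+x. (\<integral>\<^sup>+y. F a x * (\<Prod>i\<in>A. F i y) \<partial>PiM ?U (\<lambda>_. M)) \<partial>PiM (K a) (\<lambda>_. M))"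
  proof (intro nn_integral_cong)
    fix x y
    have "F a (merge (K a) ?U (x, y)) = F a x" by (rule cong) (simp_all add: merge_def)
    moreover have "(\<Prod>i\<in>A. F i (merge (K a) ?U (x, y))) = (\<Prod>i\<in>A. F i y)"
    proof (rule prod.cong[OF refl], rule cong)
      fix i k assume i: "i \<in> A" "k \<in> K i"
      then have "k \<notin> K a" "k \<in> ?U" using disj by auto
      then show "merge (K a) ?U (x, y) k = y k" by (simp add: merge_def)
    qed simp
    ultimately show "(\<Prod>i\<in>insert a A. F i (merge (K a) ?U (x, y))) = F a x * (\<Prod>i\<in>A. F i y)"
      using insert.hyps by simp
  qed
  also have "\<dots> = (\<integral>\<^sup>+x. F a x * (\<integral>\<^sup>+y. (\<Prod>i\<in>A. F i y) \<partial>PiM ?U (\<lambda>_. M)) \<partial>PiM (K a) (\<lambda>_. M))"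
    by (intro nn_integral_cong nn_integral_cmult borel_measurable_prod_ennreal meas) auto
  also have "\<dots> = (\<integral>\<^sup>+x. F a x \<partial>PiM (K a) (\<lambda>_. M)) * (\<integral>\<^sup>+y. (\<Prod>i\<in>A. F i y) \<partial>PiM ?U (\<lambda>_. M))"
    by (intro nn_integral_multc meas) auto
  also have "(\<integral>\<^sup>+y. (\<Prod>i\<in>A. F i y) \<partial>PiM ?U (\<lambda>_. M)) = (\<Prod>i\<in>A. \<integral>\<^sup>+\<omega>. F i \<omega> \<partial>PiM (K i) (\<lambda>_. M))"
  proof (rule insert.IH)
    show "disjoint_family_on K A" using insert.prems(2) by (auto simp: disjoint_family_on_def)
    show "finite (K i)" if "i \<in> A" for i using that by (intro insert.prems(1)) simp
    show "F i \<in> borel_measurable (PiM (K i) (\<lambda>_. M))" if "i \<in> A" for i using that by (intro insert.prems(3)) simp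
    show "F i (restrict \<omega> (K i)) = F i \<omega>" if "i \<in> A" for i \<omega> using that by (intro insert.prems(4)) simp
  qed
  finally show ?case using insert.hyps by simp
qed

end

section \<open>Distance to the integer lattice\<close>

lemma vnorm_L2_set: "vnorm n a = L2_set a {..<n}"
  by (simp add: vnorm_def L2_set_def)

lemma vnorm_nonneg [simp]: "0 \<le> vnorm n a"
  by (simp add: vnorm_L2_set)

lemma vnorm_power2: "(vnorm n a)\<^sup>2 = (\<Sum>j<n. (a j)\<^sup>2)"
  by (simp add: vnorm_def sum_nonneg)

lemma vnorm_triangle: "vnorm n (\<lambda>j. a j + b j) \<le> vnorm n a + vnorm n b"
  unfolding vnorm_L2_set by (rule L2_set_triangle_ineq)

lemma vnorm_scale: "vnorm n (\<lambda>j. c * a j) = \<bar>c\<bar> * vnorm n a"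
  by (simp add: vnorm_def power_mult_distrib real_sqrt_mult flip: sum_distrib_left)

lemma vnorm_minus_commute: "vnorm n (\<lambda>j. a j - b j) = vnorm n (\<lambda>j. b j - a j)"
  by (simp add: vnorm_def power2_commute)

lemma vnorm_uminus: "vnorm n (\<lambda>j. - a j) = vnorm n a"
  by (simp add: vnorm_def)

lemma vnorm_triangle_diff: "vnorm n (\<lambda>j. a j - b j) \<le> vnorm n a + vnorm n b"
  using vnorm_triangle[of n a "\<lambda>j. - b j"] by (simp add: vnorm_uminus)

lemma vnorm_mono: "(\<And>j. j < n \<Longrightarrow> \<bar>a j\<bar> \<le> \<bar>b j\<bar>) \<Longrightarrow> vnorm n a \<le> vnorm n b"
  unfolding vnorm_def by (intro real_sqrt_le_mono sum_mono) (simp add: abs_le_square_iff)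

lemma vnorm_cong: "(\<And>j. j < n \<Longrightarrow> a j = b j) \<Longrightarrow> vnorm n a = vnorm n b"
  by (simp add: vnorm_def)

lemma vnorm_eq_0D: "vnorm n a = 0 \<Longrightarrow> j < n \<Longrightarrow> a j = 0"
  by (simp add: vnorm_L2_set L2_set_eq_0_iff)

lemma abs_component_le_vnorm:
  assumes "j < n"
  shows "\<bar>a j\<bar> \<le> vnorm n a"
proof -
  have "vnorm n (\<lambda>j. \<bar>a j\<bar>) = vnorm n a" by (simp add: vnorm_def)
  then show ?thesis
    using member_le_L2_set[of "{..<n}" j "\<lambda>j. \<bar>a j\<bar>"] assms by (simp add: vnorm_L2_set)
qed

text \<open>\<open>\<theta> (Z - p / |p|)\<close> is \<open>\<theta> Z - p\<close> plus the multiple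
  \<open>(|p| - \<theta>) / |p|\<close> of \<open>p\<close>. The second part has norm at most \<eta>
  as well, because \<theta> is the norm of \<open>\<theta> Z\<close>; hence the factor 2.\<close>

lemma vnorm_normalize_near:
  assumes "vnorm n Z = 1" "0 < \<theta>" "vnorm n (\<lambda>j. \<theta> * Z j - p j) \<le> \<eta>" "0 < vnorm n p"
  shows "vnorm n (\<lambda>j. Z j - p j / vnorm n p) \<le> 2 * \<eta> / \<theta>"
proof -
  define r where "r = vnorm n p"
  have r: "0 < r" using assms(4) by (simp add: r_def)
  have t: "vnorm n (\<lambda>j. \<theta> * Z j) = \<theta>" using assms(1,2) by (simp add: vnorm_scale)
  have "\<theta> \<le> vnorm n (\<lambda>j. \<theta> * Z j - p j) + r"
    using vnorm_triangle[of n "\<lambda>j. \<theta> * Z j - p j" p] by (simp add: t r_def)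
  moreover have "r \<le> vnorm n (\<lambda>j. \<theta> * Z j - p j) + \<theta>"
    using vnorm_triangle_diff[of n "\<lambda>j. \<theta> * Z j" "\<lambda>j. \<theta> * Z j - p j"] by (simp add: t r_def)
  ultimately have d: "\<bar>r - \<theta>\<bar> \<le> \<eta>" using assms(3) by linarith
  have "\<theta> * vnorm n (\<lambda>j. Z j - p j / r) = vnorm n (\<lambda>j. \<theta> * (Z j - p j / r))"
    using assms(2) by (simp add: vnorm_scale)
  also have "\<dots> = vnorm n (\<lambda>j. (\<theta> * Z j - p j) + ((r - \<theta>) / r) * p j)"
    using r by (intro vnorm_cong) (simp add: field_simps)
  also have "\<dots> \<le> vnorm n (\<lambda>j. \<theta> * Z j - p j) + vnorm n (\<lambda>j. ((r - \<theta>) / r) * p j)"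
    by (rule vnorm_triangle)
  also have "vnorm n (\<lambda>j. ((r - \<theta>) / r) * p j) = \<bar>r - \<theta>\<bar>"
    unfolding vnorm_scale using r by (simp add: r_def)
  also have "vnorm n (\<lambda>j. \<theta> * Z j - p j) + \<bar>r - \<theta>\<bar> \<le> 2 * \<eta>" using d assms(3) by linarith
  finally show ?thesis using assms(2) by (simp add: r_def field_simps)
qed

text \<open>The minimisation decouples over the coordinates. Besides attaining the infimum, the
  formula makes measurability in parameters evident.\<close>

lemma dist_lattice_eq_round: "dist_lattice n a = vnorm n (\<lambda>j. a j - of_int (round (a j)))"
  unfolding dist_lattice_def
proof (rule cInf_eq_minimum)
  fix x assume "x \<in> {vnorm n (\<lambda>j. a j - real_of_int (p j)) |p. True}"
  then obtain p :: "nat \<Rightarrow> int" where "x = vnorm n (\<lambda>j. a j - real_of_int (p j))" by auto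
  then show "vnorm n (\<lambda>j. a j - of_int (round (a j))) \<le> x"
    by (auto intro!: vnorm_mono round_diff_minimal)
qed auto

lemma dist_lattice_le: "dist_lattice n a \<le> vnorm n (\<lambda>j. a j - of_int (p j))"
  unfolding dist_lattice_eq_round by (auto intro!: vnorm_mono round_diff_minimal)

lemma dist_lattice_nonneg [simp]: "0 \<le> dist_lattice n a"
  by (simp add: dist_lattice_eq_round)

lemma dist_lattice_diff: "dist_lattice n (\<lambda>j. a j - b j) \<le> dist_lattice n a + dist_lattice n b"
proof -
  have "dist_lattice n (\<lambda>j. a j - b j) \<le> vnorm n (\<lambda>j. a j - b j - of_int (round (a j) - round (b j)))"
    by (rule dist_lattice_le)
  also have "\<dots> = vnorm n (\<lambda>j. (a j - of_int (round (a j))) - (b j - of_int (round (b j))))"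
    by (intro vnorm_cong) simp
  also have "\<dots> \<le> dist_lattice n a + dist_lattice n b"
    unfolding dist_lattice_eq_round by (rule vnorm_triangle_diff)
  finally show ?thesis .
qed

lemma dist_lattice_uminus: "dist_lattice n (\<lambda>j. - a j) = dist_lattice n a"
proof -
  have *: "dist_lattice n (\<lambda>j. - b j) \<le> dist_lattice n b" for b
    using dist_lattice_le[of n "\<lambda>j. - b j" "\<lambda>j. - round (b j)"] vnorm_minus_commute[of n b "\<lambda>j. of_int (round (b j))"]
    by (simp add: dist_lattice_eq_round)
  show ?thesis using *[of a] *[of "\<lambda>j. - a j"] by simp
qed

lemma dist_lattice_abs_scale: "dist_lattice n (\<lambda>j. \<bar>c\<bar> * a j) = dist_lattice n (\<lambda>j. c * a j)"
  using dist_lattice_uminus[of n "\<lambda>j. c * a j"] by (cases "0 \<le> c") auto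

text \<open>The bridge from characteristic functions to the lattice: the cosines do not see integer
  shifts of \<open>a j\<close>, so \<open>a j\<close> may be reduced to its offset from the nearest
  integer, where \<open>1 - cos y >= y^2 / 12\<close> applies.\<close>

lemma dist_lattice_power2_le_cos:
  "(dist_lattice n a)\<^sup>2 \<le> (\<Sum>j<n. 1 - cos (2 * pi * a j))"
proof -
  have "(a j - of_int (round (a j)))\<^sup>2 \<le> 1 - cos (2 * pi * a j)" for j
  proof -
    define y where "y = 2 * pi * (a j - of_int (round (a j)))"
    have "\<bar>a j - of_int (round (a j))\<bar> \<le> 1 / 2" using of_int_round_abs_le[of "a j"] by (simp add: abs_minus_commute)
    then have "\<bar>y\<bar> \<le> pi" by (simp add: y_def abs_mult)
    then have "y\<^sup>2 / 12 \<le> 1 - cos y" by (rule one_minus_cos_ge)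
    moreover have "cos y = cos (2 * pi * a j)"
      using sin_int_2pin[of "round (a j)"] cos_int_2pin[of "round (a j)"]
      by (simp add: y_def right_diff_distrib cos_diff)
    moreover have "12 \<le> (2 * pi)\<^sup>2"
    proof -
      have "6\<^sup>2 \<le> (2 * pi)\<^sup>2" using pi_gt3 by (intro power_mono) auto
      then show ?thesis by simp
    qed
    then have "12 * (a j - of_int (round (a j)))\<^sup>2 \<le> y\<^sup>2"
      unfolding y_def power_mult_distrib[of "2 * pi"] by (intro mult_right_mono) auto
    ultimately show ?thesis by linarith
  qed
  then show ?thesis unfolding dist_lattice_eq_round vnorm_power2 by (intro sum_mono)
qed

text \<open>Membership in the set under the infimum of \<open>LCD\<close>. Bounds on the LCD become
  statements about the existence of witnesses, free of extended reals.\<close>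

definition LCD_witness :: "nat \<Rightarrow> real \<Rightarrow> real \<Rightarrow> (nat \<Rightarrow> real) \<Rightarrow> real \<Rightarrow> bool" where
  "LCD_witness n \<gamma> \<alpha> a \<theta> \<longleftrightarrow>
     0 < \<theta> \<and> dist_lattice n (\<lambda>j. \<theta> * a j) < min (\<gamma> * vnorm n (\<lambda>j. \<theta> * a j)) \<alpha>"

lemma LCD_less_iff: "LCD n \<gamma> \<alpha> a < ereal x \<longleftrightarrow> (\<exists>\<theta><x. LCD_witness n \<gamma> \<alpha> a \<theta>)"
  unfolding LCD_def LCD_witness_def by (auto simp: INF_less_iff)

section \<open>Gaussian averages of the lattice distance along a line\<close>

lemma nn_integral_gaussian:
  fixes A u0 :: real
  assumes "0 < A"
  shows "(\<integral>\<^sup>+u. ennreal (exp (- (A * (u - u0)\<^sup>2))) \<partial>lborel) = ennreal (sqrt (pi / A))"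
proof -
  define \<sigma> where "\<sigma> = 1 / sqrt (2 * A)"
  have s: "0 < \<sigma>" "\<sigma>\<^sup>2 = 1 / (2 * A)" using assms by (auto simp: \<sigma>_def power_divide)
  have eq: "exp (- (A * (u - u0)\<^sup>2)) = sqrt (pi / A) * normal_density u0 \<sigma> u" for u
    using assms by (simp add: normal_density_def s(2) field_simps)
  have "(\<integral>\<^sup>+u. ennreal (exp (- (A * (u - u0)\<^sup>2))) \<partial>lborel)
      = ennreal (\<integral>u. sqrt (pi / A) * normal_density u0 \<sigma> u \<partial>lborel)"
    unfolding eq using s(1) assms by (intro nn_integral_eq_integral) auto
  then show ?thesis using s(1) by simp
qed

text \<open>On an interval too short for two points to differ by an admissible multiple, the distance
  to the lattice grows linearly away from a near-minimiser \<open>u0\<close>, by the triangle inequality.\<close>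

lemma lattice_gaussian_integral_interval:
  assumes x: "vnorm n x = 1" and nw: "\<And>\<theta>. \<theta> < D \<Longrightarrow> \<not> LCD_witness n \<gamma> \<alpha> x \<theta>"
    and pos: "0 < \<gamma>" "0 < \<alpha>" "0 < \<kappa>" "0 < L" and l: "0 \<le> l" "l * L < D"
  shows "(\<integral>\<^sup>+u. ennreal (exp (- \<kappa> * (dist_lattice n (\<lambda>j. u * L * x j))\<^sup>2)) * indicator {s..s + l} u \<partial>lborel)
      \<le> ennreal (exp (\<kappa> / 4) * (sqrt (8 * pi / \<kappa>) / (\<gamma> * L) + l * exp (- \<kappa> * \<alpha>\<^sup>2 / 8)))"
proof -
  define f where "f u = dist_lattice n (\<lambda>j. u * L * x j)" for u
  have f0: "0 \<le> f u" for u by (simp add: f_def)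
  let ?J = "{s..s + l}"
  \<comment> \<open>A point within 1 of the infimum stands in for a minimiser; the error only enters
    the factor \<open>exp (\<kappa> / 4)\<close>.\<close>
  have "Inf (f ` ?J) < Inf (f ` ?J) + 1" by simp
  then obtain u0 where u0: "u0 \<in> ?J" "f u0 < Inf (f ` ?J) + 1"
    using cInf_lessD[of "f ` ?J" "Inf (f ` ?J) + 1"] l(1) by auto
  have min: "f u0 \<le> f u + 1" if "u \<in> ?J" for u
  proof -
    have "Inf (f ` ?J) \<le> f u" using that f0 by (intro cInf_lower bdd_belowI[of _ 0]) auto
    then show ?thesis using u0(2) by linarith
  qed
  define A where "A = \<kappa> * \<gamma>\<^sup>2 * L\<^sup>2 / 8"
  have A: "0 < A" using pos by (simp add: A_def)
  have pw: "exp (- \<kappa> * (f u)\<^sup>2) \<le> exp (\<kappa> / 4) * (exp (- (A * (u - u0)\<^sup>2)) + exp (- \<kappa> * \<alpha>\<^sup>2 / 8))"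
    if u: "u \<in> ?J" for u
  proof -
    define v where "v = \<bar>u - u0\<bar> * L"
    have "v \<le> l * L" unfolding v_def using u u0(1) pos by (intro mult_right_mono) auto
    then have v: "v < D" using l(2) by linarith
    have v0: "0 \<le> v" using pos by (simp add: v_def)
    have "min (\<gamma> * v) \<alpha> \<le> dist_lattice n (\<lambda>j. v * x j)"
    proof (cases "v = 0")
      case True
      then show ?thesis using pos by (simp add: min_def)
    next
      case False
      then show ?thesis using nw[OF v] v0 x by (auto simp: LCD_witness_def vnorm_scale not_less)
    qed
    also have "\<dots> = dist_lattice n (\<lambda>j. u * L * x j - u0 * L * x j)"
    proof -
      have "v = \<bar>(u - u0) * L\<bar>" using pos by (simp add: v_def abs_mult)
      then show ?thesis using dist_lattice_abs_scale[of n "(u - u0) * L" x] by (simp add: left_diff_distrib)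
    qed
    also have "\<dots> \<le> f u + f u0" unfolding f_def by (rule dist_lattice_diff)
    also have "\<dots> \<le> 2 * f u + 1" using min[OF u] by simp
    finally have "(min (\<gamma> * v) \<alpha>)\<^sup>2 \<le> (2 * f u + 1)\<^sup>2" using pos v0 by (intro power_mono) auto
    \<comment> \<open>Completing the square gives \<open>(2 f + 1)^2 <= 8 f^2 + 2\<close>, the
      origin of the 8 in the exponents and of \<open>\<kappa> / 4\<close>.\<close>
    also have "\<dots> = 8 * (f u)\<^sup>2 + 2 - (2 * f u - 1)\<^sup>2" by (simp add: power2_eq_square algebra_simps)
    also have "\<dots> \<le> 8 * (f u)\<^sup>2 + 2" by simp
    finally have m: "(min (\<gamma> * v) \<alpha>)\<^sup>2 \<le> 8 * (f u)\<^sup>2 + 2" .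
    have "\<kappa> * (min (\<gamma> * v) \<alpha>)\<^sup>2 \<le> \<kappa> * (8 * (f u)\<^sup>2 + 2)" using m pos by (intro mult_left_mono) auto
    then have "- \<kappa> * (f u)\<^sup>2 \<le> \<kappa> / 4 + - \<kappa> * (min (\<gamma> * v) \<alpha>)\<^sup>2 / 8" by (simp add: algebra_simps)
    then have "exp (- \<kappa> * (f u)\<^sup>2) \<le> exp (\<kappa> / 4 + - \<kappa> * (min (\<gamma> * v) \<alpha>)\<^sup>2 / 8)"
      by (simp only: exp_le_cancel_iff)
    also have "\<dots> = exp (\<kappa> / 4) * exp (- \<kappa> * (min (\<gamma> * v) \<alpha>)\<^sup>2 / 8)" by (rule exp_add)
    \<comment> \<open>The exponential at a minimum is one of the two exponentials, hence below their
      sum: a Gaussian in \<open>u - u0\<close> plus a constant.\<close>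
    also have "exp (- \<kappa> * (min (\<gamma> * v) \<alpha>)\<^sup>2 / 8) \<le> exp (- \<kappa> * (\<gamma> * v)\<^sup>2 / 8) + exp (- \<kappa> * \<alpha>\<^sup>2 / 8)"
      by (simp add: min_def)
    also have "- \<kappa> * (\<gamma> * v)\<^sup>2 / 8 = - (A * (u - u0)\<^sup>2)"
      by (simp add: A_def v_def power_mult_distrib)
    finally show ?thesis by simp
  qed
  let ?g = "\<lambda>u. ennreal (exp (\<kappa> / 4)) * (ennreal (exp (- (A * (u - u0)\<^sup>2))) + ennreal (exp (- \<kappa> * \<alpha>\<^sup>2 / 8)) * indicator ?J u)"
  have "(\<integral>\<^sup>+u. ennreal (exp (- \<kappa> * (f u)\<^sup>2)) * indicator ?J u \<partial>lborel) \<le> (\<integral>\<^sup>+u. ?g u \<partial>lborel)"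
  proof (rule nn_integral_mono)
    fix u :: real
    show "ennreal (exp (- \<kappa> * (f u)\<^sup>2)) * indicator ?J u \<le> ?g u"
      using pw[of u] by (cases "u \<in> ?J") (auto simp: ennreal_leI simp flip: ennreal_plus ennreal_mult)
  qed
  also have "\<dots> = ennreal (exp (\<kappa> / 4)) * (ennreal (sqrt (pi / A)) + ennreal (exp (- \<kappa> * \<alpha>\<^sup>2 / 8)) * ennreal l)"
    using l(1) by (simp add: nn_integral_cmult nn_integral_add nn_integral_gaussian[OF A] nn_integral_cmult_indicator)
  also have "\<dots> = ennreal (exp (\<kappa> / 4) * (sqrt (pi / A) + l * exp (- \<kappa> * \<alpha>\<^sup>2 / 8)))"
    using l(1) A by (simp add: mult.commute flip: ennreal_plus ennreal_mult)
  also have "sqrt (pi / A) = sqrt (8 * pi / \<kappa>) / (\<gamma> * L)"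
  proof -
    have "pi / A = (8 * pi / \<kappa>) / (\<gamma> * L)\<^sup>2" by (simp add: A_def power_mult_distrib ac_simps)
    then show ?thesis using pos by (simp add: real_sqrt_divide real_sqrt_mult)
  qed
  finally show ?thesis by (simp add: f_def)
qed

text \<open>Over the unit interval the multiples reach \<open>L\<close>, which may exceed
  \<open>D\<close>. Each of \<open>N\<close> pieces of length \<open>1 / N\<close> sweeps only
  \<open>L / N < D\<close>, and in the sum just the Gaussian term is multiplied by
  \<open>N\<close>.\<close>

lemma lattice_gaussian_integral_unit:
  assumes x: "vnorm n x = 1" and nw: "\<And>\<theta>. \<theta> < D \<Longrightarrow> \<not> LCD_witness n \<gamma> \<alpha> x \<theta>"
    and pos: "0 < \<gamma>" "0 < \<alpha>" "0 < \<kappa>" "0 < L" and N: "0 < N" "L < real N * D"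
  shows "(\<integral>\<^sup>+u. ennreal (exp (- \<kappa> * (dist_lattice n (\<lambda>j. u * L * x j))\<^sup>2)) * indicator {0..1} u \<partial>lborel)
      \<le> ennreal (exp (\<kappa> / 4) * (real N * sqrt (8 * pi / \<kappa>) / (\<gamma> * L) + exp (- \<kappa> * \<alpha>\<^sup>2 / 8)))"
proof -
  define h where "h u = ennreal (exp (- \<kappa> * (dist_lattice n (\<lambda>j. u * L * x j))\<^sup>2))" for u
  define J where "J k = {real k / real N..real k / real N + 1 / real N}" for k
  have round_meas [measurable]: "(\<lambda>x::real. real_of_int (round x)) \<in> borel_measurable borel"
    unfolding round_def by measurable
  have [measurable]: "h \<in> borel_measurable borel"
    unfolding h_def dist_lattice_eq_round vnorm_def by measurable
  have cover: "indicator {0..1} u \<le> (\<Sum>k<N. indicator (J k) u :: ennreal)" for u :: real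
  proof (cases "u \<in> {0..1}")
    case True
    \<comment> \<open>At the right end point the floor would give \<open>N\<close>, one interval too
      many.\<close>
    define k where "k = (if u = 1 then N - 1 else nat \<lfloor>u * real N\<rfloor>)"
    have "k < N \<and> u \<in> J k"
    proof (cases "u = 1")
      case True
      then show ?thesis using N(1) by (auto simp: k_def J_def of_nat_diff field_simps)
    next
      case False
      then have u: "0 \<le> u" "u < 1" using True by auto
      then have "real k = of_int \<lfloor>u * real N\<rfloor>" using False by (simp add: k_def)
      then have "real k \<le> u * real N" "u * real N \<le> real k + 1" by linarith+
      moreover have "u * real N < 1 * real N" using u N(1) by (intro mult_strict_right_mono) auto
      moreover have "k < N" using calculation by linarith
      ultimately have "k < N" "real k / real N \<le> u" "u \<le> real k / real N + 1 / real N"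
        using N(1) by (simp_all add: field_simps)
      then show ?thesis by (simp add: J_def)
    qed
    then have "indicator {0..1} u \<le> (\<Sum>k\<in>{k}. indicator (J k) u :: ennreal)" by (simp add: indicator_def)
    also have "\<dots> \<le> (\<Sum>k<N. indicator (J k) u)"
      using \<open>k < N \<and> u \<in> J k\<close> by (intro sum_mono2) auto
    finally show ?thesis .
  qed simp
  have "(\<integral>\<^sup>+u. h u * indicator {0..1} u \<partial>lborel) \<le> (\<integral>\<^sup>+u. (\<Sum>k<N. h u * indicator (J k) u) \<partial>lborel)"
    unfolding sum_distrib_left[symmetric] by (intro nn_integral_mono mult_left_mono cover) simp
  also have "\<dots> = (\<Sum>k<N. \<integral>\<^sup>+u. h u * indicator (J k) u \<partial>lborel)"
    by (intro nn_integral_sum) (auto simp: J_def)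
  also have "\<dots> \<le> (\<Sum>k<N. ennreal (exp (\<kappa> / 4) * (sqrt (8 * pi / \<kappa>) / (\<gamma> * L) + 1 / real N * exp (- \<kappa> * \<alpha>\<^sup>2 / 8))))"
    unfolding h_def J_def using N
    by (intro sum_mono lattice_gaussian_integral_interval[OF x nw pos]) (auto simp: field_simps)
  also have "\<dots> = ennreal (exp (\<kappa> / 4) * (real N * sqrt (8 * pi / \<kappa>) / (\<gamma> * L) + exp (- \<kappa> * \<alpha>\<^sup>2 / 8)))"
  proof -
    define c where "c = exp (\<kappa> / 4) * (sqrt (8 * pi / \<kappa>) / (\<gamma> * L) + 1 / real N * exp (- \<kappa> * \<alpha>\<^sup>2 / 8))"
    have "0 \<le> c" using pos by (simp add: c_def)
    then have "(\<Sum>k<N. ennreal c) = ennreal (real N * c)"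
      by (simp add: ennreal_mult ennreal_of_nat_eq_real_of_nat)
    moreover have "real N * c = exp (\<kappa> / 4) * (real N * sqrt (8 * pi / \<kappa>) / (\<gamma> * L) + exp (- \<kappa> * \<alpha>\<^sup>2 / 8))"
      using N(1) by (simp add: c_def distrib_left)
    ultimately show ?thesis by (simp only: c_def)
  qed
  finally show ?thesis by (simp add: h_def)
qed

section \<open>Counting integer vectors\<close>

lemma sum_exp_abs_int_le:
  fixes s :: real
  assumes "0 < s"
  shows "(\<Sum>k\<in>{- int N..int N}. exp (- s * \<bar>of_int k\<bar>)) \<le> 1 + 2 / s"
proof -
  define r where "r = exp (- s)"
  have r: "0 < r" "r * (exp s - 1) = 1 - r" "0 < exp s - 1"
    using assms by (auto simp: r_def algebra_simps simp flip: exp_add)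
  \<comment> \<open>Closed form of the two geometric tails, to be bounded through
    \<open>exp s - 1 >= s\<close>.\<close>
  have "(\<Sum>k\<in>{- int N..int N}. exp (- s * \<bar>of_int k\<bar>)) = 1 + 2 * (1 - r ^ N) / (exp s - 1)"
  proof (induction N)
    case (Suc N)
    have "{- int (Suc N)..int (Suc N)} = insert (int (Suc N)) (insert (- int (Suc N)) {- int N..int N})" by auto
    then have "(\<Sum>k\<in>{- int (Suc N)..int (Suc N)}. exp (- s * \<bar>of_int k\<bar>))
        = 2 * r ^ Suc N + (\<Sum>k\<in>{- int N..int N}. exp (- s * \<bar>of_int k\<bar>))"
      by (simp add: r_def algebra_simps flip: exp_of_nat_mult exp_add)
    also have "\<dots> = 2 * (r ^ N * (r * (exp s - 1))) / (exp s - 1) + (1 + 2 * (1 - r ^ N) / (exp s - 1))"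
      using Suc.IH r(3) by simp
    also have "\<dots> = 1 + 2 * (1 - r ^ Suc N) / (exp s - 1)"
      unfolding r(2) by (simp add: add_divide_distrib diff_divide_distrib algebra_simps)
    finally show ?case .
  qed simp
  also have "\<dots> \<le> 1 + 2 / s"
  proof -
    have "2 * (1 - r ^ N) / (exp s - 1) \<le> 2 / s"
      using r assms exp_ge_add_one_self[of s] by (intro frac_le) (auto simp del: exp_ge_add_one_self)
    then show ?thesis by simp
  qed
  finally show ?thesis .
qed

text \<open>Exponential weights: each \<open>p\<close> in \<open>S\<close> has weight
  \<open>exp (s (M - sum |p j|)) >= 1\<close>, and the total weight over a box factorises into
  one-dimensional sums. The parameter \<open>s\<close> stays free: a large one suits sparse vectors,
  where \<open>1 + 2 / s\<close> must be close to 1, and a small one suits large entries.\<close>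

lemma card_int_vectors_le:
  fixes S :: "(nat \<Rightarrow> int) set" and s :: real
  assumes "S \<subseteq> ({..<n} \<rightarrow>\<^sub>E UNIV)" "\<And>p. p \<in> S \<Longrightarrow> (\<Sum>j<n. \<bar>real_of_int (p j)\<bar>) \<le> M" "0 < s"
  shows "finite S" "real (card S) \<le> exp (s * M) * (1 + 2 / s) ^ n"
proof -
  define N where "N = nat \<lfloor>M\<rfloor>"
  let ?B = "{- int N..int N}"
  have sub: "S \<subseteq> ({..<n} \<rightarrow>\<^sub>E ?B)"
  proof
    fix p assume p: "p \<in> S"
    have "p j \<in> ?B" if "j < n" for j
    proof -
      have "\<bar>real_of_int (p j)\<bar> \<le> (\<Sum>j<n. \<bar>real_of_int (p j)\<bar>)"
        using that by (intro member_le_sum) auto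
      then have "of_int \<bar>p j\<bar> \<le> M" using assms(2)[OF p] by simp
      then have "\<bar>p j\<bar> \<le> \<lfloor>M\<rfloor>" by (simp add: le_floor_iff)
      moreover from this have "int N = \<lfloor>M\<rfloor>" using abs_ge_zero[of "p j"] unfolding N_def by linarith
      ultimately show ?thesis by auto
    qed
    then show "p \<in> {..<n} \<rightarrow>\<^sub>E ?B" using p assms(1) by (auto simp: PiE_iff)
  qed
  have fin: "finite ({..<n} \<rightarrow>\<^sub>E ?B)" by (intro finite_PiE) auto
  show "finite S" using sub fin by (rule finite_subset)
  have "real (card S) = (\<Sum>p\<in>S. 1)" by simp
  also have "\<dots> \<le> (\<Sum>p\<in>S. exp (s * M) * (\<Prod>j<n. exp (- s * \<bar>of_int (p j)\<bar>)))"
  proof (rule sum_mono)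
    fix p assume "p \<in> S"
    then have "s * (\<Sum>j<n. \<bar>real_of_int (p j)\<bar>) \<le> s * M" using assms by (intro mult_left_mono) auto
    then have "1 \<le> exp (s * M + (\<Sum>j<n. - s * \<bar>of_int (p j)\<bar>))"
      by (simp add: sum_negf sum_distrib_left)
    then show "1 \<le> exp (s * M) * (\<Prod>j<n. exp (- s * \<bar>of_int (p j)\<bar>))"
      by (simp add: exp_add exp_sum)
  qed
  also have "\<dots> \<le> (\<Sum>p\<in>{..<n} \<rightarrow>\<^sub>E ?B. exp (s * M) * (\<Prod>j<n. exp (- s * \<bar>of_int (p j)\<bar>)))"
    using fin sub by (intro sum_mono2) (auto intro!: mult_nonneg_nonneg prod_nonneg)
  also have "\<dots> = exp (s * M) * (\<Prod>j<n. \<Sum>k\<in>?B. exp (- s * \<bar>of_int k\<bar>))"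
    by (subst prod_sum_PiE) (simp_all add: sum_distrib_left)
  also have "\<dots> \<le> exp (s * M) * (\<Prod>j<n. 1 + 2 / s)"
    using assms(3) by (intro mult_left_mono prod_mono conjI sum_nonneg sum_exp_abs_int_le) auto
  finally show "real (card S) \<le> exp (s * M) * (1 + 2 / s) ^ n" by simp
qed

text \<open>On integers \<open>|k| <= k^2\<close>. For norm \<open>c sqrt n\<close> with small
  \<open>c\<close> this gives \<open>c^2 n\<close>, better than the \<open>c n\<close> of the
  Cauchy-Schwarz inequality; it captures the sparsity behind the count for small
  denominators.\<close>

lemma sum_abs_int_le_vnorm_power2:
  "(\<Sum>j<n. \<bar>real_of_int (p j)\<bar>) \<le> (vnorm n (\<lambda>j. of_int (p j)))\<^sup>2"
  unfolding vnorm_power2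
proof (rule sum_mono)
  fix j
  have "\<bar>p j\<bar> \<le> (p j)\<^sup>2"
  proof (cases "p j = 0")
    case False
    then have "\<bar>p j\<bar> * 1 \<le> \<bar>p j\<bar> * \<bar>p j\<bar>" by (intro mult_left_mono) auto
    then show ?thesis by (simp add: power2_eq_square)
  qed simp
  then show "\<bar>real_of_int (p j)\<bar> \<le> (real_of_int (p j))\<^sup>2"
    by (metis of_int_abs of_int_le_iff of_int_power)
qed

lemma sum_abs_le_vnorm: "(\<Sum>j<n. \<bar>a j\<bar>) \<le> sqrt (real n) * vnorm n a"
  using L2_set_mult_ineq[of "\<lambda>_. 1" a "{..<n}"] by (simp add: vnorm_L2_set L2_set_constant)

section \<open>Small ball probabilities\<close>

text \<open>The uniform law on \<open>[0, 1]\<close>. The frequency \<open>u\<close> lives on a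
  probability space, where boundedness settles integrability and Fubini's theorem applies.\<close>

definition unit_interval_measure :: "real measure" where
  "unit_interval_measure = density lborel (\<lambda>u. ennreal (indicator {0..1} u))"

lemma sets_unit_interval_measure [simp, measurable_cong]: "sets unit_interval_measure = sets borel"
  by (simp add: unit_interval_measure_def)

lemma prob_space_unit_interval_measure: "prob_space unit_interval_measure"
proof
  have "emeasure unit_interval_measure (space unit_interval_measure) = (\<integral>\<^sup>+u. indicator {0..1::real} u \<partial>lborel)"
    unfolding unit_interval_measure_def by (subst emeasure_density) (auto intro!: nn_integral_cong simp: ennreal_indicator)
  then show "emeasure unit_interval_measure (space unit_interval_measure) = 1" by simp
qed

lemma nn_integral_unit_interval_measure:
  "f \<in> borel_measurable borel \<Longrightarrow>
    (\<integral>\<^sup>+u. f u \<partial>unit_interval_measure) = (\<integral>\<^sup>+u. f u * indicator {0..1} u \<partial>lborel)"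
  unfolding unit_interval_measure_def
  by (subst nn_integral_density) (auto simp: ennreal_indicator mult.commute)

lemma exp_minus_square_le_unit_interval:
  "exp (- s\<^sup>2) \<le> 6 * (\<integral>u. (1 - u)\<^sup>2 * cos (u * s) \<partial>unit_interval_measure)"
proof -
  have "(\<integral>u. (1 - u)\<^sup>2 * cos (u * s) \<partial>unit_interval_measure)
      = (\<integral>u. ((1 - u)\<^sup>2 * cos (u * s)) * indicator {0..1} u \<partial>lborel)"
    unfolding unit_interval_measure_def by (subst integral_density) (auto simp: mult.commute)
  then show ?thesis using exp_minus_square_le_cosine_transform[of s] by simp
qed

lemma AE_unit_interval_measure: "AE u in unit_interval_measure. 0 \<le> u \<and> u \<le> 1"
  unfolding unit_interval_measure_def by (subst AE_density) (auto simp: indicator_def)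

lemma borel_measurable_dist_lattice:
  assumes [measurable]: "\<And>j. j < n \<Longrightarrow> f j \<in> borel_measurable N"
  shows "(\<lambda>x. dist_lattice n (\<lambda>j. f j x)) \<in> borel_measurable N"
proof -
  have [measurable]: "(\<lambda>x::real. real_of_int (round x)) \<in> borel_measurable borel"
    unfolding round_def by measurable
  show ?thesis unfolding dist_lattice_eq_round vnorm_def by measurable
qed

lemma sum_singleton_times: "(\<Sum>k\<in>{i} \<times> J. f k) = (\<Sum>j\<in>J. f (i, j))"
proof -
  have "{i} \<times> J = Pair i ` J" by auto
  then show ?thesis by (simp add: sum.reindex inj_on_def)
qed

lemma prod_singleton_times: "(\<Prod>k\<in>{i} \<times> J. f k) = (\<Prod>j\<in>J. f (i, j))"
proof -
  have "{i} \<times> J = Pair i ` J" by auto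
  then show ?thesis by (simp add: prod.reindex inj_on_def)
qed

context real_distribution
begin

section \<open>Symmetrization and characteristic functions\<close>

text \<open>If every annulus \<open>a <= |X - Y| <= b\<close> were null, two independent copies
  would agree almost surely; but for fixed \<open>x\<close> centering and unit variance give
  \<open>E (x - Y)^2 = x^2 + 1\<close>. Later \<open>a\<close> keeps the frequencies from collapsing
  to 0, and \<open>b\<close> limits the range that they sweep.\<close>

lemma symmetrization_nondegenerate:
  assumes "integrable M (\<lambda>x. x)" "(\<integral>x. x \<partial>M) = 0"
    and "integrable M (\<lambda>x. x\<^sup>2)" "(\<integral>x. x\<^sup>2 \<partial>M) = 1"
  obtains a b where "0 < a" "a \<le> b" "0 < measure (M \<Otimes>\<^sub>M M) {z. a \<le> \<bar>fst z - snd z\<bar> \<and> \<bar>fst z - snd z\<bar> \<le> b}"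
proof (rule ccontr)
  assume "\<not> thesis"
  interpret pair: pair_prob_space M M ..
  define W where "W k = {z::real \<times> real. 1 / (real k + 1) \<le> \<bar>fst z - snd z\<bar> \<and> \<bar>fst z - snd z\<bar> \<le> real k + 1}" for k :: nat
  have W_meas: "W k \<in> sets (M \<Otimes>\<^sub>M M)" for k
  proof -
    have "{z \<in> space (M \<Otimes>\<^sub>M M). 1 / (real k + 1) \<le> \<bar>fst z - snd z\<bar> \<and> \<bar>fst z - snd z\<bar> \<le> real k + 1} \<in> sets (M \<Otimes>\<^sub>M M)"
      by measurable
    then show ?thesis by (simp add: W_def space_pair_measure)
  qed
  have null: "W k \<in> null_sets (M \<Otimes>\<^sub>M M)" for k
  proof -
    have "\<not> 0 < measure (M \<Otimes>\<^sub>M M) (W k)"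
    proof
      assume "0 < measure (M \<Otimes>\<^sub>M M) (W k)"
      moreover have "1 / (real k + 1) \<le> real k + 1" by (simp add: field_simps)
      ultimately show False
        using that[of "1 / (real k + 1)" "real k + 1"] \<open>\<not> thesis\<close> unfolding W_def by simp
    qed
    then have "measure (M \<Otimes>\<^sub>M M) (W k) = 0" using measure_nonneg[of "M \<Otimes>\<^sub>M M" "W k"] by linarith
    then show ?thesis using W_meas by (simp add: null_sets_def pair.P.emeasure_eq_measure)
  qed
  have "(\<Union>k. W k) \<in> null_sets (M \<Otimes>\<^sub>M M)" using null by (rule null_sets_UN)
  moreover have "z \<in> (\<Union>k. W k)" if "fst z \<noteq> snd z" for z
  proof -
    define d where "d = \<bar>fst z - snd z\<bar>"
    have d: "0 < d" using that by (simp add: d_def)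
    obtain k :: nat where k: "max d (1 / d) \<le> real k" using real_arch_simple by blast
    have "1 / d \<le> real k + 1" using k by simp
    then have "1 / (real k + 1) \<le> d" using d by (simp add: field_simps)
    then have "z \<in> W k" using k by (simp add: W_def d_def)
    then show ?thesis by blast
  qed
  ultimately have "AE z in M \<Otimes>\<^sub>M M. fst z = snd z"
    by (intro AE_I'[of "\<Union>k. W k"] subsetI) blast+
  then have "AE z in M \<Otimes>\<^sub>M M. ennreal ((fst z - snd z)\<^sup>2) = 0"
    by eventually_elim simp
  then have "(\<integral>\<^sup>+z. ennreal ((fst z - snd z)\<^sup>2) \<partial>(M \<Otimes>\<^sub>M M)) = (\<integral>\<^sup>+z. 0 \<partial>(M \<Otimes>\<^sub>M M))"
    by (rule nn_integral_cong_AE)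
  moreover have "(\<integral>\<^sup>+z. ennreal ((fst z - snd z)\<^sup>2) \<partial>(M \<Otimes>\<^sub>M M))
      = (\<integral>\<^sup>+x. \<integral>\<^sup>+y. ennreal ((x - y)\<^sup>2) \<partial>M \<partial>M)"
  proof -
    have "(\<lambda>z. ennreal ((fst z - snd z)\<^sup>2)) \<in> borel_measurable (M \<Otimes>\<^sub>M M)" by measurable
    from nn_integral_fst[OF this] show ?thesis by simp
  qed
  moreover have "(\<integral>\<^sup>+y. ennreal ((x - y)\<^sup>2) \<partial>M) = ennreal (x\<^sup>2 + 1)" for x
  proof -
    have eq: "(x - y)\<^sup>2 = x\<^sup>2 - 2 * x * y + y\<^sup>2" for y by (simp add: power2_eq_square algebra_simps)
    have int1: "integrable M (\<lambda>y. x\<^sup>2 - 2 * x * y)" using assms(1) by simp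
    have int2: "integrable M (\<lambda>y. x\<^sup>2 - 2 * x * y + y\<^sup>2)"
      using int1 assms(3) by (rule Bochner_Integration.integrable_add)
    have "(\<integral>\<^sup>+y. ennreal ((x - y)\<^sup>2) \<partial>M) = ennreal (\<integral>y. (x - y)\<^sup>2 \<partial>M)"
      using int2 by (intro nn_integral_eq_integral AE_I2 zero_le_power2) (simp only: eq)
    also have "(\<integral>y. (x - y)\<^sup>2 \<partial>M) = (\<integral>y. x\<^sup>2 - 2 * x * y \<partial>M) + (\<integral>y. y\<^sup>2 \<partial>M)"
      unfolding eq using int1 assms(3) by (rule Bochner_Integration.integral_add)
    also have "(\<integral>y. x\<^sup>2 - 2 * x * y \<partial>M) = x\<^sup>2"
      using assms(1,2) prob_space by simp
    also have "x\<^sup>2 + (\<integral>y. y\<^sup>2 \<partial>M) = x\<^sup>2 + 1" using assms(4) by simp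
    finally show ?thesis .
  qed
  moreover have "(\<integral>\<^sup>+x. 1 \<partial>M) \<le> (\<integral>\<^sup>+x. ennreal (x\<^sup>2 + 1) \<partial>M)"
    by (intro nn_integral_mono) (simp flip: ennreal_1)
  ultimately show False using emeasure_space_1 by simp
qed

text \<open>\<open>|char M t|^2\<close> is the mean of \<open>cos (t (X - Y))\<close> for
  independent copies. Apply \<open>y <= exp (y - 1)\<close> to it; the square root produces the
  factor \<open>1 / 2\<close>.\<close>

lemma cmod_char_le_symmetrization:
  "cmod (char M t) \<le> exp (- (1 / 2) * (\<integral>z. 1 - cos (t * (fst z - snd z)) \<partial>(M \<Otimes>\<^sub>M M)))"
proof -
  interpret pair: pair_prob_space M M ..
  have int: "integrable M (\<lambda>x. cos (t * x))" "integrable M (\<lambda>x. sin (t * x))"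
    by (auto intro!: integrable_const_bound[where B = 1])
  have iint: "integrable M (\<lambda>x. iexp (t * x))" by (intro integrable_iexp) auto
  have Re: "Re (char M t) = (\<integral>x. cos (t * x) \<partial>M)"
    unfolding char_def integral_Re[OF iint, symmetric] by (simp add: Re_exp)
  have Im: "Im (char M t) = (\<integral>x. sin (t * x) \<partial>M)"
    unfolding char_def integral_Im[OF iint, symmetric] by (simp add: Im_exp)
  have pint: "integrable (M \<Otimes>\<^sub>M M) (\<lambda>z. cos (t * (fst z - snd z)))"
    by (intro pair.P.integrable_const_bound[where B = 1]) auto
  have "(\<integral>z. cos (t * (fst z - snd z)) \<partial>(M \<Otimes>\<^sub>M M)) = (\<integral>x. \<integral>y. cos (t * (x - y)) \<partial>M \<partial>M)"
    using pair.integral_fst'[OF pint] by simp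
  also have "\<dots> = (\<integral>x. cos (t * x) * (\<integral>y. cos (t * y) \<partial>M) + sin (t * x) * (\<integral>y. sin (t * y) \<partial>M) \<partial>M)"
    using int by (simp add: right_diff_distrib cos_diff)
  also have "\<dots> = (\<integral>y. cos (t * y) \<partial>M)\<^sup>2 + (\<integral>y. sin (t * y) \<partial>M)\<^sup>2"
    using int by (simp add: power2_eq_square)
  also have "\<dots> = (cmod (char M t))\<^sup>2" by (simp add: cmod_power2 Re Im)
  finally have c: "(cmod (char M t))\<^sup>2 = (\<integral>z. cos (t * (fst z - snd z)) \<partial>(M \<Otimes>\<^sub>M M))" by simp
  have "(\<integral>z. 1 - cos (t * (fst z - snd z)) \<partial>(M \<Otimes>\<^sub>M M)) = 1 - (cmod (char M t))\<^sup>2"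
    unfolding c using pint by (simp add: pair.P.prob_space)
  moreover have "cmod (char M t) \<le> exp (- (1 / 2) * (1 - (cmod (char M t))\<^sup>2))"
  proof (rule power2_le_imp_le)
    have "(cmod (char M t))\<^sup>2 \<le> exp ((cmod (char M t))\<^sup>2 - 1)"
      using exp_ge_add_one_self[of "(cmod (char M t))\<^sup>2 - 1"] by simp
    also have "\<dots> = (exp (- (1 / 2) * (1 - (cmod (char M t))\<^sup>2)))\<^sup>2"
      by (simp add: power2_eq_square flip: exp_add)
    finally show "(cmod (char M t))\<^sup>2 \<le> (exp (- (1 / 2) * (1 - (cmod (char M t))\<^sup>2)))\<^sup>2" .
  qed simp
  ultimately show ?thesis by simp
qed

text \<open>Summing \<open>1 - cos\<close> over the coordinates gives at least the squared lattice
  distance \<open>h\<close>. Restricted to \<open>W\<close>, the exponent is \<open>p / 2\<close>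
  times the conditional mean of \<open>h\<close>, and Jensen's inequality takes the mean out of the
  exponential; \<open>1 / p\<close> normalises the conditional law.\<close>

lemma prod_char_le:
  fixes a b v :: real and n :: nat and x :: "nat \<Rightarrow> real"
  defines "W \<equiv> {z::real \<times> real. a \<le> \<bar>fst z - snd z\<bar> \<and> \<bar>fst z - snd z\<bar> \<le> b}"
  defines "p \<equiv> measure (M \<Otimes>\<^sub>M M) W"
  defines "h \<equiv> \<lambda>z. (dist_lattice n (\<lambda>j. v * (fst z - snd z) / (2 * pi) * x j))\<^sup>2"
  assumes p: "0 < p"
  shows "ennreal (\<Prod>j<n. cmod (char M (v * x j)))
    \<le> ennreal (1 / p) * (\<integral>\<^sup>+z. ennreal (exp (- (p / 2) * h z)) * indicator W z \<partial>(M \<Otimes>\<^sub>M M))"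
proof -
  interpret pair: pair_prob_space M M ..
  have W_meas [measurable]: "W \<in> sets (M \<Otimes>\<^sub>M M)"
  proof -
    have "{z \<in> space (M \<Otimes>\<^sub>M M). a \<le> \<bar>fst z - snd z\<bar> \<and> \<bar>fst z - snd z\<bar> \<le> b} \<in> sets (M \<Otimes>\<^sub>M M)"
      by measurable
    then show ?thesis by (simp add: W_def space_pair_measure)
  qed
  have h_meas [measurable]: "h \<in> borel_measurable (M \<Otimes>\<^sub>M M)"
    unfolding h_def by (intro borel_measurable_power borel_measurable_dist_lattice) measurable
  define C where "C z = (\<Sum>j<n. 1 - cos (v * x j * (fst z - snd z)))" for z :: "real \<times> real"
  have hC: "h z \<le> C z" for z
    unfolding h_def C_def
  proof -
    have "2 * pi * (v * (fst z - snd z) / (2 * pi) * x j) = v * x j * (fst z - snd z)" for j by simp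
    then show "(dist_lattice n (\<lambda>j. v * (fst z - snd z) / (2 * pi) * x j))\<^sup>2 \<le> (\<Sum>j<n. 1 - cos (v * x j * (fst z - snd z)))"
      using dist_lattice_power2_le_cos[of n "\<lambda>j. v * (fst z - snd z) / (2 * pi) * x j"] by (simp only:)
  qed
  have C_int1: "integrable (M \<Otimes>\<^sub>M M) (\<lambda>z. 1 - cos (v * x j * (fst z - snd z)))" for j
  proof (intro Bochner_Integration.integrable_diff)
    show "integrable (M \<Otimes>\<^sub>M M) (\<lambda>z. cos (v * x j * (fst z - snd z)))"
      by (intro pair.P.integrable_const_bound[where B = 1]) auto
  qed simp
  have C_int: "integrable (M \<Otimes>\<^sub>M M) C" unfolding C_def using C_int1 by auto
  have h0: "0 \<le> h z" for z by (simp add: h_def)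
  have C0: "0 \<le> C z" for z using h0[of z] hC[of z] by linarith
  have h_int: "integrable (M \<Otimes>\<^sub>M M) h"
    using C_int by (rule Bochner_Integration.integrable_bound) (use h0 hC C0 in auto)
  define c where "c = (\<integral>z. h z * indicator W z \<partial>(M \<Otimes>\<^sub>M M))"
  have hW_int: "integrable (M \<Otimes>\<^sub>M M) (\<lambda>z. h z * indicator W z)"
    using W_meas h_int by (rule integrable_real_mult_indicator)
  have c_le: "c \<le> (\<integral>z. C z \<partial>(M \<Otimes>\<^sub>M M))"
    unfolding c_def using hW_int C_int
    by (rule integral_mono) (use hC C0 in \<open>auto simp: indicator_def\<close>)
  have "(\<Prod>j<n. cmod (char M (v * x j)))
      \<le> (\<Prod>j<n. exp (- (1 / 2) * (\<integral>z. 1 - cos (v * x j * (fst z - snd z)) \<partial>(M \<Otimes>\<^sub>M M))))"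
    by (intro prod_mono conjI cmod_char_le_symmetrization) auto
  also have "\<dots> = exp (- (1 / 2) * (\<integral>z. C z \<partial>(M \<Otimes>\<^sub>M M)))"
    unfolding C_def by (subst Bochner_Integration.integral_sum) (auto simp: C_int1 exp_sum sum_distrib_left)
  also have "\<dots> \<le> exp (- (1 / 2) * c)" using c_le by simp
  finally have 1: "(\<Prod>j<n. cmod (char M (v * x j))) \<le> exp (- (1 / 2) * c)" .
  \<comment> \<open>Jensen's inequality for the conditional law on \<open>W\<close>, from the tangent line of \<open>exp\<close>.\<close>
  define g where "g z = exp (- (1 / 2) * c) * ((1 + c / 2) * indicator W z - (p / 2) * (h z * indicator W z))" for z
  have W_int: "integrable (M \<Otimes>\<^sub>M M) (\<lambda>z. indicator W z :: real)"
    using W_meas by (rule integrable_real_indicator) (simp add: pair.P.emeasure_eq_measure)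
  have g_int: "integrable (M \<Otimes>\<^sub>M M) g" unfolding g_def using W_int hW_int by auto
  have g_val: "(\<integral>z. g z \<partial>(M \<Otimes>\<^sub>M M)) = exp (- (1 / 2) * c) * p"
  proof -
    have "(\<integral>z. indicator W z \<partial>(M \<Otimes>\<^sub>M M)) = p" by (simp add: p_def space_pair_measure)
    then have "(\<integral>z. g z \<partial>(M \<Otimes>\<^sub>M M)) = exp (- (1 / 2) * c) * ((1 + c / 2) * p - (p / 2) * c)"
      unfolding g_def using W_int hW_int by (simp add: c_def[symmetric])
    then show ?thesis by (simp add: algebra_simps)
  qed
  have e_int: "integrable (M \<Otimes>\<^sub>M M) (\<lambda>z. exp (- (p / 2) * h z) * indicator W z)"
    using h0 p by (intro pair.P.integrable_const_bound[where B = 1] AE_I2) (auto simp: indicator_def)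
  have "g z \<le> exp (- (p / 2) * h z) * indicator W z" for z
  proof (cases "z \<in> W")
    case True
    have "exp (- (1 / 2) * c) * (1 + (c / 2 - (p / 2) * h z)) \<le> exp (- (1 / 2) * c) * exp (c / 2 - (p / 2) * h z)"
      by (intro mult_left_mono) auto
    also have "\<dots> = exp (- (p / 2) * h z)" by (simp flip: exp_add)
    finally show ?thesis using True by (simp add: g_def algebra_simps)
  qed (simp add: g_def)
  then have "exp (- (1 / 2) * c) * p \<le> (\<integral>z. exp (- (p / 2) * h z) * indicator W z \<partial>(M \<Otimes>\<^sub>M M))"
    unfolding g_val[symmetric] using g_int e_int by (intro integral_mono) auto
  then have "exp (- (1 / 2) * c) \<le> 1 / p * (\<integral>z. exp (- (p / 2) * h z) * indicator W z \<partial>(M \<Otimes>\<^sub>M M))"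
    using p by (simp add: field_simps)
  with 1 have "ennreal (\<Prod>j<n. cmod (char M (v * x j)))
      \<le> ennreal (1 / p * (\<integral>z. exp (- (p / 2) * h z) * indicator W z \<partial>(M \<Otimes>\<^sub>M M)))"
    by (intro ennreal_leI) linarith
  also have "\<dots> = ennreal (1 / p) * ennreal (\<integral>z. exp (- (p / 2) * h z) * indicator W z \<partial>(M \<Otimes>\<^sub>M M))"
    using p by (intro ennreal_mult Bochner_Integration.integral_nonneg) auto
  also have "ennreal (\<integral>z. exp (- (p / 2) * h z) * indicator W z \<partial>(M \<Otimes>\<^sub>M M))
      = (\<integral>\<^sup>+z. ennreal (exp (- (p / 2) * h z) * indicator W z) \<partial>(M \<Otimes>\<^sub>M M))"
    using e_int by (intro nn_integral_eq_integral[symmetric]) auto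
  also have "\<dots> = (\<integral>\<^sup>+z. ennreal (exp (- (p / 2) * h z)) * indicator W z \<partial>(M \<Otimes>\<^sub>M M))"
    by (intro nn_integral_cong) (simp add: indicator_def)
  finally show ?thesis .
qed

text \<open>A Gaussian of the linear form \<open>S\<close> is dominated by an average of
  \<open>cos (u S / t)\<close> with nonnegative weights \<open>(1 - u)^2\<close>, and the mean of
  each cosine is the real part of a characteristic function, which factorises over the independent
  coordinates.\<close>

lemma laplace_square_le_char:
  fixes x :: "nat \<Rightarrow> real"
  assumes t: "0 < t"
  shows "(\<integral>\<^sup>+\<omega>. ennreal (exp (- (\<Sum>j<n. x j * \<omega> (i, j))\<^sup>2 / t\<^sup>2)) \<partial>PiM ({i} \<times> {..<n}) (\<lambda>_. M))
    \<le> 6 * (\<integral>\<^sup>+u. ennreal (\<Prod>j<n. cmod (char M (u / t * x j))) \<partial>unit_interval_measure)"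
proof -
  define K where "K = {i} \<times> {..<n}"
  define P where "P = PiM K (\<lambda>_. M)"
  define S where "S \<omega> = (\<Sum>j<n. x j * \<omega> (i, j))" for \<omega>
  interpret P: prob_space P unfolding P_def by (intro prob_space_PiM prob_space_axioms)
  interpret U: prob_space unit_interval_measure by (rule prob_space_unit_interval_measure)
  interpret PU: pair_prob_space P unit_interval_measure ..
  have [measurable]: "S \<in> borel_measurable P"
    using linear_form_measurable[where K = K and a = "\<lambda>k. x (snd k)"]
    by (simp add: S_def[abs_def] P_def K_def sum_singleton_times)
  have charS: "(\<integral>\<omega>. iexp (v * S \<omega>) \<partial>P) = (\<Prod>j<n. char M (v * x j))" for v
  proof -
    have "(\<integral>\<omega>. iexp (v * S \<omega>) \<partial>P) = (\<integral>\<omega>. (\<Prod>k\<in>K. iexp (v * x (snd k) * \<omega> k)) \<partial>P)"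
      by (simp add: S_def K_def prod_singleton_times sum_distrib_left algebra_simps flip: exp_sum)
    also have "\<dots> = (\<Prod>k\<in>K. \<integral>y. iexp (v * x (snd k) * y) \<partial>M)"
      unfolding P_def by (rule powers.product_integral_prod) (auto simp: K_def intro!: integrable_iexp)
    also have "\<dots> = (\<Prod>j<n. char M (v * x j))"
      by (simp add: K_def prod_singleton_times char_def)
    finally show ?thesis .
  qed
  have cosS: "\<bar>\<integral>\<omega>. cos (v * S \<omega>) \<partial>P\<bar> \<le> (\<Prod>j<n. cmod (char M (v * x j)))" for v
  proof -
    have "integrable P (\<lambda>\<omega>. iexp (v * S \<omega>))" by (intro P.integrable_iexp) auto
    from integral_Re[OF this] have "(\<integral>\<omega>. cos (v * S \<omega>) \<partial>P) = Re (\<integral>\<omega>. iexp (v * S \<omega>) \<partial>P)"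
      by (simp add: Re_exp)
    then show ?thesis using abs_Re_le_cmod[of "\<integral>\<omega>. iexp (v * S \<omega>) \<partial>P"] unfolding charS by (simp add: prod_norm)
  qed
  have pos: "AE z in P \<Otimes>\<^sub>M unit_interval_measure. 0 \<le> snd z \<and> snd z \<le> 1"
  proof (rule PU.AE_pair_measure)
    show "{z \<in> space (P \<Otimes>\<^sub>M unit_interval_measure). 0 \<le> snd z \<and> snd z \<le> 1} \<in> sets (P \<Otimes>\<^sub>M unit_interval_measure)"
      by measurable
  qed (use AE_unit_interval_measure in simp)
  have int: "integrable (P \<Otimes>\<^sub>M unit_interval_measure) (\<lambda>(\<omega>, u). (1 - u)\<^sup>2 * cos (u * (S \<omega> / t)))"
  proof (rule PU.P.integrable_const_bound[where B = 1])
    show "AE z in P \<Otimes>\<^sub>M unit_interval_measure. norm (case z of (\<omega>, u) \<Rightarrow> (1 - u)\<^sup>2 * cos (u * (S \<omega> / t))) \<le> 1"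
      using pos
    proof eventually_elim
      case (elim z)
      then have "(1 - snd z)\<^sup>2 \<le> 1" by (intro power_le_one) auto
      then have "(1 - snd z)\<^sup>2 * \<bar>cos (snd z * (S (fst z) / t))\<bar> \<le> 1 * 1" by (intro mult_mono) auto
      then show ?case by (simp add: case_prod_beta abs_mult)
    qed
  qed measurable
  have U_int: "integrable unit_interval_measure (\<lambda>u. \<Prod>j<n. cmod (char M (u / t * x j)))"
    by (intro U.integrable_const_bound[where B = 1] AE_I2)
      (auto simp: abs_prod intro!: prod_le_1 cmod_char_le_1)
  have C_int: "integrable P (\<lambda>\<omega>. \<integral>u. (1 - u)\<^sup>2 * cos (u * (S \<omega> / t)) \<partial>unit_interval_measure)"
    using PU.integrable_fst'[OF int] by simp
  have D_int: "integrable unit_interval_measure (\<lambda>u. \<integral>\<omega>. (1 - u)\<^sup>2 * cos (u * (S \<omega> / t)) \<partial>P)"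
    using PU.integrable_snd[OF int] by simp
  have E_int: "integrable P (\<lambda>\<omega>. exp (- (S \<omega> / t)\<^sup>2))"
    by (intro P.integrable_const_bound[where B = 1] AE_I2) auto
  have "(\<integral>\<omega>. exp (- (S \<omega> / t)\<^sup>2) \<partial>P)
      \<le> (\<integral>\<omega>. 6 * (\<integral>u. (1 - u)\<^sup>2 * cos (u * (S \<omega> / t)) \<partial>unit_interval_measure) \<partial>P)"
    using E_int C_int by (intro integral_mono exp_minus_square_le_unit_interval) auto
  also have "\<dots> = 6 * (\<integral>u. (\<integral>\<omega>. (1 - u)\<^sup>2 * cos (u * (S \<omega> / t)) \<partial>P) \<partial>unit_interval_measure)"
    using PU.Fubini_integral[OF int] by simp
  also have "\<dots> \<le> 6 * (\<integral>u. (\<Prod>j<n. cmod (char M (u / t * x j))) \<partial>unit_interval_measure)"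
  proof (intro mult_left_mono integral_mono_AE D_int U_int)
    show "AE u in unit_interval_measure. (\<integral>\<omega>. (1 - u)\<^sup>2 * cos (u * (S \<omega> / t)) \<partial>P) \<le> (\<Prod>j<n. cmod (char M (u / t * x j)))"
      using AE_unit_interval_measure
    proof eventually_elim
      case (elim u)
      have "(\<integral>\<omega>. (1 - u)\<^sup>2 * cos (u * (S \<omega> / t)) \<partial>P) = (1 - u)\<^sup>2 * (\<integral>\<omega>. cos (u / t * S \<omega>) \<partial>P)" by simp
      also have "\<dots> \<le> (1 - u)\<^sup>2 * (\<Prod>j<n. cmod (char M (u / t * x j)))"
        using cosS[of "u / t"] by (intro mult_left_mono) auto
      also have "\<dots> \<le> 1 * (\<Prod>j<n. cmod (char M (u / t * x j)))"
        using elim by (intro mult_right_mono prod_nonneg power_le_one) auto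
      finally show ?case by simp
    qed
  qed simp
  finally have main: "(\<integral>\<omega>. exp (- (S \<omega> / t)\<^sup>2) \<partial>P) \<le> 6 * (\<integral>u. (\<Prod>j<n. cmod (char M (u / t * x j))) \<partial>unit_interval_measure)" .
  have "(\<integral>\<^sup>+\<omega>. ennreal (exp (- (S \<omega>)\<^sup>2 / t\<^sup>2)) \<partial>P) = ennreal (\<integral>\<omega>. exp (- (S \<omega> / t)\<^sup>2) \<partial>P)"
    using nn_integral_eq_integral[OF E_int] by (simp add: power_divide)
  also have "\<dots> \<le> ennreal (6 * (\<integral>u. (\<Prod>j<n. cmod (char M (u / t * x j))) \<partial>unit_interval_measure))"
    by (intro ennreal_leI main)
  also have "\<dots> = 6 * ennreal (\<integral>u. (\<Prod>j<n. cmod (char M (u / t * x j))) \<partial>unit_interval_measure)"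
    by (subst ennreal_mult) (auto intro!: Bochner_Integration.integral_nonneg prod_nonneg)
  also have "ennreal (\<integral>u. (\<Prod>j<n. cmod (char M (u / t * x j))) \<partial>unit_interval_measure)
      = (\<integral>\<^sup>+u. ennreal (\<Prod>j<n. cmod (char M (u / t * x j))) \<partial>unit_interval_measure)"
    using U_int by (intro nn_integral_eq_integral[symmetric] AE_I2 prod_nonneg) auto
  finally show ?thesis by (simp add: S_def P_def K_def)
qed

text \<open>For a fixed difference \<open>z\<close> in \<open>W\<close> the frequencies sweep
  multiples of \<open>x\<close> from 0 to some \<open>L < b / t\<close>, and the lattice estimate
  turns the absence of witnesses below \<open>D\<close> into decay. The condition
  \<open>1 / D <= t\<close> bounds that range by \<open>b D\<close>.\<close>

lemma small_ball_LCD: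
  assumes "integrable M (\<lambda>x. x)" "(\<integral>x. x \<partial>M) = 0"
    and "integrable M (\<lambda>x. x\<^sup>2)" "(\<integral>x. x\<^sup>2 \<partial>M) = 1"
  obtains C \<kappa> where "0 < C" "0 < \<kappa>"
    "\<And>n x D \<gamma> \<alpha> t i. \<lbrakk>vnorm n x = 1; \<And>\<theta>. \<theta> < D \<Longrightarrow> \<not> LCD_witness n \<gamma> \<alpha> x \<theta>;
       0 < \<gamma>; 0 < \<alpha>; 0 < D; 1 / D \<le> t\<rbrakk> \<Longrightarrow>
     (\<integral>\<^sup>+\<omega>. ennreal (exp (- (\<Sum>j<n. x j * \<omega> (i::nat, j))\<^sup>2 / t\<^sup>2)) \<partial>PiM ({i} \<times> {..<n}) (\<lambda>_. M))
       \<le> ennreal (C * (t / \<gamma> + exp (- \<kappa> * \<alpha>\<^sup>2)))"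
proof -
  interpret pair: pair_prob_space M M ..
  obtain a b where ab: "0 < a" "a \<le> b"
    and pp: "0 < measure (M \<Otimes>\<^sub>M M) {z. a \<le> \<bar>fst z - snd z\<bar> \<and> \<bar>fst z - snd z\<bar> \<le> b}"
    using symmetrization_nondegenerate[OF assms] .
  define W where "W = {z::real \<times> real. a \<le> \<bar>fst z - snd z\<bar> \<and> \<bar>fst z - snd z\<bar> \<le> b}"
  define p where "p = measure (M \<Otimes>\<^sub>M M) W"
  have p: "0 < p" using pp by (simp add: p_def W_def)
  \<comment> \<open>\<open>b / t <= N D\<close>, so the same number of pieces serves every
    \<open>z\<close> in \<open>W\<close>.\<close>
  define N where "N = nat \<lceil>b\<rceil>"
  have N: "0 < N" "b \<le> real N" using ab by (auto simp: N_def)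
  define A where "A = real N * sqrt (8 * pi / (p / 2)) * (2 * pi / a)"
  define C where "C = 6 * exp (p / 8) * (A + 1)"
  have A: "0 \<le> A" using ab p by (simp add: A_def)
  have W_meas [measurable]: "W \<in> sets (M \<Otimes>\<^sub>M M)"
  proof -
    have "{z \<in> space (M \<Otimes>\<^sub>M M). a \<le> \<bar>fst z - snd z\<bar> \<and> \<bar>fst z - snd z\<bar> \<le> b} \<in> sets (M \<Otimes>\<^sub>M M)"
      by measurable
    then show ?thesis by (simp add: W_def space_pair_measure)
  qed
  interpret U: prob_space unit_interval_measure by (rule prob_space_unit_interval_measure)
  interpret UM: pair_sigma_finite unit_interval_measure "M \<Otimes>\<^sub>M M" ..
  show thesis
  \<comment> \<open>\<open>p / 16\<close> is the Jensen exponent \<open>p / 2\<close> divided by the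
    8 of the interval estimate.\<close>
  proof (rule that[of C "p / 16"])
    show "0 < C" "0 < p / 16" using A p by (auto simp: C_def)
    fix n :: nat and x :: "nat \<Rightarrow> real" and D \<gamma> \<alpha> t :: real and i :: nat
    assume x: "vnorm n x = 1" and nw: "\<And>\<theta>. \<theta> < D \<Longrightarrow> \<not> LCD_witness n \<gamma> \<alpha> x \<theta>"
      and pos: "0 < \<gamma>" "0 < \<alpha>" "0 < D" and tD: "1 / D \<le> t"
    have t: "0 < t" using pos(3) by (intro less_le_trans[OF _ tD]) simp
    define h where "h u z = dist_lattice n (\<lambda>j. u / t * (fst z - snd z) / (2 * pi) * x j)" for u and z :: "real \<times> real"
    define E where "E = exp (p / 8) * (A * (t / \<gamma>) + exp (- (p / 16) * \<alpha>\<^sup>2))"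
    have E: "0 \<le> E" using A t pos by (simp add: E_def)
    have inner: "(\<integral>\<^sup>+u. ennreal (exp (- (p / 2) * (h u z)\<^sup>2)) \<partial>unit_interval_measure) \<le> ennreal E"
      if z: "z \<in> W" for z
    proof -
      \<comment> \<open>The multiple reached at \<open>u = 1\<close>; the sign of
        \<open>fst z - snd z\<close> does not affect the lattice distance.\<close>
      define L where "L = \<bar>fst z - snd z\<bar> / (2 * pi * t)"
      have az: "a \<le> \<bar>fst z - snd z\<bar>" "\<bar>fst z - snd z\<bar> \<le> b" using z by (auto simp: W_def)
      have L: "0 < L" using az ab t by (simp add: L_def)
      have "L \<le> b / (2 * pi * t)" unfolding L_def using az t by (intro divide_right_mono) auto
      also have "\<dots> < b / t"
        using ab t pi_gt3 by (intro divide_strict_left_mono) auto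
      also have "\<dots> \<le> real N * D"
      proof -
        have "1 / t \<le> D" using tD t pos by (simp add: field_simps)
        then have "b * (1 / t) \<le> real N * D" using N ab t by (intro mult_mono) auto
        then show ?thesis by simp
      qed
      finally have LN: "L < real N * D" .
      have hL: "h u z = dist_lattice n (\<lambda>j. u * L * x j)" for u
        using dist_lattice_abs_scale[of n "u * L" x]
          dist_lattice_abs_scale[of n "u / t * (fst z - snd z) / (2 * pi)" x] t
        by (simp add: h_def L_def abs_mult abs_divide ac_simps)
      have "(\<integral>\<^sup>+u. ennreal (exp (- (p / 2) * (h u z)\<^sup>2)) \<partial>unit_interval_measure)
          = (\<integral>\<^sup>+u. ennreal (exp (- (p / 2) * (dist_lattice n (\<lambda>j. u * L * x j))\<^sup>2)) * indicator {0..1} u \<partial>lborel)"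
      proof -
        have [measurable]: "(\<lambda>u. dist_lattice n (\<lambda>j. u * L * x j)) \<in> borel_measurable borel"
          by (intro borel_measurable_dist_lattice) measurable
        show ?thesis unfolding hL by (intro nn_integral_unit_interval_measure) measurable
      qed
      also have "\<dots> \<le> ennreal (exp ((p / 2) / 4) * (real N * sqrt (8 * pi / (p / 2)) / (\<gamma> * L) + exp (- (p / 2) * \<alpha>\<^sup>2 / 8)))"
        using p by (intro lattice_gaussian_integral_unit[OF x nw pos(1,2) _ L N(1) LN]) auto
      also have "\<dots> \<le> ennreal E"
      proof (intro ennreal_leI)
        have "1 / L \<le> 2 * pi * t / a"
          using az ab t by (simp add: L_def frac_le)
        then have "real N * sqrt (8 * pi / (p / 2)) / \<gamma> * (1 / L) \<le> real N * sqrt (8 * pi / (p / 2)) / \<gamma> * (2 * pi * t / a)"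
          using pos p by (intro mult_left_mono) auto
        then have "real N * sqrt (8 * pi / (p / 2)) / (\<gamma> * L) \<le> A * (t / \<gamma>)"
          by (simp add: A_def ac_simps)
        then show "exp ((p / 2) / 4) * (real N * sqrt (8 * pi / (p / 2)) / (\<gamma> * L) + exp (- (p / 2) * \<alpha>\<^sup>2 / 8)) \<le> E"
          by (simp add: E_def)
      qed
      finally show ?thesis .
    qed
    \<comment> \<open>\<open>L\<close> depends on \<open>z\<close>, so the integral over
      \<open>u\<close> has to become the inner one; joint measurability allows the exchange.\<close>
    have fm [measurable]: "(\<lambda>(u, z). ennreal (exp (- (p / 2) * (h u z)\<^sup>2)) * indicator W z)
        \<in> borel_measurable (unit_interval_measure \<Otimes>\<^sub>M (M \<Otimes>\<^sub>M M))"
    proof -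
      have [measurable]: "(\<lambda>q. h (fst q) (snd q)) \<in> borel_measurable (unit_interval_measure \<Otimes>\<^sub>M (M \<Otimes>\<^sub>M M))"
        unfolding h_def by (intro borel_measurable_dist_lattice) measurable
      show ?thesis unfolding case_prod_beta by measurable
    qed
    have "(\<integral>\<^sup>+u. ennreal (\<Prod>j<n. cmod (char M (u / t * x j))) \<partial>unit_interval_measure)
        \<le> (\<integral>\<^sup>+u. ennreal (1 / p) * (\<integral>\<^sup>+z. ennreal (exp (- (p / 2) * (h u z)\<^sup>2)) * indicator W z \<partial>(M \<Otimes>\<^sub>M M)) \<partial>unit_interval_measure)"
      unfolding h_def W_def p_def by (intro nn_integral_mono prod_char_le pp)
    also have "\<dots> = ennreal (1 / p) * (\<integral>\<^sup>+u. (\<integral>\<^sup>+z. ennreal (exp (- (p / 2) * (h u z)\<^sup>2)) * indicator W z \<partial>(M \<Otimes>\<^sub>M M)) \<partial>unit_interval_measure)"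
      using pair.P.borel_measurable_nn_integral[OF fm] by (rule nn_integral_cmult)
    also have "(\<integral>\<^sup>+u. (\<integral>\<^sup>+z. ennreal (exp (- (p / 2) * (h u z)\<^sup>2)) * indicator W z \<partial>(M \<Otimes>\<^sub>M M)) \<partial>unit_interval_measure)
        = (\<integral>\<^sup>+z. (\<integral>\<^sup>+u. ennreal (exp (- (p / 2) * (h u z)\<^sup>2)) * indicator W z \<partial>unit_interval_measure) \<partial>(M \<Otimes>\<^sub>M M))"
      using UM.Fubini'[OF fm] by (rule sym)
    also have "\<dots> \<le> (\<integral>\<^sup>+z. ennreal E * indicator W z \<partial>(M \<Otimes>\<^sub>M M))"
      using inner by (intro nn_integral_mono) (auto simp: indicator_def)
    also have "\<dots> = ennreal E * ennreal p"
      unfolding nn_integral_cmult_indicator[OF W_meas] by (simp add: p_def pair.P.emeasure_eq_measure)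
    also have "ennreal (1 / p) * (ennreal E * ennreal p) = ennreal E"
      using p E by (simp flip: ennreal_mult)
    finally have 1: "(\<integral>\<^sup>+u. ennreal (\<Prod>j<n. cmod (char M (u / t * x j))) \<partial>unit_interval_measure) \<le> ennreal E"
      by (simp add: mult_left_mono)
    have "(\<integral>\<^sup>+\<omega>. ennreal (exp (- (\<Sum>j<n. x j * \<omega> (i, j))\<^sup>2 / t\<^sup>2)) \<partial>PiM ({i} \<times> {..<n}) (\<lambda>_. M)) \<le> 6 * ennreal E"
      using laplace_square_le_char[OF t, where n = n and x = x and i = i] 1 by (meson mult_left_mono order_trans zero_le)
    also have "\<dots> = ennreal (6 * E)" using E by (simp add: ennreal_mult)
    also have "\<dots> \<le> ennreal (C * (t / \<gamma> + exp (- (p / 16) * \<alpha>\<^sup>2)))"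
    proof (intro ennreal_leI)
      have "A * (t / \<gamma>) + exp (- (p / 16) * \<alpha>\<^sup>2) \<le> (A + 1) * (t / \<gamma>) + (A + 1) * exp (- (p / 16) * \<alpha>\<^sup>2)"
        using A t pos by (intro add_mono mult_right_mono) (auto simp: distrib_right)
      then have "(6 * exp (p / 8)) * (A * (t / \<gamma>) + exp (- (p / 16) * \<alpha>\<^sup>2))
          \<le> (6 * exp (p / 8)) * ((A + 1) * (t / \<gamma>) + (A + 1) * exp (- (p / 16) * \<alpha>\<^sup>2))"
        by (intro mult_left_mono) auto
      then show "6 * E \<le> C * (t / \<gamma> + exp (- (p / 16) * \<alpha>\<^sup>2))"
        by (simp only: E_def C_def distrib_left[of "A + 1"] mult.assoc)
    qed
    finally show "(\<integral>\<^sup>+\<omega>. ennreal (exp (- (\<Sum>j<n. x j * \<omega> (i, j))\<^sup>2 / t\<^sup>2)) \<partial>PiM ({i} \<times> {..<n}) (\<lambda>_. M))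
       \<le> ennreal (C * (t / \<gamma> + exp (- (p / 16) * \<alpha>\<^sup>2)))" .
  qed
qed

end

section \<open>Random matrices\<close>

text \<open>A lattice of mesh \<open>1 / (2 sqrt n)\<close>: rounding moves each of at most
  \<open>n\<close> coordinates by at most \<open>1 / (4 sqrt n)\<close>, hence the vector by at most
  \<open>1 / 4\<close>. Labelling the net by integer vectors lets \<open>card_int_vectors_le\<close>
  count it.\<close>

lemma round_scaled_near:
  fixes y :: "nat \<Rightarrow> real"
  assumes "d \<le> n" "0 < n" "vnorm d y \<le> 1"
  defines "p \<equiv> restrict (\<lambda>i. round (2 * sqrt (real n) * y i)) {..<d}"
  defines "y' \<equiv> \<lambda>i. of_int (p i) / (2 * sqrt (real n))"
  shows "p \<in> {..<d} \<rightarrow>\<^sub>E UNIV" "vnorm d (\<lambda>i. of_int (p i)) \<le> 5 / 2 * sqrt (real n)"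
    "vnorm d (\<lambda>i. y i - y' i) \<le> 1 / 4" "vnorm d y' \<le> 5 / 4"
proof -
  define r where "r = sqrt (real n)"
  have r: "0 < r" using assms(2) by (simp add: r_def)
  show "p \<in> {..<d} \<rightarrow>\<^sub>E UNIV" by (simp add: p_def)
  have "vnorm d (\<lambda>i. y i - y' i) \<le> vnorm d (\<lambda>i. 1 / (4 * r) * 1)"
  proof (rule vnorm_mono)
    fix i assume i: "i < d"
    have "\<bar>of_int (round (2 * r * y i)) - 2 * r * y i\<bar> / (2 * r) \<le> (1 / 2) / (2 * r)"
      using r by (intro divide_right_mono of_int_round_abs_le) auto
    moreover have "\<bar>y i - y' i\<bar> = \<bar>of_int (round (2 * r * y i)) - 2 * r * y i\<bar> / (2 * r)"
    proof -
      have "y i - y' i = - ((of_int (round (2 * r * y i)) - 2 * r * y i) / (2 * r))"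
        using i r by (simp add: y'_def p_def r_def[symmetric] field_simps)
      then show ?thesis using r by (simp add: abs_divide)
    qed
    ultimately show "\<bar>y i - y' i\<bar> \<le> \<bar>1 / (4 * r) * 1\<bar>" using r by simp
  qed
  also have "\<dots> = 1 / (4 * r) * sqrt (real d)" using r unfolding vnorm_scale by (simp add: vnorm_def)
  also have "\<dots> \<le> 1 / (4 * r) * r" using r assms(1) by (intro mult_left_mono) (auto simp: r_def)
  finally show near: "vnorm d (\<lambda>i. y i - y' i) \<le> 1 / 4" using r by simp
  show y': "vnorm d y' \<le> 5 / 4"
    using vnorm_triangle_diff[of d y "\<lambda>i. y i - y' i"] near assms(3) by simp
  have "vnorm d (\<lambda>i. of_int (p i)) = vnorm d (\<lambda>i. (2 * r) * y' i)"
    using r by (simp add: y'_def r_def)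
  also have "\<dots> = 2 * r * vnorm d y'" unfolding vnorm_scale using r by simp
  also have "\<dots> \<le> 2 * r * (5 / 4)" using r y' by (intro mult_left_mono) auto
  finally show "vnorm d (\<lambda>i. of_int (p i)) \<le> 5 / 2 * sqrt (real n)" by (simp add: r_def)
qed

text \<open>Absorption: let \<open>S\<close> be the supremum of the bilinear form over the unit
  balls. Moving the two arguments to net points costs \<open>S / 4\<close> and
  \<open>(5 / 4) (S / 4)\<close>, so \<open>S <= R + 9 S / 16\<close>. The factor \<open>4 n\<close>
  undoes the scaling of the two net vectors.\<close>

lemma operator_norm_le_net:
  fixes B :: "nat \<Rightarrow> nat \<Rightarrow> real"
  assumes mn: "m \<le> n" "0 < n"
    and net: "\<And>p q. \<lbrakk>p \<in> {..<m} \<rightarrow>\<^sub>E UNIV; vnorm m (\<lambda>i. of_int (p i)) \<le> 5 / 2 * sqrt (real n);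
        q \<in> {..<n} \<rightarrow>\<^sub>E UNIV; vnorm n (\<lambda>j. of_int (q j)) \<le> 5 / 2 * sqrt (real n)\<rbrakk> \<Longrightarrow>
        (\<Sum>i<m. \<Sum>j<n. of_int (p i) * of_int (q j) * B i j) \<le> 4 * real n * R"
    and R: "0 \<le> R"
  shows "vnorm m (\<lambda>i. \<Sum>j<n. x j * B i j) \<le> 3 * R * vnorm n x"
proof -
  define F where "F y x = (\<Sum>i<m. \<Sum>j<n. y i * x j * B i j)" for y x
  have F_scale: "F (\<lambda>i. a * y i) (\<lambda>j. b * x j) = a * b * F y x" for a b y x
    by (simp add: F_def sum_distrib_left ac_simps)
  have F_split: "F y x = F y' x' + (F (\<lambda>i. y i - y' i) x + F y' (\<lambda>j. x j - x' j))" for y x y' x'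
    by (simp add: F_def algebra_simps sum.distrib sum_subtractf)
  define T where "T = {F y x | y x. vnorm m y \<le> 1 \<and> vnorm n x \<le> 1}"
  \<comment> \<open>Finiteness of the supremum, without which the inequality for \<open>S\<close>
    could not be solved.\<close>
  have bdd: "bdd_above T"
  proof (rule bdd_aboveI)
    fix v assume "v \<in> T"
    then obtain y x where v: "v = F y x" and yx: "vnorm m y \<le> 1" "vnorm n x \<le> 1" by (auto simp: T_def)
    have "y i * x j * B i j \<le> \<bar>B i j\<bar>" if "i < m" "j < n" for i j
    proof -
      have "\<bar>y i\<bar> \<le> 1" "\<bar>x j\<bar> \<le> 1"
        using abs_component_le_vnorm[OF that(1), of y] abs_component_le_vnorm[OF that(2), of x] yx by linarith+
      then have "\<bar>y i\<bar> * \<bar>x j\<bar> * \<bar>B i j\<bar> \<le> 1 * 1 * \<bar>B i j\<bar>" by (intro mult_mono) auto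
      then show ?thesis using abs_ge_self[of "y i * x j * B i j"] by (simp add: abs_mult)
    qed
    then show "v \<le> (\<Sum>i<m. \<Sum>j<n. \<bar>B i j\<bar>)" unfolding v F_def by (intro sum_mono) auto
  qed
  define S where "S = Sup T"
  have "F (\<lambda>_. 0) (\<lambda>_. 0) \<in> T" unfolding T_def by (force simp: vnorm_def)
  then have S0: "0 \<le> S" unfolding S_def using cSup_upper[OF _ bdd] by (auto simp: F_def)
  have F_le: "F y x \<le> S * vnorm m y * vnorm n x" for y x
  proof (cases "vnorm m y = 0 \<or> vnorm n x = 0")
    case True
    then have "F y x = 0" unfolding F_def by (auto dest: vnorm_eq_0D intro!: sum.neutral)
    then show ?thesis using S0 by simp
  next
    case False
    then have pos: "0 < vnorm m y" "0 < vnorm n x"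
      using vnorm_nonneg[of m y] vnorm_nonneg[of n x] by linarith+
    have "F (\<lambda>i. (1 / vnorm m y) * y i) (\<lambda>j. (1 / vnorm n x) * x j) \<in> T"
    proof -
      have "vnorm m (\<lambda>i. (1 / vnorm m y) * y i) = 1" "vnorm n (\<lambda>j. (1 / vnorm n x) * x j) = 1"
        using pos unfolding vnorm_scale by auto
      then show ?thesis unfolding T_def by (intro CollectI exI conjI) (rule refl, simp_all)
    qed
    then have "F (\<lambda>i. (1 / vnorm m y) * y i) (\<lambda>j. (1 / vnorm n x) * x j) \<le> S"
      unfolding S_def using bdd by (rule cSup_upper)
    then show ?thesis unfolding F_scale using pos by (simp add: field_simps)
  qed
  have "S \<le> R + S * (9 / 16)"
    unfolding S_def
  proof (rule cSup_least)
    show "T \<noteq> {}" using \<open>F (\<lambda>_. 0) (\<lambda>_. 0) \<in> T\<close> by blast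
    fix v assume "v \<in> T"
    then obtain y x where v: "v = F y x" and yx: "vnorm m y \<le> 1" "vnorm n x \<le> 1" by (auto simp: T_def)
    define p where "p = restrict (\<lambda>i. round (2 * sqrt (real n) * y i)) {..<m}"
    define q where "q = restrict (\<lambda>j. round (2 * sqrt (real n) * x j)) {..<n}"
    define y' where "y' i = of_int (p i) / (2 * sqrt (real n))" for i
    define x' where "x' j = of_int (q j) / (2 * sqrt (real n))" for j
    note P = round_scaled_near[OF mn yx(1), folded p_def, folded y'_def]
    note Q = round_scaled_near[OF order_refl mn(2) yx(2), folded q_def, folded x'_def]
    have "F y' x' = F (\<lambda>i. (1 / (2 * sqrt (real n))) * of_int (p i)) (\<lambda>j. (1 / (2 * sqrt (real n))) * of_int (q j))"
      by (simp add: y'_def[abs_def] x'_def[abs_def])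
    also have "\<dots> = 1 / (4 * real n) * F (\<lambda>i. of_int (p i)) (\<lambda>j. of_int (q j))"
      unfolding F_scale by simp
    also have "\<dots> \<le> 1 / (4 * real n) * (4 * real n * R)"
      unfolding F_def using net[OF P(1,2) Q(1,2)] by (intro mult_left_mono) auto
    also have "\<dots> = R" using mn(2) by simp
    finally have 1: "F y' x' \<le> R" .
    have "F (\<lambda>i. y i - y' i) x \<le> S * vnorm m (\<lambda>i. y i - y' i) * vnorm n x" by (rule F_le)
    also have "\<dots> \<le> S * (1 / 4) * 1" using P(3) yx(2) S0 by (intro mult_mono) auto
    finally have 2: "F (\<lambda>i. y i - y' i) x \<le> S * (1 / 4)" by simp
    have "F y' (\<lambda>j. x j - x' j) \<le> S * vnorm m y' * vnorm n (\<lambda>j. x j - x' j)" by (rule F_le)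
    also have "\<dots> \<le> S * (5 / 4) * (1 / 4)" using P(4) Q(3) S0 by (intro mult_mono) auto
    finally have 3: "F y' (\<lambda>j. x j - x' j) \<le> S * (5 / 16)" by simp
    show "v \<le> R + Sup T * (9 / 16)"
      using F_split[of y x y' x'] 1 2 3 unfolding v S_def[symmetric] by linarith
  qed
  then have SR: "S \<le> 3 * R" using R by linarith
  \<comment> \<open>Testing the form with the image itself passes from the bilinear bound to the
    norm of the image.\<close>
  define z where "z i = (\<Sum>j<n. x j * B i j)" for i
  have "(vnorm m z)\<^sup>2 = F z x"
    unfolding vnorm_power2 F_def by (simp add: z_def power2_eq_square sum_distrib_left ac_simps)
  also have "\<dots> \<le> S * vnorm m z * vnorm n x" by (rule F_le)
  finally have "vnorm m z * vnorm m z \<le> vnorm m z * (S * vnorm n x)"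
    by (simp add: power2_eq_square ac_simps)
  then have "vnorm m z \<le> S * vnorm n x"
    using S0 vnorm_nonneg[of m z] vnorm_nonneg[of n x]
    by (cases "vnorm m z = 0") (auto simp: mult_le_cancel_left)
  also have "\<dots> \<le> 3 * R * vnorm n x" using SR by (intro mult_right_mono) auto
  finally show ?thesis by (simp add: z_def[abs_def])
qed

definition bounded_operator :: "nat \<Rightarrow> nat \<Rightarrow> real \<Rightarrow> (nat \<times> nat \<Rightarrow> real) \<Rightarrow> bool" where
  "bounded_operator m n R \<omega> \<longleftrightarrow> (\<forall>x. vnorm m (\<lambda>i. \<Sum>j<n. x j * \<omega> (i, j)) \<le> R * vnorm n x)"

lemma emeasure_exponential_Markov:
  assumes [measurable]: "f \<in> borel_measurable N"
  shows "emeasure N {x \<in> space N. c \<le> f x} \<le> ennreal (exp (- c)) * (\<integral>\<^sup>+x. ennreal (exp (f x)) \<partial>N)"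
proof -
  have "emeasure N {x \<in> space N. c \<le> f x} = (\<integral>\<^sup>+x. indicator {x \<in> space N. c \<le> f x} x \<partial>N)" by simp
  also have "\<dots> \<le> (\<integral>\<^sup>+x. ennreal (exp (- c)) * ennreal (exp (f x)) \<partial>N)"
    by (intro nn_integral_mono) (auto simp: indicator_def simp flip: ennreal_mult exp_add)
  also have "\<dots> = ennreal (exp (- c)) * (\<integral>\<^sup>+x. ennreal (exp (f x)) \<partial>N)"
    by (intro nn_integral_cmult) measurable
  finally show ?thesis .
qed

context real_distribution
begin

abbreviation matrix_law :: "nat \<Rightarrow> nat \<Rightarrow> (nat \<times> nat \<Rightarrow> real) measure" where
  "matrix_law m n \<equiv> PiM ({..<m} \<times> {..<n}) (\<lambda>_. M)"

lemma prob_space_matrix_law: "prob_space (matrix_law m n)"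
  by (intro prob_space_PiM prob_space_axioms)

lemma row_form_measurable:
  assumes "i < m"
  shows "(\<lambda>\<omega>. \<Sum>j<n. x j * \<omega> (i, j)) \<in> borel_measurable (matrix_law m n)"
proof (rule borel_measurable_sum)
  fix j assume "j \<in> {..<n}"
  then have "(i, j) \<in> {..<m} \<times> {..<n}" using assms by simp
  then show "(\<lambda>\<omega>. x j * \<omega> (i, j)) \<in> borel_measurable (matrix_law m n)" by measurable
qed

lemma bilinear_form_tail:
  assumes mgf: "\<And>s. (\<integral>\<^sup>+x. ennreal (exp (s * x)) \<partial>M) \<le> ennreal (exp (C * s\<^sup>2))" and C: "0 \<le> C"
    and n: "0 < n" and y: "vnorm m y \<le> 5 / 2 * sqrt (real n)" and x: "vnorm n x \<le> 5 / 2 * sqrt (real n)"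
  shows "{\<omega> \<in> space (matrix_law m n). 4 * real n * (k * sqrt (real n)) \<le> (\<Sum>i<m. \<Sum>j<n. y i * x j * \<omega> (i, j))} \<in> sets (matrix_law m n)"
    (is "?E \<in> _")
    and "measure (matrix_law m n) {\<omega> \<in> space (matrix_law m n). 4 * real n * (k * sqrt (real n)) \<le> (\<Sum>i<m. \<Sum>j<n. y i * x j * \<omega> (i, j))}
      \<le> exp (real n * (3 * C - k))"
proof -
  interpret P: prob_space "matrix_law m n" by (rule prob_space_matrix_law)
  let ?K = "{..<m} \<times> {..<n}"
  \<comment> \<open>This normalisation turns the threshold into \<open>n k\<close>, while the
    squared coefficients sum to at most \<open>(25 / 16)^2 n <= 3 n\<close>; both exponents are then
    linear in \<open>n\<close>.\<close>
  define l where "l = 1 / (4 * sqrt (real n))"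
  have l: "0 < l" using n by (simp add: l_def)
  define a where "a k = l * (y (fst k) * x (snd k))" for k
  have E: "?E = {\<omega> \<in> space (matrix_law m n). real n * k \<le> (\<Sum>k\<in>?K. a k * \<omega> k)}"
  proof -
    have "(\<Sum>k\<in>?K. a k * \<omega> k) = l * (\<Sum>i<m. \<Sum>j<n. y i * x j * \<omega> (i, j))" for \<omega> :: "nat \<times> nat \<Rightarrow> real"
      by (simp add: a_def sum.cartesian_product' sum_distrib_left mult.assoc)
    moreover have "4 * real n * (k * sqrt (real n)) \<le> v \<longleftrightarrow> real n * k \<le> l * v" for v
    proof -
      have "real n * k = l * (4 * real n * (k * sqrt (real n)))" using n by (simp add: l_def)
      then show ?thesis using l by (simp only: mult_le_cancel_left_pos)
    qed
    ultimately show ?thesis by (simp only:)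
  qed
  have [measurable]: "(\<lambda>\<omega>. \<Sum>k\<in>?K. a k * \<omega> k) \<in> borel_measurable (matrix_law m n)"
    by (rule linear_form_measurable)
  show "?E \<in> sets (matrix_law m n)" unfolding E by measurable
  have "(\<Sum>k\<in>?K. (a k)\<^sup>2) = (l * (vnorm m y * vnorm n x))\<^sup>2"
    by (simp add: a_def power_mult_distrib vnorm_power2 sum_product sum.cartesian_product' sum_distrib_left ac_simps)
  also have "\<dots> \<le> (l * ((5 / 2 * sqrt (real n)) * (5 / 2 * sqrt (real n))))\<^sup>2"
    using l x y by (intro power_mono mult_left_mono mult_mono) auto
  also have "\<dots> = (25 / 16)\<^sup>2 * real n"
    using n by (simp add: l_def power2_eq_square field_simps)
  also have "\<dots> \<le> 3 * real n" by (simp add: power2_eq_square)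
  finally have "C * (\<Sum>k\<in>?K. (a k)\<^sup>2) \<le> C * (3 * real n)" using C by (intro mult_left_mono)
  then have mg: "(\<integral>\<^sup>+\<omega>. ennreal (exp (\<Sum>k\<in>?K. a k * \<omega> k)) \<partial>matrix_law m n) \<le> ennreal (exp (C * (3 * real n)))"
    by (intro order_trans[OF linear_form_mgf[OF mgf]]) (auto simp: ennreal_leI)
  have "emeasure (matrix_law m n) ?E \<le> ennreal (exp (- (real n * k))) * ennreal (exp (C * (3 * real n)))"
    unfolding E by (intro order_trans[OF emeasure_exponential_Markov] mult_left_mono mg) auto
  also have "\<dots> = ennreal (exp (real n * (3 * C - k)))"
    by (simp add: algebra_simps flip: ennreal_mult exp_add)
  finally show "measure (matrix_law m n) ?E \<le> exp (real n * (3 * C - k))"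
    by (simp add: P.emeasure_eq_measure)
qed

lemma operator_norm_event:
  assumes mgf: "\<And>s. (\<integral>\<^sup>+x. ennreal (exp (s * x)) \<partial>M) \<le> ennreal (exp (C * s\<^sup>2))" and C: "0 \<le> C"
    and mn: "m \<le> n" "0 < n"
  obtains E where "E \<in> sets (matrix_law m n)" "measure (matrix_law m n) E \<le> exp (- real n)"
    "\<And>\<omega>. \<omega> \<in> space (matrix_law m n) - E \<Longrightarrow> bounded_operator m n (3 * (9 + 3 * C) * sqrt (real n)) \<omega>"
proof -
  interpret P: prob_space "matrix_law m n" by (rule prob_space_matrix_law)
  define I where "I d = {p \<in> {..<d} \<rightarrow>\<^sub>E (UNIV :: int set). vnorm d (\<lambda>i. of_int (p i)) \<le> 5 / 2 * sqrt (real n)}" for d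
  have I: "finite (I d)" "real (card (I d)) \<le> exp (5 / 2 * real n) * 3 ^ n" if "d \<le> n" for d
  proof -
    have s: "(\<Sum>i<d. \<bar>real_of_int (p i)\<bar>) \<le> 5 / 2 * real n" if "p \<in> I d" for p
    proof -
      have "(\<Sum>i<d. \<bar>real_of_int (p i)\<bar>) \<le> sqrt (real d) * vnorm d (\<lambda>i. of_int (p i))"
        by (rule sum_abs_le_vnorm)
      also have "\<dots> \<le> sqrt (real n) * (5 / 2 * sqrt (real n))"
        using that \<open>d \<le> n\<close> by (intro mult_mono) (auto simp: I_def)
      also have "\<dots> = 5 / 2 * (sqrt (real n) * sqrt (real n))" by (simp only: mult.left_commute)
      finally show ?thesis by simp
    qed
    have "I d \<subseteq> {..<d} \<rightarrow>\<^sub>E UNIV" by (auto simp: I_def)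
    note card_int_vectors_le[OF this s, where s = 1, simplified]
    moreover have "(3::real) ^ d \<le> 3 ^ n" using that by (intro power_increasing) auto
    ultimately show "finite (I d)" "real (card (I d)) \<le> exp (5 / 2 * real n) * 3 ^ n"
      by (auto elim!: order_trans intro!: mult_left_mono)
  qed
  \<comment> \<open>The net has at most \<open>exp (8 n)\<close> pairs, by
    \<open>3 <= exp (3 / 2)\<close>. This \<open>k\<close> bounds each bad event by
    \<open>exp (- 9 n)\<close>, which leaves \<open>exp (- n)\<close>.\<close>
  define k where "k = 9 + 3 * C"
  define Ev where "Ev z = {\<omega> \<in> space (matrix_law m n). 4 * real n * (k * sqrt (real n)) \<le>
      (\<Sum>i<m. \<Sum>j<n. of_int (fst z i) * of_int (snd z j) * \<omega> (i, j))}" for z :: "(nat \<Rightarrow> int) \<times> (nat \<Rightarrow> int)"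
  have Ev: "Ev z \<in> sets (matrix_law m n)" "measure (matrix_law m n) (Ev z) \<le> exp (- (9 * real n))"
    if "z \<in> I m \<times> I n" for z
  proof -
    have z: "vnorm m (\<lambda>i. of_int (fst z i)) \<le> 5 / 2 * sqrt (real n)" "vnorm n (\<lambda>i. of_int (snd z i)) \<le> 5 / 2 * sqrt (real n)"
      using that by (auto simp: I_def)
    show "Ev z \<in> sets (matrix_law m n)" "measure (matrix_law m n) (Ev z) \<le> exp (- (9 * real n))"
      using bilinear_form_tail[OF mgf C mn(2) z, of k] by (auto simp: Ev_def k_def mult.commute[of "real n" 9])
  qed
  define E where "E = (\<Union>z\<in>I m \<times> I n. Ev z)"
  have fin: "finite (I m \<times> I n)" using I mn by auto
  show thesis
  proof (rule that[of E])
    show "E \<in> sets (matrix_law m n)" unfolding E_def using fin Ev by (intro sets.finite_UN) auto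
    have "measure (matrix_law m n) E \<le> (\<Sum>z\<in>I m \<times> I n. measure (matrix_law m n) (Ev z))"
      unfolding E_def using fin Ev by (intro P.finite_measure_subadditive_finite) auto
    also have "\<dots> \<le> (\<Sum>z\<in>I m \<times> I n. exp (- (9 * real n)))" by (intro sum_mono Ev)
    also have "\<dots> = real (card (I m)) * real (card (I n)) * exp (- (9 * real n))" by (simp add: card_cartesian_product)
    also have "\<dots> \<le> (exp (5 / 2 * real n) * 3 ^ n) * (exp (5 / 2 * real n) * 3 ^ n) * exp (- (9 * real n))"
      using I mn by (intro mult_right_mono mult_mono) auto
    also have "\<dots> \<le> (exp (5 / 2 * real n) * exp (3 / 2 * real n)) * (exp (5 / 2 * real n) * exp (3 / 2 * real n)) * exp (- (9 * real n))"
    proof -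
      have "(3::real) \<le> exp (3 / 2)"
      proof -
        have "(3::real) \<le> (1 + 3 / 4)\<^sup>2" by (simp add: power2_eq_square)
        also have "\<dots> \<le> (exp (3 / 4))\<^sup>2" by (intro power_mono exp_ge_add_one_self) auto
        also have "\<dots> = exp (3 / 2 :: real)" by (simp add: power2_eq_square flip: exp_add)
        finally show ?thesis .
      qed
      then have "(3::real) ^ n \<le> exp (3 / 2) ^ n" by (intro power_mono) auto
      also have "\<dots> = exp (3 / 2 * real n)" by (simp add: mult.commute flip: exp_of_nat_mult)
      finally show ?thesis by (intro mult_right_mono mult_mono mult_left_mono) auto
    qed
    also have "\<dots> = exp (- real n)" by (simp flip: exp_add)
    finally show "measure (matrix_law m n) E \<le> exp (- real n)" .
    fix \<omega> assume \<omega>: "\<omega> \<in> space (matrix_law m n) - E"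
    have "vnorm m (\<lambda>i. \<Sum>j<n. x j * \<omega> (i, j)) \<le> 3 * (k * sqrt (real n)) * vnorm n x" for x
    proof (rule operator_norm_le_net[OF mn])
      fix p q :: "nat \<Rightarrow> int"
      assume "p \<in> {..<m} \<rightarrow>\<^sub>E UNIV" "vnorm m (\<lambda>i. of_int (p i)) \<le> 5 / 2 * sqrt (real n)"
        "q \<in> {..<n} \<rightarrow>\<^sub>E UNIV" "vnorm n (\<lambda>j. of_int (q j)) \<le> 5 / 2 * sqrt (real n)"
      then have "(p, q) \<in> I m \<times> I n" by (simp add: I_def)
      then have "\<omega> \<notin> Ev (p, q)" using \<omega> by (auto simp: E_def)
      then show "(\<Sum>i<m. \<Sum>j<n. of_int (p i) * of_int (q j) * \<omega> (i, j)) \<le> 4 * real n * (k * sqrt (real n))"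
        using \<omega> by (simp add: Ev_def)
    qed (use C in \<open>simp add: k_def\<close>)
    then show "bounded_operator m n (3 * (9 + 3 * C) * sqrt (real n)) \<omega>"
      by (simp add: bounded_operator_def k_def mult.assoc del: distrib_left_numeral)
  qed
qed

section \<open>Vectors with a small image under the random matrix\<close>

text \<open>The exponential Markov inequality for \<open>- l |B x|^2\<close>, whose exponential is a
  product over the independent rows.\<close>

lemma rows_small_image:
  assumes row: "\<And>i. i < m \<Longrightarrow>
      (\<integral>\<^sup>+\<omega>. ennreal (exp (- l * (\<Sum>j<n. x j * \<omega> (i, j))\<^sup>2)) \<partial>PiM ({i} \<times> {..<n}) (\<lambda>_. M)) \<le> ennreal q"
    and q: "0 \<le> q" and l: "0 < l"
  shows "{\<omega> \<in> space (matrix_law m n). vnorm m (\<lambda>i. \<Sum>j<n. x j * \<omega> (i, j)) \<le> r} \<in> sets (matrix_law m n)" (is "?E \<in> _")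
    and "measure (matrix_law m n) {\<omega> \<in> space (matrix_law m n). vnorm m (\<lambda>i. \<Sum>j<n. x j * \<omega> (i, j)) \<le> r} \<le> exp (l * r\<^sup>2) * q ^ m"
proof -
  interpret P: prob_space "matrix_law m n" by (rule prob_space_matrix_law)
  note row_form_measurable[measurable]
  show E: "?E \<in> sets (matrix_law m n)" unfolding vnorm_def by measurable
  define G where "G \<omega> = - l * (vnorm m (\<lambda>i. \<Sum>j<n. x j * \<omega> (i, j)))\<^sup>2" for \<omega>
  have [measurable]: "G \<in> borel_measurable (matrix_law m n)" unfolding G_def vnorm_def by measurable
  define F where "F i \<omega> = ennreal (exp (- l * (\<Sum>j<n. x j * \<omega> (i, j))\<^sup>2))" for i :: nat and \<omega>
  have U: "(\<Union>i<m. {i} \<times> {..<n}) = {..<m} \<times> {..<n}" by auto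
  have "(\<integral>\<^sup>+\<omega>. ennreal (exp (G \<omega>)) \<partial>matrix_law m n) = (\<integral>\<^sup>+\<omega>. (\<Prod>i<m. F i \<omega>) \<partial>PiM (\<Union>i<m. {i} \<times> {..<n}) (\<lambda>_. M))"
    unfolding U
    by (intro nn_integral_cong) (simp add: G_def F_def vnorm_power2 sum_distrib_left exp_sum prod_ennreal)
  also have "\<dots> = (\<Prod>i<m. \<integral>\<^sup>+\<omega>. F i \<omega> \<partial>PiM ({i} \<times> {..<n}) (\<lambda>_. M))"
  proof (rule nn_integral_prod_disjoint_blocks)
    show "disjoint_family_on (\<lambda>i. {i} \<times> {..<n}) {..<m}" by (auto simp: disjoint_family_on_def)
    show "F i \<in> borel_measurable (PiM ({i} \<times> {..<n}) (\<lambda>_. M))" for i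
    proof -
      have [measurable]: "(\<lambda>\<omega>. \<Sum>j<n. x j * \<omega> (i, j)) \<in> borel_measurable (PiM ({i} \<times> {..<n}) (\<lambda>_. M))"
        using linear_form_measurable[where K = "{i} \<times> {..<n}" and a = "\<lambda>k. x (snd k)"]
        by (simp add: sum_singleton_times)
      show ?thesis unfolding F_def by measurable
    qed
  qed (auto simp: F_def)
  also have "\<dots> \<le> (\<Prod>i<m. ennreal q)"
    unfolding F_def by (intro prod_mono_ennreal row) auto
  also have "\<dots> = ennreal (q ^ m)" using q by (simp add: ennreal_power)
  finally have main: "(\<integral>\<^sup>+\<omega>. ennreal (exp (G \<omega>)) \<partial>matrix_law m n) \<le> ennreal (q ^ m)" .
  have sub: "?E \<subseteq> {\<omega> \<in> space (matrix_law m n). - l * r\<^sup>2 \<le> G \<omega>}"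
  proof safe
    fix \<omega> assume "vnorm m (\<lambda>i. \<Sum>j<n. x j * \<omega> (i, j)) \<le> r"
    then have "(vnorm m (\<lambda>i. \<Sum>j<n. x j * \<omega> (i, j)))\<^sup>2 \<le> r\<^sup>2" by (intro power_mono) auto
    then show "- l * r\<^sup>2 \<le> G \<omega>" using l by (simp add: G_def)
  qed
  have "emeasure (matrix_law m n) ?E \<le> emeasure (matrix_law m n) {\<omega> \<in> space (matrix_law m n). - l * r\<^sup>2 \<le> G \<omega>}"
    using sub by (rule emeasure_mono) measurable
  also have "\<dots> \<le> ennreal (exp (- (- l * r\<^sup>2))) * ennreal (q ^ m)"
    by (intro order_trans[OF emeasure_exponential_Markov] mult_left_mono main) auto
  also have "\<dots> = ennreal (exp (l * r\<^sup>2) * q ^ m)" using q by (simp add: ennreal_mult)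
  finally show "measure (matrix_law m n) ?E \<le> exp (l * r\<^sup>2) * q ^ m"
    using q by (simp add: P.emeasure_eq_measure)
qed

text \<open>The label \<open>p\<close> and the net point \<open>x p\<close> are kept apart: labels
  are counted as integer vectors, while in the level-set argument \<open>x p\<close> need not be the
  normalised label.\<close>

lemma rows_small_image_net:
  assumes T: "finite T" "real (card T) \<le> c"
    and row: "\<And>p i. p \<in> T \<Longrightarrow> i < m \<Longrightarrow>
      (\<integral>\<^sup>+\<omega>. ennreal (exp (- l * (\<Sum>j<n. x p j * \<omega> (i, j))\<^sup>2)) \<partial>PiM ({i} \<times> {..<n}) (\<lambda>_. M)) \<le> ennreal q"
    and q: "0 \<le> q" and l: "0 < l"
  obtains E where "E \<in> sets (matrix_law m n)" "measure (matrix_law m n) E \<le> c * (exp (l * r\<^sup>2) * q ^ m)"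
    "\<And>\<omega> p. \<omega> \<in> space (matrix_law m n) - E \<Longrightarrow> p \<in> T \<Longrightarrow> r < vnorm m (\<lambda>i. \<Sum>j<n. x p j * \<omega> (i, j))"
proof -
  interpret P: prob_space "matrix_law m n" by (rule prob_space_matrix_law)
  define Ev where "Ev p = {\<omega> \<in> space (matrix_law m n). vnorm m (\<lambda>i. \<Sum>j<n. x p j * \<omega> (i, j)) \<le> r}" for p
  have Ev: "Ev p \<in> sets (matrix_law m n)" "measure (matrix_law m n) (Ev p) \<le> exp (l * r\<^sup>2) * q ^ m" if "p \<in> T" for p
    unfolding Ev_def using rows_small_image[OF row[OF that] q l, where r = r] by auto
  show thesis
  proof (rule that[of "\<Union>p\<in>T. Ev p"])
    show "(\<Union>p\<in>T. Ev p) \<in> sets (matrix_law m n)" using T(1) Ev by (intro sets.finite_UN) auto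
    have "measure (matrix_law m n) (\<Union>p\<in>T. Ev p) \<le> (\<Sum>p\<in>T. measure (matrix_law m n) (Ev p))"
      using T(1) Ev by (intro P.finite_measure_subadditive_finite) auto
    also have "\<dots> \<le> (\<Sum>p\<in>T. exp (l * r\<^sup>2) * q ^ m)" by (intro sum_mono Ev)
    also have "\<dots> = real (card T) * (exp (l * r\<^sup>2) * q ^ m)" by simp
    also have "\<dots> \<le> c * (exp (l * r\<^sup>2) * q ^ m)" using T(2) q by (intro mult_right_mono) auto
    finally show "measure (matrix_law m n) (\<Union>p\<in>T. Ev p) \<le> c * (exp (l * r\<^sup>2) * q ^ m)" .
  qed (auto simp: Ev_def not_le)
qed

end

section \<open>Denominators of kernel vectors\<close>

text \<open>\<open>\<gamma> <= 1\<close> makes the rounding error smaller than \<theta>, so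
  \<open>p\<close> is nonzero and its norm at most \<open>2 \<theta>\<close>. Both error bounds are
  recorded: \<open>\<gamma> \<theta>\<close> serves the small denominators and \<alpha> the large
  ones.\<close>

lemma LCD_witness_int_vector:
  assumes Z: "vnorm n Z = 1" and w: "LCD_witness n \<gamma> \<alpha> Z \<theta>" and g: "\<gamma> \<le> 1"
  obtains p :: "nat \<Rightarrow> int" where "p \<in> {..<n} \<rightarrow>\<^sub>E UNIV" "vnorm n (\<lambda>j. \<theta> * Z j - of_int (p j)) \<le> \<gamma> * \<theta>"
    "vnorm n (\<lambda>j. \<theta> * Z j - of_int (p j)) \<le> \<alpha>" "0 < vnorm n (\<lambda>j. of_int (p j))" "vnorm n (\<lambda>j. of_int (p j)) \<le> 2 * \<theta>"
proof -
  define p where "p = restrict (\<lambda>j. round (\<theta> * Z j)) {..<n}"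
  define d where "d = vnorm n (\<lambda>j. \<theta> * Z j - of_int (p j))"
  have t: "0 < \<theta>" using w by (simp add: LCD_witness_def)
  have v: "vnorm n (\<lambda>j. \<theta> * Z j) = \<theta>" using Z t by (simp add: vnorm_scale)
  have "d = dist_lattice n (\<lambda>j. \<theta> * Z j)"
    unfolding d_def dist_lattice_eq_round by (intro vnorm_cong) (simp add: p_def)
  then have d: "d < \<gamma> * \<theta>" "d < \<alpha>" using w by (auto simp: LCD_witness_def v)
  have "\<gamma> * \<theta> \<le> 1 * \<theta>" using g t by (intro mult_right_mono) auto
  then have "d < \<theta>" using d by linarith
  moreover have "\<theta> \<le> d + vnorm n (\<lambda>j. of_int (p j))"
    using vnorm_triangle[of n "\<lambda>j. \<theta> * Z j - of_int (p j)" "\<lambda>j. of_int (p j)"] by (simp add: v d_def)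
  moreover have "vnorm n (\<lambda>j. of_int (p j)) \<le> \<theta> + d"
    using vnorm_triangle_diff[of n "\<lambda>j. \<theta> * Z j" "\<lambda>j. \<theta> * Z j - of_int (p j)"] by (simp add: v d_def)
  ultimately have "0 < vnorm n (\<lambda>j. of_int (p j))" "vnorm n (\<lambda>j. of_int (p j)) \<le> 2 * \<theta>" by linarith+
  moreover have "p \<in> {..<n} \<rightarrow>\<^sub>E UNIV" by (simp add: p_def)
  ultimately show thesis using d that[of p] by (simp add: d_def)
qed

definition unit_kernel :: "nat \<Rightarrow> nat \<Rightarrow> (nat \<times> nat \<Rightarrow> real) \<Rightarrow> (nat \<Rightarrow> real) set" where
  "unit_kernel m n \<omega> = {Z. vnorm n Z = 1 \<and> (\<forall>i<m. (\<Sum>j<n. Z j * \<omega> (i, j)) = 0)}"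

lemma kernel_vector_image:
  assumes op: "bounded_operator m n R \<omega>" and Z: "Z \<in> unit_kernel m n \<omega>"
    and near: "vnorm n (\<lambda>j. Z j - x j) \<le> e" and R: "0 \<le> R"
  shows "vnorm m (\<lambda>i. \<Sum>j<n. x j * \<omega> (i, j)) \<le> R * e"
proof -
  have "vnorm m (\<lambda>i. \<Sum>j<n. x j * \<omega> (i, j)) = vnorm m (\<lambda>i. \<Sum>j<n. (x j - Z j) * \<omega> (i, j))"
    using Z by (intro vnorm_cong) (simp add: unit_kernel_def left_diff_distrib sum_subtractf)
  also have "\<dots> \<le> R * vnorm n (\<lambda>j. x j - Z j)" 
    using op[unfolded bounded_operator_def, rule_format, of "\<lambda>j. x j - Z j"] .
  also have "\<dots> \<le> R * e" using near R vnorm_minus_commute[of n x Z] by (intro mult_left_mono) auto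
  finally show ?thesis .
qed

context real_distribution
begin

text \<open>The balance is \<open>exp (2 \<delta> n)\<close> for the count,
  \<open>exp (\<delta> n)\<close> for the image radius and \<open>exp (- 4 \<delta>)\<close> for
  each row. The missing \<open>n\<close>-th row is the source of the additive
  \<open>4 \<delta>\<close> in the final exponent.\<close>

lemma small_denominator_event:
  assumes mgf: "0 \<le> C" "\<And>s. (\<integral>\<^sup>+x. ennreal (exp (s * x)) \<partial>M) \<le> ennreal (exp (C * s\<^sup>2))"
    and mom: "integrable M (\<lambda>x. x)" "(\<integral>x. x \<partial>M) = 0"
      "integrable M (\<lambda>x. x\<^sup>2)" "(\<integral>x. x\<^sup>2 \<partial>M) = 1"
    and K: "0 < K"
  obtains \<delta> c0 \<gamma> where "0 < \<delta>" "0 < c0" "0 < \<gamma>" "\<gamma> < 1"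
    "\<And>n. 0 < n \<Longrightarrow> \<exists>E \<in> sets (matrix_law (n - 1) n). measure (matrix_law (n - 1) n) E \<le> exp (4 * \<delta> - \<delta> * real n) \<and>
      (\<forall>\<omega>\<in>space (matrix_law (n - 1) n) - E.
        bounded_operator (n - 1) n (K * sqrt (real n)) \<omega> \<longrightarrow>
        (\<forall>Z\<in>unit_kernel (n - 1) n \<omega>. \<forall>\<alpha> \<theta>.
          \<theta> \<le> c0 * sqrt (real n) \<longrightarrow> \<not> LCD_witness n \<gamma> \<alpha> Z \<theta>))"
proof -
  define Q where "Q = 512 * exp C"
  have "1 \<le> exp C" using mgf(1) by simp
  then have Q: "1 \<le> Q" unfolding Q_def by linarith
  define q where "q = 1 - 1 / (2 * Q)"
  \<comment> \<open>Chosen so that \<open>q = 1 - 4 \<delta>\<close>.\<close>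
  define \<delta> where "\<delta> = 1 / (8 * Q)"
  \<comment> \<open>The count is made with \<open>s = 2 / \<delta>\<close>, so that its base is
    \<open>1 + \<delta>\<close>; this \<open>c0\<close> then turns its exponent
    \<open>s * 4 * c0^2 * n\<close> into \<open>\<delta> n / 2\<close>.\<close>
  define c0 where "c0 = \<delta> / 4"
  \<comment> \<open>Keeps the squared image radius \<open>(2 \<gamma> K)^2 n\<close> at most
    \<open>\<delta> n\<close>.\<close>
  define \<gamma> where "\<gamma> = min (1 / 2) (sqrt \<delta> / (2 * K))"
  have d: "0 < \<delta>" using Q by (simp add: \<delta>_def)
  have c0: "0 < c0" using d by (simp add: c0_def)
  have g: "0 < \<gamma>" "\<gamma> < 1" using d K by (auto simp: \<gamma>_def min_def)
  have q0: "0 \<le> q" using Q by (simp add: q_def field_simps)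
  have q: "q \<le> exp (- (4 * \<delta>))"
    using exp_ge_add_one_self[of "- (4 * \<delta>)"] by (simp add: q_def \<delta>_def)
  have gK: "(2 * \<gamma> * K)\<^sup>2 \<le> \<delta>"
  proof -
    have "2 * \<gamma> * K \<le> 2 * (sqrt \<delta> / (2 * K)) * K"
      using K by (intro mult_right_mono mult_left_mono) (auto simp: \<gamma>_def)
    also have "\<dots> = sqrt \<delta>" using K by simp
    finally have "(2 * \<gamma> * K)\<^sup>2 \<le> (sqrt \<delta>)\<^sup>2" using g K by (intro power_mono) auto
    then show ?thesis using d by simp
  qed
  show thesis
  proof (rule that[OF d c0 g])
    fix n :: nat assume n: "0 < n"
    define T where "T = {p \<in> {..<n} \<rightarrow>\<^sub>E (UNIV :: int set). 0 < vnorm n (\<lambda>j. of_int (p j))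
        \<and> vnorm n (\<lambda>j. of_int (p j)) \<le> 2 * c0 * sqrt (real n)}"
    define x where "x p j = real_of_int (p j) / vnorm n (\<lambda>j. of_int (p j))" for p :: "nat \<Rightarrow> int" and j
    have sum_le: "(\<Sum>j<n. \<bar>real_of_int (p j)\<bar>) \<le> 4 * c0\<^sup>2 * real n" if "p \<in> T" for p
    proof -
      have "(\<Sum>j<n. \<bar>real_of_int (p j)\<bar>) \<le> (vnorm n (\<lambda>j. of_int (p j)))\<^sup>2" by (rule sum_abs_int_le_vnorm_power2)
      also have "\<dots> \<le> (2 * c0 * sqrt (real n))\<^sup>2" using that by (intro power_mono) (auto simp: T_def)
      also have "\<dots> = 4 * c0\<^sup>2 * real n" by (simp add: power_mult_distrib)
      finally show ?thesis .
    qed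
    have "T \<subseteq> {..<n} \<rightarrow>\<^sub>E UNIV" by (auto simp: T_def)
    note cd = card_int_vectors_le[OF this sum_le, where s = "2 / \<delta>"]
    have fin: "finite T" using cd(1) d by simp
    have "real (card T) \<le> exp (2 / \<delta> * (4 * c0\<^sup>2 * real n)) * (1 + \<delta>) ^ n" using cd(2) d by simp
    also have "\<dots> \<le> exp (\<delta> * real n) * exp (\<delta> * real n)"
    proof (intro mult_mono)
      have "2 / \<delta> * (4 * c0\<^sup>2 * real n) = \<delta> / 2 * real n" using d by (simp add: c0_def power2_eq_square)
      also have "\<dots> \<le> \<delta> * real n" using d by (intro mult_right_mono) auto
      finally show "exp (2 / \<delta> * (4 * c0\<^sup>2 * real n)) \<le> exp (\<delta> * real n)" by (simp only: exp_le_cancel_iff)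
      have "(1 + \<delta>) ^ n \<le> exp \<delta> ^ n" using d by (intro power_mono exp_ge_add_one_self) auto
      then show "(1 + \<delta>) ^ n \<le> exp (\<delta> * real n)" by (simp add: mult.commute flip: exp_of_nat_mult)
    qed (use d in auto)
    finally have card: "real (card T) \<le> exp (2 * \<delta> * real n)" by (simp add: mult.assoc flip: exp_add)
    have row: "(\<integral>\<^sup>+\<omega>. ennreal (exp (- (1 / Q) * (\<Sum>j<n. x p j * \<omega> (i, j))\<^sup>2)) \<partial>PiM ({i} \<times> {..<n}) (\<lambda>_. M)) \<le> ennreal q"
      if "p \<in> T" for p and i :: nat
    proof -
      have "vnorm n (x p) = 1"
      proof -
        have "vnorm n (\<lambda>j. 1 / vnorm n (\<lambda>j. of_int (p j)) * of_int (p j)) = 1"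
          using that unfolding vnorm_scale by (simp add: T_def)
        then show ?thesis by (simp add: x_def[abs_def])
      qed
      then have "(\<Sum>k\<in>{i} \<times> {..<n}. (x p (snd k))\<^sup>2) = 1"
        using vnorm_power2[of n "x p"] by (simp add: sum_singleton_times)
      from linear_form_laplace_lt_1[OF mgf mom _ this Q_def] show ?thesis
        by (simp add: sum_singleton_times q_def)
    qed
    \<comment> \<open>The operator norm times the distance \<open>2 \<gamma>\<close> from a kernel
      vector to its net point.\<close>
    define r where "r = K * sqrt (real n) * (2 * \<gamma>)"
    have l: "0 < 1 / Q" using Q by simp
    obtain E where E: "E \<in> sets (matrix_law (n - 1) n)"
        "measure (matrix_law (n - 1) n) E \<le> exp (2 * \<delta> * real n) * (exp (1 / Q * r\<^sup>2) * q ^ (n - 1))"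
      and out: "\<And>\<omega> p. \<omega> \<in> space (matrix_law (n - 1) n) - E \<Longrightarrow> p \<in> T \<Longrightarrow> r < vnorm (n - 1) (\<lambda>i. \<Sum>j<n. x p j * \<omega> (i, j))"
      by (rule rows_small_image_net[where m = "n - 1" and x = x and r = r, OF fin card _ q0 l],
          erule row, rule that)
    show "\<exists>E \<in> sets (matrix_law (n - 1) n). measure (matrix_law (n - 1) n) E \<le> exp (4 * \<delta> - \<delta> * real n) \<and>
      (\<forall>\<omega>\<in>space (matrix_law (n - 1) n) - E.
        bounded_operator (n - 1) n (K * sqrt (real n)) \<omega> \<longrightarrow>
        (\<forall>Z\<in>unit_kernel (n - 1) n \<omega>. \<forall>\<alpha> \<theta>.
          \<theta> \<le> c0 * sqrt (real n) \<longrightarrow> \<not> LCD_witness n \<gamma> \<alpha> Z \<theta>))"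
    proof (intro bexI[OF _ E(1)] conjI ballI impI allI notI)
      have "1 / Q * r\<^sup>2 \<le> 1 * r\<^sup>2" using Q by (intro mult_right_mono) auto
      also have "1 * r\<^sup>2 = (2 * \<gamma> * K)\<^sup>2 * real n" by (simp add: r_def power_mult_distrib)
      also have "\<dots> \<le> \<delta> * real n" using gK by (intro mult_right_mono) auto
      finally have 1: "exp (1 / Q * r\<^sup>2) \<le> exp (\<delta> * real n)" by simp
      have "q ^ (n - 1) \<le> exp (- (4 * \<delta>)) ^ (n - 1)" using q q0 by (intro power_mono)
      also have "\<dots> = exp (4 * \<delta> - 4 * \<delta> * real n)"
        using n by (simp add: of_nat_diff algebra_simps flip: exp_of_nat_mult)
      finally have 2: "q ^ (n - 1) \<le> exp (4 * \<delta> - 4 * \<delta> * real n)" .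
      have "exp (2 * \<delta> * real n) * (exp (1 / Q * r\<^sup>2) * q ^ (n - 1))
          \<le> exp (2 * \<delta> * real n) * (exp (\<delta> * real n) * exp (4 * \<delta> - 4 * \<delta> * real n))"
        using 1 2 q0 by (intro mult_left_mono mult_mono) auto
      also have "\<dots> = exp (4 * \<delta> - \<delta> * real n)" by (simp flip: exp_add)
      finally show "measure (matrix_law (n - 1) n) E \<le> exp (4 * \<delta> - \<delta> * real n)" using E(2) by linarith
      fix \<omega> Z \<alpha> \<theta>
      assume \<omega>: "\<omega> \<in> space (matrix_law (n - 1) n) - E"
        and op: "bounded_operator (n - 1) n (K * sqrt (real n)) \<omega>"
        and ker: "Z \<in> unit_kernel (n - 1) n \<omega>"
        and t: "\<theta> \<le> c0 * sqrt (real n)" and w: "LCD_witness n \<gamma> \<alpha> Z \<theta>"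
      have Z: "vnorm n Z = 1" using ker by (simp add: unit_kernel_def)
      obtain p :: "nat \<Rightarrow> int" where p: "p \<in> {..<n} \<rightarrow>\<^sub>E UNIV" "vnorm n (\<lambda>j. \<theta> * Z j - of_int (p j)) \<le> \<gamma> * \<theta>"
        "0 < vnorm n (\<lambda>j. of_int (p j))" "vnorm n (\<lambda>j. of_int (p j)) \<le> 2 * \<theta>"
        by (rule LCD_witness_int_vector[OF Z w less_imp_le[OF g(2)]], rule that)
      have "p \<in> T" using p t by (auto simp: T_def)
      have t0: "0 < \<theta>" using w by (simp add: LCD_witness_def)
      have "vnorm n (\<lambda>j. Z j - x p j) \<le> 2 * (\<gamma> * \<theta>) / \<theta>"
        unfolding x_def using vnorm_normalize_near[OF Z t0 p(2,3)] .
      then have near: "vnorm n (\<lambda>j. Z j - x p j) \<le> 2 * \<gamma>" using t0 by simp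
      have "vnorm (n - 1) (\<lambda>i. \<Sum>j<n. x p j * \<omega> (i, j)) \<le> r"
        unfolding r_def
        using K by (intro kernel_vector_image[OF op ker near]) simp
      then show False using out[OF \<omega> \<open>p \<in> T\<close>] by simp
    qed
  qed
qed

text \<open>Levels start at \<open>c0 sqrt n\<close>, so that \<open>w = D / sqrt n\<close> is
  bounded below and the 1 in the count \<open>(1 + 8 w)^n\<close> can be absorbed into
  \<open>(C1 w)^n\<close>. Each row pays \<open>G / w\<close>, which cancels a factor
  \<open>C1 w\<close> up to the small constant \<open>C1 G\<close>.\<close>

lemma level_set_event:
  assumes mom: "integrable M (\<lambda>x. x)" "(\<integral>x. x \<partial>M) = 0"
      "integrable M (\<lambda>x. x\<^sup>2)" "(\<integral>x. x\<^sup>2 \<partial>M) = 1"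
    and K: "0 < K" and g: "0 < \<gamma>" "\<gamma> < 1" and c0: "0 < c0"
  obtains \<beta> c C2 n1 where "0 < \<beta>" "0 < c" "c \<le> 1" "0 < C2"
    "\<And>n D. \<lbrakk>n1 \<le> n; c0 * sqrt (real n) \<le> D; D \<le> exp (c * real n)\<rbrakk> \<Longrightarrow>
      \<exists>E \<in> sets (matrix_law (n - 1) n). measure (matrix_law (n - 1) n) E \<le> C2 * exp (- 2 * real n) \<and>
      (\<forall>\<omega>\<in>space (matrix_law (n - 1) n) - E.
        bounded_operator (n - 1) n (K * sqrt (real n)) \<omega> \<longrightarrow>
        (\<forall>Z\<in>unit_kernel (n - 1) n \<omega>. \<forall>\<theta>.
          (\<forall>\<theta>'<D. \<not> LCD_witness n \<gamma> (\<beta> * sqrt (real n)) Z \<theta>') \<longrightarrow>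
          D \<le> \<theta> \<longrightarrow> \<theta> < 2 * D \<longrightarrow> \<not> LCD_witness n \<gamma> (\<beta> * sqrt (real n)) Z \<theta>))"
proof -
  obtain B \<kappa> where B: "0 < B" and \<kappa>: "0 < \<kappa>" and small_ball:
    "\<And>n x D \<gamma> \<alpha> t i. \<lbrakk>vnorm n x = 1; \<And>\<theta>. \<theta> < D \<Longrightarrow> \<not> LCD_witness n \<gamma> \<alpha> x \<theta>;
       0 < \<gamma>; 0 < \<alpha>; 0 < D; 1 / D \<le> t\<rbrakk> \<Longrightarrow>
     (\<integral>\<^sup>+\<omega>. ennreal (exp (- (\<Sum>j<n. x j * \<omega> (i::nat, j))\<^sup>2 / t\<^sup>2)) \<partial>PiM ({i} \<times> {..<n}) (\<lambda>_. M))
       \<le> ennreal (B * (t / \<gamma> + exp (- \<kappa> * \<alpha>\<^sup>2)))"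
    using small_ball_LCD[OF mom] by blast
  define C1 where "C1 = 8 + 1 / c0"
  have C1: "0 < C1" using c0 by (simp add: C1_def add_pos_pos)
  \<comment> \<open>Solves \<open>C1 * G = exp (- 5)\<close>. Of the five units in the exponent, two
    pay for \<open>exp n\<close> from the count and \<open>exp n\<close> from the image radius, one
    for the uncancelled \<open>w\<close>, and two remain.\<close>
  define \<beta> where "\<beta> = exp (- 5) * \<gamma> / (8 * B * K * C1)"
  have \<beta>: "0 < \<beta>" using g B K C1 by (simp add: \<beta>_def)
  \<comment> \<open>With \<open>c <= \<kappa> \<beta>^2\<close> the small ball error
    \<open>exp (- \<kappa> \<alpha>^2)\<close> is at most \<open>1 / D\<close> for all levels up to
    \<open>exp (c n)\<close>.\<close>
  define c where "c = min 1 (\<kappa> * \<beta>\<^sup>2)"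
  have c: "0 < c" "c \<le> 1" "c \<le> \<kappa> * \<beta>\<^sup>2" using \<kappa> \<beta> by (auto simp: c_def)
  define G where "G = 8 * B * K * \<beta> / \<gamma>"
  have G: "0 < G" "C1 * G = exp (- 5)" using B K \<beta> g C1 by (auto simp: G_def \<beta>_def)
  \<comment> \<open>For \<open>n >= n1\<close> one has \<open>4 K \<beta> sqrt n >= 1\<close>, which
    is the condition \<open>1 / D <= t\<close> of the small ball bound.\<close>
  define n1 where "n1 = nat \<lceil>(1 / (4 * K * \<beta>))\<^sup>2\<rceil> + 1"
  show thesis
  proof (rule that[of \<beta> c "C1 * exp 5" n1])
    show "0 < \<beta>" "0 < c" "c \<le> 1" "0 < C1 * exp 5" using \<beta> c C1 by auto
    fix n :: nat and D :: real
    assume n1: "n1 \<le> n" and D: "c0 * sqrt (real n) \<le> D" "D \<le> exp (c * real n)"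
    have n: "0 < n" using n1 by (simp add: n1_def)
    define rn where "rn = sqrt (real n)"
    have rn: "0 < rn" "1 \<le> rn" "rn * rn = real n" "rn\<^sup>2 = real n" using n by (auto simp: rn_def)
    have rn1: "1 \<le> 4 * K * \<beta> * rn"
    proof -
      have "(1 / (4 * K * \<beta>))\<^sup>2 \<le> real n" using n1 by (simp add: n1_def) linarith
      then have "1 / (4 * K * \<beta>) \<le> rn" unfolding rn_def by (rule real_le_rsqrt)
      then show ?thesis using K \<beta> by (simp add: field_simps)
    qed
    have D0: "0 < D" using D(1) c0 rn(1) by (intro less_le_trans[OF _ D(1)]) (simp add: rn_def)
    define w where "w = D / rn"
    have w: "0 < w" "c0 \<le> w" "w \<le> D"
      using D0 rn D(1) mult_left_mono[OF rn(2), of D] by (auto simp: w_def field_simps rn_def[symmetric])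
    define t where "t = 4 * K * \<beta> * rn / D"
    have tD: "1 / D \<le> t" unfolding t_def using rn1 D0 by (intro divide_right_mono) auto
    have t: "0 < t" using K \<beta> rn D0 by (simp add: t_def)
    define \<alpha> where "\<alpha> = \<beta> * rn"
    have \<alpha>: "0 < \<alpha>" using \<beta> rn by (simp add: \<alpha>_def)
    define ok where "ok p Z \<longleftrightarrow> vnorm n Z = 1 \<and> (\<forall>\<theta>'<D. \<not> LCD_witness n \<gamma> \<alpha> Z \<theta>') \<and>
        (\<exists>\<theta>\<ge>D. vnorm n (\<lambda>j. \<theta> * Z j - of_int (p j)) \<le> \<alpha>)" for p :: "nat \<Rightarrow> int" and Z
    define T where "T = {p \<in> {..<n} \<rightarrow>\<^sub>E (UNIV :: int set). 0 < vnorm n (\<lambda>j. of_int (p j))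
        \<and> vnorm n (\<lambda>j. of_int (p j)) \<le> 4 * D \<and> (\<exists>Z. ok p Z)}"
    \<comment> \<open>Chosen from the level set, hence without witness below \<open>D\<close>. Two
      vectors with the same label are within \<open>4 \<alpha> / D\<close>, each being within
      \<open>2 \<alpha> / D\<close> of \<open>p / |p|\<close>.\<close>
    define x where "x p = (SOME Z. ok p Z)" for p
    have x: "ok p (x p)" if "p \<in> T" for p unfolding x_def using that by (intro someI_ex[of "ok p"]) (auto simp: T_def)
    have near: "vnorm n (\<lambda>j. Z j - real_of_int (p j) / vnorm n (\<lambda>j. of_int (p j))) \<le> 2 * \<alpha> / D"
      if pT: "p \<in> T" and okp: "ok p Z" for p Z
    proof -
      obtain \<theta> where \<theta>: "D \<le> \<theta>" "vnorm n (\<lambda>j. \<theta> * Z j - of_int (p j)) \<le> \<alpha>" and Z: "vnorm n Z = 1"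
        using okp by (auto simp: ok_def)
      have "vnorm n (\<lambda>j. Z j - real_of_int (p j) / vnorm n (\<lambda>j. of_int (p j))) \<le> 2 * \<alpha> / \<theta>"
        using pT \<theta> D0 by (intro vnorm_normalize_near[OF Z]) (auto simp: T_def)
      also have "\<dots> \<le> 2 * \<alpha> / D" using \<theta> D0 \<alpha> by (intro divide_left_mono) auto
      finally show ?thesis .
    qed
    have sum_le: "(\<Sum>j<n. \<bar>real_of_int (p j)\<bar>) \<le> rn * (4 * D)" if "p \<in> T" for p
    proof -
      have "(\<Sum>j<n. \<bar>real_of_int (p j)\<bar>) \<le> rn * vnorm n (\<lambda>j. of_int (p j))"
        unfolding rn_def by (rule sum_abs_le_vnorm)
      also have "\<dots> \<le> rn * (4 * D)" using that rn by (intro mult_left_mono) (auto simp: T_def)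
      finally show ?thesis .
    qed
    have sub: "T \<subseteq> {..<n} \<rightarrow>\<^sub>E UNIV" by (auto simp: T_def)
    \<comment> \<open>The weight parameter that balances the count: \<open>s M = n\<close> and
      \<open>2 / s = 8 w\<close>.\<close>
    have s0: "0 < rn / (4 * D)" using rn D0 by simp
    note cd = card_int_vectors_le[OF sub sum_le s0]
    have fin: "finite T" using cd(1) by simp
    have "real (card T) \<le> exp (real n) * (1 + 8 * w) ^ n"
      using cd(2) D0 rn by (simp add: w_def)
    also have "\<dots> \<le> exp (real n) * (C1 * w) ^ n"
    proof (intro mult_left_mono power_mono)
      have "1 \<le> 1 / c0 * w" using w c0 by (simp add: field_simps)
      then show "1 + 8 * w \<le> C1 * w" by (simp add: C1_def distrib_right)
    qed (use w in auto)
    finally have card: "real (card T) \<le> exp (real n) * (C1 * w) ^ n" .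
    define q where "q = G / w"
    have q0: "0 \<le> q" using G w by (simp add: q_def)
    have row: "(\<integral>\<^sup>+\<omega>. ennreal (exp (- (1 / t\<^sup>2) * (\<Sum>j<n. x p j * \<omega> (i, j))\<^sup>2)) \<partial>PiM ({i} \<times> {..<n}) (\<lambda>_. M)) \<le> ennreal q"
      if "p \<in> T" for p and i :: nat
    proof -
      have "vnorm n (x p) = 1" "\<And>\<theta>. \<theta> < D \<Longrightarrow> \<not> LCD_witness n \<gamma> \<alpha> (x p) \<theta>"
        using x[OF that] by (auto simp: ok_def)
      from small_ball[OF this g(1) \<alpha> D0 tD, of i]
      have "(\<integral>\<^sup>+\<omega>. ennreal (exp (- (1 / t\<^sup>2) * (\<Sum>j<n. x p j * \<omega> (i, j))\<^sup>2)) \<partial>PiM ({i} \<times> {..<n}) (\<lambda>_. M))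
          \<le> ennreal (B * (t / \<gamma> + exp (- \<kappa> * \<alpha>\<^sup>2)))" by simp
      also have "\<dots> \<le> ennreal q"
      proof (rule ennreal_leI)
        have "c * real n \<le> \<kappa> * \<beta>\<^sup>2 * real n" using c by (intro mult_right_mono) auto
        also have "\<dots> = \<kappa> * \<alpha>\<^sup>2" by (simp add: \<alpha>_def power_mult_distrib rn)
        finally have "exp (- \<kappa> * \<alpha>\<^sup>2) \<le> exp (- (c * real n))" by simp
        also have "\<dots> = 1 / exp (c * real n)" by (simp add: exp_minus divide_inverse)
        also have "\<dots> \<le> 1 / D" using D(2) D0 by (intro divide_left_mono) auto
        also have "\<dots> \<le> t / 1" using tD by simp
        also have "\<dots> \<le> t / \<gamma>" using t g by (intro divide_left_mono) auto
        finally have "t / \<gamma> + exp (- \<kappa> * \<alpha>\<^sup>2) \<le> 2 * (t / \<gamma>)" by simp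
        then have "B * (t / \<gamma> + exp (- \<kappa> * \<alpha>\<^sup>2)) \<le> B * (2 * (t / \<gamma>))" using B by (intro mult_left_mono) auto
        also have "\<dots> = q" by (simp add: q_def G_def w_def t_def ac_simps)
        finally show "B * (t / \<gamma> + exp (- \<kappa> * \<alpha>\<^sup>2)) \<le> q" .
      qed
      finally show ?thesis .
    qed
    have l: "0 < 1 / t\<^sup>2" using t by simp
    \<comment> \<open>This equals the operator norm bound times \<open>4 \<alpha> / D\<close>; the
      scale \<open>t\<close> is defined so that \<open>r / t = rn\<close> and the Markov factor is
      \<open>exp n\<close>.\<close>
    define r where "r = t * rn"
    obtain E where E: "E \<in> sets (matrix_law (n - 1) n)"
        "measure (matrix_law (n - 1) n) E \<le> exp (real n) * (C1 * w) ^ n * (exp (1 / t\<^sup>2 * r\<^sup>2) * q ^ (n - 1))"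
      and out: "\<And>\<omega> p. \<omega> \<in> space (matrix_law (n - 1) n) - E \<Longrightarrow> p \<in> T \<Longrightarrow> r < vnorm (n - 1) (\<lambda>i. \<Sum>j<n. x p j * \<omega> (i, j))"
      by (rule rows_small_image_net[where m = "n - 1" and x = x and r = r, OF fin card _ q0 l],
          erule row, rule that)
    show "\<exists>E \<in> sets (matrix_law (n - 1) n). measure (matrix_law (n - 1) n) E \<le> C1 * exp 5 * exp (- 2 * real n) \<and>
      (\<forall>\<omega>\<in>space (matrix_law (n - 1) n) - E.
        bounded_operator (n - 1) n (K * sqrt (real n)) \<omega> \<longrightarrow>
        (\<forall>Z\<in>unit_kernel (n - 1) n \<omega>. \<forall>\<theta>.
          (\<forall>\<theta>'<D. \<not> LCD_witness n \<gamma> (\<beta> * sqrt (real n)) Z \<theta>') \<longrightarrow>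
          D \<le> \<theta> \<longrightarrow> \<theta> < 2 * D \<longrightarrow> \<not> LCD_witness n \<gamma> (\<beta> * sqrt (real n)) Z \<theta>))"
      unfolding rn_def[symmetric] \<alpha>_def[symmetric]
    proof (intro bexI[OF _ E(1)] conjI ballI impI allI notI)
      have "1 / t\<^sup>2 * r\<^sup>2 = real n" using t by (simp add: r_def power_mult_distrib rn)
      then have "exp (real n) * (C1 * w) ^ n * (exp (1 / t\<^sup>2 * r\<^sup>2) * q ^ (n - 1))
          = exp (real n) * exp (real n) * ((C1 * w) ^ n * q ^ (n - 1))" by simp
      \<comment> \<open>The \<open>n\<close> coordinates of the count meet \<open>n - 1\<close>
        rows: one factor \<open>C1 w\<close> is left over.\<close>
      also have "(C1 * w) ^ n * q ^ (n - 1) = C1 * w * (C1 * w * q) ^ (n - 1)"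
        using n by (cases n) (simp_all add: power_mult_distrib)
      also have "C1 * w * q = exp (- 5)" using w G by (simp add: q_def)
      also have "exp (- 5) ^ (n - 1) = exp (5 - 5 * real n :: real)"
        using n by (simp add: of_nat_diff algebra_simps flip: exp_of_nat_mult)
      also have "exp (real n) * exp (real n) * (C1 * w * exp (5 - 5 * real n))
          \<le> exp (real n) * exp (real n) * (C1 * exp (real n) * exp (5 - 5 * real n))"
      proof (intro mult_left_mono mult_right_mono)
        have "c * real n \<le> 1 * real n" using c by (intro mult_right_mono) auto
        then have "exp (c * real n) \<le> exp (real n)" by simp
        then show "w \<le> exp (real n)" using w(3) D(2) by linarith
      qed (use C1 in auto)
      also have "\<dots> = C1 * (exp (real n) * exp (real n) * exp (real n) * exp (5 - 5 * real n))" by simp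
      also have "\<dots> = C1 * (exp 5 * exp (- 2 * real n))" by (simp flip: exp_add)
      finally show "measure (matrix_law (n - 1) n) E \<le> C1 * exp 5 * exp (- 2 * real n)"
        using E(2) by simp
      fix \<omega> Z \<theta>
      assume \<omega>: "\<omega> \<in> space (matrix_law (n - 1) n) - E"
        and op: "bounded_operator (n - 1) n (K * rn) \<omega>"
        and ker: "Z \<in> unit_kernel (n - 1) n \<omega>"
        and nw: "\<forall>\<theta>'<D. \<not> LCD_witness n \<gamma> \<alpha> Z \<theta>'"
        and th: "D \<le> \<theta>" "\<theta> < 2 * D" and wi: "LCD_witness n \<gamma> \<alpha> Z \<theta>"
      have Z: "vnorm n Z = 1" using ker by (simp add: unit_kernel_def)
      obtain p :: "nat \<Rightarrow> int" where p: "p \<in> {..<n} \<rightarrow>\<^sub>E UNIV" "vnorm n (\<lambda>j. \<theta> * Z j - of_int (p j)) \<le> \<alpha>"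
        "0 < vnorm n (\<lambda>j. of_int (p j))" "vnorm n (\<lambda>j. of_int (p j)) \<le> 2 * \<theta>"
        by (rule LCD_witness_int_vector[OF Z wi less_imp_le[OF g(2)]], rule that)
      have ok: "ok p Z" using Z nw th p by (auto simp: ok_def)
      have pT: "p \<in> T" using p th ok by (auto simp: T_def)
      let ?u = "\<lambda>j. real_of_int (p j) / vnorm n (\<lambda>j. of_int (p j))"
      have "vnorm n (\<lambda>j. Z j - x p j) = vnorm n (\<lambda>j. (Z j - ?u j) - (x p j - ?u j))" by simp
      also have "\<dots> \<le> vnorm n (\<lambda>j. Z j - ?u j) + vnorm n (\<lambda>j. x p j - ?u j)" by (rule vnorm_triangle_diff)
      also have "\<dots> \<le> 2 * \<alpha> / D + 2 * \<alpha> / D" using near[OF pT ok] near[OF pT x[OF pT]] by (rule add_mono)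
      finally have near4: "vnorm n (\<lambda>j. Z j - x p j) \<le> 4 * \<alpha> / D" by simp
      have "vnorm (n - 1) (\<lambda>i. \<Sum>j<n. x p j * \<omega> (i, j)) \<le> K * rn * (4 * \<alpha> / D)"
        using K rn(1) by (intro kernel_vector_image[OF op ker near4]) simp
      also have "\<dots> = r" by (simp add: r_def t_def \<alpha>_def)
      finally show False using out[OF \<omega> pT] by simp
    qed
  qed
qed

end

section \<open>Union over dyadic levels\<close>

theorem theorem7p1:
  fixes \<mu> :: "real measure"
  assumes "prob_space \<mu>"
    and "sets \<mu> = sets borel"
    and "subgaussian \<mu>"
    and "integrable \<mu> (\<lambda>x. x)" and "(\<integral>x. x \<partial>\<mu>) = 0"
    and "integrable \<mu> (\<lambda>x. x\<^sup>2)" and "(\<integral>x. x\<^sup>2 \<partial>\<mu>) = 1"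
  shows "\<exists>\<gamma> \<beta> c c' (n0::nat). 0 < \<gamma> \<and> \<gamma> < 1 \<and> \<beta> > 0 \<and> c > 0 \<and> c' > 0 \<and>
    (\<forall>n\<ge>n0. \<exists>A \<in> sets (PiM ({..<n-1} \<times> {..<n}) (\<lambda>_. \<mu>)).
       {\<omega> \<in> space (PiM ({..<n-1} \<times> {..<n}) (\<lambda>_. \<mu>)).
          \<exists>Z :: nat \<Rightarrow> real. vnorm n Z = 1 \<and>
            (\<forall>i<n-1. (\<Sum>j<n. Z j * \<omega> (i, j)) = 0) \<and>
            LCD n \<gamma> (\<beta> * sqrt (real n)) Z < ereal (exp (c * real n))} \<subseteq> A \<and>
       measure (PiM ({..<n-1} \<times> {..<n}) (\<lambda>_. \<mu>)) A \<le> exp (- c' * real n))"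
proof -
  interpret real_distribution \<mu>
    using assms(1,2) by (simp add: real_distribution_def real_distribution_axioms_def)
  note mom = assms(4-7)
  obtain C where C: "0 \<le> C" "\<And>s. (\<integral>\<^sup>+x. ennreal (exp (s * x)) \<partial>\<mu>) \<le> ennreal (exp (C * s\<^sup>2))"
    using subgaussian_mgf_bound[OF assms(3-5)] by blast
  define K where "K = 3 * (9 + 3 * C)"
  have K: "0 < K" using C(1) by (simp add: K_def)
  obtain \<delta> c0 \<gamma> where small: "0 < \<delta>" "0 < c0" "0 < \<gamma>" "\<gamma> < 1"
    "\<And>n. 0 < n \<Longrightarrow> \<exists>E \<in> sets (matrix_law (n - 1) n). measure (matrix_law (n - 1) n) E \<le> exp (4 * \<delta> - \<delta> * real n) \<and>
      (\<forall>\<omega>\<in>space (matrix_law (n - 1) n) - E.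
        bounded_operator (n - 1) n (K * sqrt (real n)) \<omega> \<longrightarrow>
        (\<forall>Z\<in>unit_kernel (n - 1) n \<omega>. \<forall>\<alpha> \<theta>.
          \<theta> \<le> c0 * sqrt (real n) \<longrightarrow> \<not> LCD_witness n \<gamma> \<alpha> Z \<theta>))"
    by (rule small_denominator_event[OF C mom K], rule that)
  obtain \<beta> c C2 n1 where level: "0 < \<beta>" "0 < c" "c \<le> 1" "0 < C2"
    "\<And>n D. \<lbrakk>n1 \<le> n; c0 * sqrt (real n) \<le> D; D \<le> exp (c * real n)\<rbrakk> \<Longrightarrow>
      \<exists>E \<in> sets (matrix_law (n - 1) n). measure (matrix_law (n - 1) n) E \<le> C2 * exp (- 2 * real n) \<and>
      (\<forall>\<omega>\<in>space (matrix_law (n - 1) n) - E.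
        bounded_operator (n - 1) n (K * sqrt (real n)) \<omega> \<longrightarrow>
        (\<forall>Z\<in>unit_kernel (n - 1) n \<omega>. \<forall>\<theta>.
          (\<forall>\<theta>'<D. \<not> LCD_witness n \<gamma> (\<beta> * sqrt (real n)) Z \<theta>') \<longrightarrow>
          D \<le> \<theta> \<longrightarrow> \<theta> < 2 * D \<longrightarrow> \<not> LCD_witness n \<gamma> (\<beta> * sqrt (real n)) Z \<theta>))"
    by (rule level_set_event[OF mom K small(3,4,2)], rule that)
  \<comment> \<open>All events decay at rate at least \<open>2 c'\<close>; half of it absorbs the
    constants collected in \<open>H\<close>.\<close>
  define c' where "c' = min \<delta> 1 / 2"
  have c': "0 < c'" "2 * c' \<le> \<delta>" "2 * c' \<le> 1" using small(1) by (auto simp: c'_def)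
  define H where "H = 1 + exp (4 * \<delta>) + 3 * C2"
  \<comment> \<open>The two ceilings ensure \<open>c0 sqrt n >= 1\<close> and
    \<open>H <= c' n\<close>.\<close>
  define n0 where "n0 = n1 + 1 + nat \<lceil>(1 / c0)\<^sup>2\<rceil> + nat \<lceil>H / c'\<rceil>"
  have "\<exists>A \<in> sets (matrix_law (n - 1) n).
      {\<omega> \<in> space (matrix_law (n - 1) n). \<exists>Z. vnorm n Z = 1 \<and> (\<forall>i<n - 1. (\<Sum>j<n. Z j * \<omega> (i, j)) = 0) \<and>
            LCD n \<gamma> (\<beta> * sqrt (real n)) Z < ereal (exp (c * real n))} \<subseteq> A \<and>
      measure (matrix_law (n - 1) n) A \<le> exp (- c' * real n)" if n0: "n0 \<le> n" for n
  proof -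
    interpret P: prob_space "matrix_law (n - 1) n" by (rule prob_space_matrix_law)
    have n: "0 < n" "n1 \<le> n" using n0 by (auto simp: n0_def)
    have c0n: "1 \<le> c0 * sqrt (real n)"
    proof -
      have "(1 / c0)\<^sup>2 \<le> real n" using n0 unfolding n0_def by linarith
      then have "1 / c0 \<le> sqrt (real n)" by (rule real_le_rsqrt)
      then show ?thesis using small(2) by (simp add: field_simps)
    qed
    have Hn: "H \<le> exp (c' * real n)"
    proof -
      have "H / c' \<le> real n" using n0 unfolding n0_def by linarith
      then have "H \<le> c' * real n" using c'(1) by (simp add: field_simps)
      then show ?thesis using exp_ge_add_one_self[of "c' * real n"] by linarith
    qed
    define D where "D k = c0 * sqrt (real n) * 2 ^ k" for k :: nat
    obtain E0 where E0: "E0 \<in> sets (matrix_law (n - 1) n)" "measure (matrix_law (n - 1) n) E0 \<le> exp (- real n)"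
      and op: "\<And>\<omega>. \<omega> \<in> space (matrix_law (n - 1) n) - E0 \<Longrightarrow> bounded_operator (n - 1) n (K * sqrt (real n)) \<omega>"
      by (rule operator_norm_event[OF C(2,1) diff_le_self n(1), folded K_def], rule that)
    obtain E1 where E1: "E1 \<in> sets (matrix_law (n - 1) n)" "measure (matrix_law (n - 1) n) E1 \<le> exp (4 * \<delta> - \<delta> * real n)"
      and sm: "\<And>\<omega> Z \<alpha> \<theta>. \<lbrakk>\<omega> \<in> space (matrix_law (n - 1) n) - E1;
          bounded_operator (n - 1) n (K * sqrt (real n)) \<omega>; Z \<in> unit_kernel (n - 1) n \<omega>; \<theta> \<le> c0 * sqrt (real n)\<rbrakk> \<Longrightarrow> \<not> LCD_witness n \<gamma> \<alpha> Z \<theta>"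
      using small(5)[OF n(1)] by blast
    \<comment> \<open>Levels beyond \<open>exp (c n)\<close> carry no claim and receive the empty
      event, so that an event exists for every \<open>k\<close>.\<close>
    define lvl where "lvl k E \<longleftrightarrow> E \<in> sets (matrix_law (n - 1) n) \<and> measure (matrix_law (n - 1) n) E \<le> C2 * exp (- 2 * real n) \<and>
      (D k \<le> exp (c * real n) \<longrightarrow> (\<forall>\<omega>\<in>space (matrix_law (n - 1) n) - E. bounded_operator (n - 1) n (K * sqrt (real n)) \<omega> \<longrightarrow>
        (\<forall>Z\<in>unit_kernel (n - 1) n \<omega>. \<forall>\<theta>.
          (\<forall>\<theta>'<D k. \<not> LCD_witness n \<gamma> (\<beta> * sqrt (real n)) Z \<theta>') \<longrightarrow>
          D k \<le> \<theta> \<longrightarrow> \<theta> < 2 * D k \<longrightarrow> \<not> LCD_witness n \<gamma> (\<beta> * sqrt (real n)) Z \<theta>)))" for k E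
    have "\<exists>E. lvl k E" for k
    proof (cases "D k \<le> exp (c * real n)")
      case True
      have "c0 * sqrt (real n) * 1 \<le> D k"
        unfolding D_def using small(2) by (intro mult_left_mono) auto
      then have "c0 * sqrt (real n) \<le> D k" by simp
      from level(5)[OF n(2) this True] show ?thesis unfolding lvl_def by blast
    next
      case False
      then have "lvl k {}" using level(4) by (simp add: lvl_def)
      then show ?thesis by blast
    qed
    then obtain E2 where lvl: "\<And>k. lvl k (E2 k)" by metis
    have E2: "E2 k \<in> sets (matrix_law (n - 1) n)" "measure (matrix_law (n - 1) n) (E2 k) \<le> C2 * exp (- 2 * real n)" for k
      using lvl[of k] unfolding lvl_def by blast+
    \<comment> \<open>A measurable superset, as the event itself ranges over uncountably many
      \<open>Z\<close>. The number of levels is linear in \<open>n\<close>, which the rate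
      \<open>exp (- 2 n)\<close> of each level outweighs.\<close>
    define A where "A = (E0 \<union> E1) \<union> (\<Union>k<2 * n + 1. E2 k)"
    have A: "A \<in> sets (matrix_law (n - 1) n)" unfolding A_def using E0(1) E1(1) E2(1) by auto
    have "measure (matrix_law (n - 1) n) A \<le> measure (matrix_law (n - 1) n) (E0 \<union> E1) + measure (matrix_law (n - 1) n) (\<Union>k<2 * n + 1. E2 k)"
      unfolding A_def using E0(1) E1(1) E2(1) by (intro measure_Un_le) auto
    also have "\<dots> \<le> (exp (- real n) + exp (4 * \<delta> - \<delta> * real n)) + (\<Sum>k<2 * n + 1. C2 * exp (- 2 * real n))"
    proof (intro add_mono)
      show "measure (matrix_law (n - 1) n) (E0 \<union> E1) \<le> exp (- real n) + exp (4 * \<delta> - \<delta> * real n)"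
        using measure_Un_le[OF E0(1) E1(1)] E0(2) E1(2) by linarith
      have "measure (matrix_law (n - 1) n) (\<Union>k<2 * n + 1. E2 k) \<le> (\<Sum>k<2 * n + 1. measure (matrix_law (n - 1) n) (E2 k))"
        using E2(1) by (intro P.finite_measure_subadditive_finite) auto
      also have "\<dots> \<le> (\<Sum>k<2 * n + 1. C2 * exp (- 2 * real n))" by (intro sum_mono E2(2))
      finally show "measure (matrix_law (n - 1) n) (\<Union>k<2 * n + 1. E2 k) \<le> (\<Sum>k<2 * n + 1. C2 * exp (- 2 * real n))" .
    qed
    also have "\<dots> \<le> (exp (- (2 * c' * real n)) + exp (4 * \<delta>) * exp (- (2 * c' * real n))) + 3 * C2 * exp (- (2 * c' * real n))"
    proof (intro add_mono)
      have e1: "exp (- real n) \<le> exp (- (2 * c' * real n))"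
        using c'(3) mult_right_mono[of "2 * c'" 1 "real n"] by simp
      then show "exp (- real n) \<le> exp (- (2 * c' * real n))" .
      have "4 * \<delta> - \<delta> * real n \<le> 4 * \<delta> + - (2 * c' * real n)"
        using mult_right_mono[OF c'(2), of "real n"] by simp
      then show "exp (4 * \<delta> - \<delta> * real n) \<le> exp (4 * \<delta>) * exp (- (2 * c' * real n))"
        by (simp only: exp_le_cancel_iff flip: exp_add)
      have "real (2 * n + 1) \<le> 3 * exp (real n)"
        using exp_ge_add_one_self[of "real n"] n(1) by (simp del: exp_ge_add_one_self)
      then have "real (2 * n + 1) * (C2 * exp (- 2 * real n)) \<le> 3 * exp (real n) * (C2 * exp (- 2 * real n))"
        using level(4) by (intro mult_right_mono) auto
      also have "\<dots> = 3 * C2 * (exp (real n) * exp (- 2 * real n))" by simp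
      also have "exp (real n) * exp (- 2 * real n) = exp (- real n)" by (simp flip: exp_add)
      also have "3 * C2 * exp (- real n) \<le> 3 * C2 * exp (- (2 * c' * real n))"
        using e1 level(4) by (intro mult_left_mono) auto
      finally show "(\<Sum>k<2 * n + 1. C2 * exp (- 2 * real n)) \<le> 3 * C2 * exp (- (2 * c' * real n))" by simp
    qed
    also have "\<dots> = H * exp (- (2 * c' * real n))" by (simp add: H_def distrib_right)
    also have "\<dots> \<le> exp (c' * real n) * exp (- (2 * c' * real n))" using Hn by (intro mult_right_mono) auto
    also have "\<dots> = exp (- c' * real n)" by (simp flip: exp_add)
    finally have mA: "measure (matrix_law (n - 1) n) A \<le> exp (- c' * real n)" .
    have False if \<omega>: "\<omega> \<in> space (matrix_law (n - 1) n)" "\<omega> \<notin> A" and Z: "vnorm n Z = 1"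
        and ker: "\<forall>i<n - 1. (\<Sum>j<n. Z j * \<omega> (i, j)) = 0"
        and lcd: "LCD n \<gamma> (\<beta> * sqrt (real n)) Z < ereal (exp (c * real n))" for \<omega> Z
    proof -
      let ?W = "LCD_witness n \<gamma> (\<beta> * sqrt (real n)) Z"
      obtain \<theta> where \<theta>: "\<theta> < exp (c * real n)" "?W \<theta>" using lcd by (auto simp: LCD_less_iff)
      have opn: "bounded_operator (n - 1) n (K * sqrt (real n)) \<omega>"
        using \<omega> by (intro op) (auto simp: A_def)
      have kerZ: "Z \<in> unit_kernel (n - 1) n \<omega>" using Z ker by (simp add: unit_kernel_def)
      have nosmall: "\<not> ?W \<theta>'" if "\<theta>' \<le> c0 * sqrt (real n)" for \<theta>'
        using sm[OF _ opn kerZ that] \<omega> by (auto simp: A_def)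
      \<comment> \<open>A least level replaces a least witness, since the set of witnesses need not
        have a minimum.\<close>
      define Pk where "Pk k \<longleftrightarrow> (\<exists>\<theta>'. \<theta>' < 2 * D k \<and> ?W \<theta>')" for k
      obtain k0 :: nat where "\<theta> < 2 ^ k0" using real_arch_pow[of 2 \<theta>] by auto
      also have "2 ^ k0 \<le> 2 * D k0"
      proof -
        have "1 * 2 ^ k0 \<le> D k0" unfolding D_def using c0n by (intro mult_right_mono) auto
        moreover have "0 \<le> D k0" using small(2) by (simp add: D_def)
        ultimately show ?thesis by simp
      qed
      finally have "Pk k0" using \<theta>(2) by (auto simp: Pk_def)
      define k where "k = (LEAST k. Pk k)"
      have Pk: "Pk k" unfolding k_def using \<open>Pk k0\<close> by (rule LeastI)
      \<comment> \<open>Level 0 rests on the small-denominator event; above it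
        \<open>2 * D l = D (Suc l)\<close>, so minimality of \<open>k\<close> applies.\<close>
      have below: "\<forall>\<theta>'<D k. \<not> ?W \<theta>'"
      proof (cases k)
        case 0
        then show ?thesis using nosmall by (simp add: D_def)
      next
        case (Suc l)
        then have "\<not> Pk l" unfolding k_def by (intro not_less_Least) simp
        then show ?thesis using Suc by (auto simp: Pk_def D_def)
      qed
      obtain \<theta>' where t': "\<theta>' < 2 * D k" "?W \<theta>'" using Pk by (auto simp: Pk_def)
      have ge: "D k \<le> u" if "?W u" for u using below that by (meson not_le)
      have Dk: "D k \<le> \<theta>'" "D k \<le> exp (c * real n)" using ge[OF t'(2)] ge[OF \<theta>(2)] \<theta>(1) by linarith+
      \<comment> \<open>\<open>2 ^ k <= D k <= exp n\<close> because \<open>c0 sqrt n >= 1\<close>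
        and \<open>c <= 1\<close>, while \<open>2 ^ (2 * n) = 4 ^ n\<close> exceeds
        \<open>exp n\<close>.\<close>
      have "k < 2 * n + 1"
      proof (rule ccontr)
        assume "\<not> k < 2 * n + 1"
        then have "(2::real) ^ (2 * n) \<le> 2 ^ k" by (intro power_increasing) auto
        also have "\<dots> \<le> D k" unfolding D_def using c0n mult_right_mono[of 1 "c0 * sqrt (real n)" "2 ^ k"] by simp
        also have "\<dots> \<le> exp (c * real n)" by (rule Dk(2))
        also have "\<dots> \<le> exp (1 * real n)" using mult_right_mono[OF level(3), of "real n"] by simp
        also have "\<dots> = exp 1 ^ n" by (simp flip: exp_of_nat_mult)
        also have "\<dots> < 4 ^ n" using exp_le n(1) by (intro power_strict_mono) auto
        finally show False by (simp add: power_mult)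
      qed
      then have "\<omega> \<in> space (matrix_law (n - 1) n) - E2 k" using \<omega> by (auto simp: A_def)
      then show False using lvl[of k] Dk t' opn kerZ below unfolding lvl_def by blast
    qed
    then have "{\<omega> \<in> space (matrix_law (n - 1) n). \<exists>Z. vnorm n Z = 1 \<and> (\<forall>i<n - 1. (\<Sum>j<n. Z j * \<omega> (i, j)) = 0) \<and>
            LCD n \<gamma> (\<beta> * sqrt (real n)) Z < ereal (exp (c * real n))} \<subseteq> A" by blast
    then show ?thesis using A mA by blast
  qed
  then have "\<forall>n\<ge>n0. \<exists>A \<in> sets (matrix_law (n - 1) n).
      {\<omega> \<in> space (matrix_law (n - 1) n). \<exists>Z. vnorm n Z = 1 \<and> (\<forall>i<n - 1. (\<Sum>j<n. Z j * \<omega> (i, j)) = 0) \<and>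
            LCD n \<gamma> (\<beta> * sqrt (real n)) Z < ereal (exp (c * real n))} \<subseteq> A \<and>
      measure (matrix_law (n - 1) n) A \<le> exp (- c' * real n)" by blast
  then show ?thesis using small(3,4) level(1,2) c'(1) by blast
qed

end
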